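(* Let $$f(x)=\sum_{j=t_1}^\infty c_{j,1}P_{j,1}(x)+\sum_{j=t_2}^\infty c_{j,2}P_{j,2}(x)+\sum_{j=t_3}^\infty c_{j,3}P_{j,3}(x)$$ be an entire analytic function on $SG$, where $t_1,t_2,t_3\ge0$ are integers and $c_{t_1,1},c_{t_2,2},c_{t_3,3}$ are nonzero, and let $Z$ be the zero set of $f$. (a) If $t_3<t_1-1$ and $t_3<t_2$, then $f$ has infinitely many zeros, having $q_0$ as a limit point. (b) Suppose that $P_{j,1}(x)>0$ for all $x\in SG\setminus\{q_0\}$ and all $j>0$. If $t_1\le t_2$ and $t_1\le t_3$, then $q_0$ has a neighborhood $U$ such that $Z\cap U\subset\{q_0\}$.
   Context: Sierpinski gasket: let $q_0=(\tfrac12,\tfrac{\sqrt3}{2})$, $q_1=(0,0)$, $q_2=(1,0)$, $V_0=\{q_0,q_1,q_2\}$, $F_i(x)=\tfrac12(x-q_i)+q_i$, and let $SG\subset\mathbb R^2$ be the unique nonempty compact set with $SG=\bigcup_{i=0}^2F_i(SG)$. For a word $w=(w_1,\dots,w_m)\in\{0,1,2\}^m$, $|w|=m$, put $F_w=F_{w_1}\circ\cdots\circ F_{w_m}$; $F_w(SG)$ is called an $m$-cell; $V_m=\bigcup_{|w|=m}F_w(V_0)$; distinct $x,y\in V_m$ satisfy $x\sim_m y$ if they lie in a common $m$-cell. $\mu$ is the self-similar Borel probability measure with $\mu(F_w(SG))=3^{-|w|}$. All functions are real-valued. Energy and Laplacian: $\mathscr E(u,v)=\lim_{m\to\infty}(3/5)^{-m}\sum_{x\sim_m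 y}(u(x)-u(y))(v(x)-v(y))$ (sum over unordered pairs), and $u\in\operatorname{dom}\mathscr E$ if $\mathscr E(u,u)$ exists and is finite. For $u\in\operatorname{dom}\mathscr E$ and $f$ continuous, $\Delta u=f$ means $\mathscr E(u,v)=-\int_{SG}fv\,d\mu$ for all $v\in\operatorname{dom}\mathscr E$ vanishing on $V_0$. Indices of $q_i$ are mod 3. Normal derivative: $\partial_nu(q_i)=\lim_m(5/3)^m(2u(q_i)-u(F_i^mq_{i+1})-u(F_i^mq_{i-1}))$. Tangential derivative: $\partial_Tu(q_i)=\lim_m5^m(u(F_i^mq_{i+1})-u(F_i^mq_{i-1}))$. Monomials: for $j\ge0$, $k\in\{1,2,3\}$, $P_{j,k}$ is the unique function with $\Delta^{j+1}P_{j,k}=0$ such that for all $0\le n\le j$: $\Delta^nP_{j,k}(q_0)=\delta_{nj}\delta_{k1}$, $\partial_n\Delta^nP_{j,k}(q_0)=\delta_{nj}\delta_{k2}$, $\partial_T\Delta^nP_{j,k}(q_0)=\delta_{nj}\delta_{k3}$. Entire analytic function: a function defined by a power series $\sum_{k=1}^3\sum_{j=0}^\infty c_{j,k}P_{j,k}(x)$ with real coefficients such that $|c_{j,k}|=O(R^j)$ as $j\to\infty$ for some $R<\lambda_2$, where $\lambda_2=135.572126995788\ldots$ is the second nonzero Neumann eigenvalue of $-\Delta$ (eigenvalues counted without multiplicity; Neumann means vanishing normal derivatives at $V_0$). *)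

theory Defs
  imports "HOL-Probability.Probability" "HOL-Library.Landau_Symbols"
begin

(* The Sierpinski gasket lives in real \<times> real (Euclidean norm).  Functions on SG are modelled as
   functions on the whole plane of which only the values on SG are ever looked at. *)
type_synonym point = "real \<times> real"

section \<open>The gasket\<close>

(* Indices are read mod 3, so corner (i + 2) is q_{i-1}. *)
definition corner :: "nat \<Rightarrow> point" where
  "corner i = (if i mod 3 = 0 then (1/2, sqrt 3 / 2) else if i mod 3 = 1 then (0, 0) else (1, 0))"

definition V0 :: "point set" where
  "V0 = {corner 0, corner 1, corner 2}"

definition sgmap :: "nat \<Rightarrow> point \<Rightarrow> point" where
  "sgmap i x = (1/2) *\<^sub>R (x - corner i) + corner i"

definition SG :: "point set" where
  "SG = (THE K. K \<noteq> {} \<and> compact K \<and> K = (\<Union>i<3. sgmap i ` K))"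

definition words :: "nat \<Rightarrow> nat list set" where
  "words m = {w. length w = m \<and> set w \<subseteq> {..<3}}"

primrec wordmap :: "nat list \<Rightarrow> point \<Rightarrow> point" where
  "wordmap [] = id"
| "wordmap (i # w) = sgmap i \<circ> wordmap w"

definition cell :: "nat list \<Rightarrow> point set" where
  "cell w = wordmap w ` SG"

definition V :: "nat \<Rightarrow> point set" where
  "V m = (\<Union>w\<in>words m. wordmap w ` V0)"

definition adj :: "nat \<Rightarrow> point \<Rightarrow> point \<Rightarrow> bool" where
  "adj m x y \<longleftrightarrow> x \<in> V m \<and> y \<in> V m \<and> x \<noteq> y \<and> (\<exists>w\<in>words m. x \<in> cell w \<and> y \<in> cell w)"

(* Realised as a Borel measure on the plane; it is carried by SG = cell []. *)
definition sg_measure :: "point measure" where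
  "sg_measure = (THE M. prob_space M \<and> sets M = sets borel \<and>
     (\<forall>m. \<forall>w\<in>words m. measure M (cell w) = (1/3) ^ m))"

section \<open>Energy, Laplacian and boundary derivatives\<close>

(* The factor 1/2 turns the sum over ordered pairs into the sum over unordered pairs. *)
definition graph_energy :: "nat \<Rightarrow> (point \<Rightarrow> real) \<Rightarrow> (point \<Rightarrow> real) \<Rightarrow> real" where
  "graph_energy m u v = inverse ((3/5) ^ m) *
     ((1/2) * (\<Sum>(x, y) \<in> {(x, y). adj m x y}. (u x - u y) * (v x - v y)))"

definition energy :: "(point \<Rightarrow> real) \<Rightarrow> (point \<Rightarrow> real) \<Rightarrow> real" where
  "energy u v = lim (\<lambda>m. graph_energy m u v)"

(* As usual, the domain of the energy consists of continuous functions: the energy only sees the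
   mu-null set of vertices, on which a function of finite energy is uniformly continuous, so such a
   function is determined on SG by its unique continuous extension. *)
definition domE :: "(point \<Rightarrow> real) set" where
  "domE = {u. continuous_on SG u \<and> convergent (\<lambda>m. graph_energy m u u)}"

(* Delta u = f *)
definition has_laplacian :: "(point \<Rightarrow> real) \<Rightarrow> (point \<Rightarrow> real) \<Rightarrow> bool" where
  "has_laplacian u f \<longleftrightarrow> u \<in> domE \<and> continuous_on SG f \<and>
     (\<forall>v\<in>domE. (\<forall>x\<in>V0. v x = 0) \<longrightarrow>
        energy u v = - (LINT x:SG|sg_measure. f x * v x))"

(* Delta^n u = f *)
primrec has_laplacian_pow :: "nat \<Rightarrow> (point \<Rightarrow> real) \<Rightarrow> (point \<Rightarrow> real) \<Rightarrow> bool" where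
  "has_laplacian_pow 0 u f \<longleftrightarrow> (\<forall>x\<in>SG. u x = f x)"
| "has_laplacian_pow (Suc n) u f \<longleftrightarrow> (\<exists>g. has_laplacian u g \<and> has_laplacian_pow n g f)"

definition has_normal_deriv :: "(point \<Rightarrow> real) \<Rightarrow> nat \<Rightarrow> real \<Rightarrow> bool" where
  "has_normal_deriv u i d \<longleftrightarrow>
     (\<lambda>m. (5/3) ^ m * (2 * u (corner i) - u ((sgmap i ^^ m) (corner (i + 1)))
                                        - u ((sgmap i ^^ m) (corner (i + 2))))) \<longlonglongrightarrow> d"

definition has_tangential_deriv :: "(point \<Rightarrow> real) \<Rightarrow> nat \<Rightarrow> real \<Rightarrow> bool" where
  "has_tangential_deriv u i d \<longleftrightarrow>
     (\<lambda>m. 5 ^ m * (u ((sgmap i ^^ m) (corner (i + 1)))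
                 - u ((sgmap i ^^ m) (corner (i + 2))))) \<longlonglongrightarrow> d"

section \<open>Monomials\<close>

definition is_monomial :: "nat \<Rightarrow> nat \<Rightarrow> (point \<Rightarrow> real) \<Rightarrow> bool" where
  "is_monomial j k u \<longleftrightarrow> has_laplacian_pow (Suc j) u (\<lambda>x. 0) \<and>
     (\<forall>n\<le>j. \<exists>g. has_laplacian_pow n u g \<and>
        g (corner 0) = of_bool (n = j \<and> k = 1) \<and>
        has_normal_deriv g 0 (of_bool (n = j \<and> k = 2)) \<and>
        has_tangential_deriv g 0 (of_bool (n = j \<and> k = 3)))"

(* Uniqueness holds for functions on SG, hence the normalisation off SG. *)
definition P :: "nat \<Rightarrow> nat \<Rightarrow> point \<Rightarrow> real" where
  "P j k = (THE u. is_monomial j k u \<and> (\<forall>x. x \<notin> SG \<longrightarrow> u x = 0))"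

section \<open>Entire analytic functions\<close>

definition neumann_eigenvalue :: "real \<Rightarrow> bool" where
  "neumann_eigenvalue l \<longleftrightarrow> (\<exists>u. (\<exists>x\<in>SG. u x \<noteq> 0) \<and> has_laplacian u (\<lambda>x. - l * u x) \<and>
     (\<forall>i<3. has_normal_deriv u i 0))"

definition lambda1 :: real where
  "lambda1 = (LEAST l. neumann_eigenvalue l \<and> l \<noteq> 0)"

definition lambda2 :: real where
  "lambda2 = (LEAST l. neumann_eigenvalue l \<and> l \<noteq> 0 \<and> l \<noteq> lambda1)"

definition entire_coeffs :: "(nat \<Rightarrow> nat \<Rightarrow> real) \<Rightarrow> bool" where
  "entire_coeffs c \<longleftrightarrow> (\<exists>R. 0 < R \<and> R < lambda2 \<and> (\<forall>k\<in>{1,2,3}. (\<lambda>j. c j k) \<in> O(\<lambda>j. R ^ j)))"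

(* f is the entire analytic function on SG with coefficients c j k. *)
definition entire_analytic :: "(nat \<Rightarrow> nat \<Rightarrow> real) \<Rightarrow> (point \<Rightarrow> real) \<Rightarrow> bool" where
  "entire_analytic c f \<longleftrightarrow> entire_coeffs c \<and>
     (\<forall>x\<in>SG. (\<forall>k\<in>{1,2,3}. summable (\<lambda>j. c j k * P j k x)) \<and>
        f x = (\<Sum>k\<in>{1,2,3}. \<Sum>j. c j k * P j k x))"

end

theory Submission
  imports Defs
begin

text \<open>The monomials are eigenfunctions of the contraction \<open>F\<^sub>0\<close> at \<open>q\<^sub>0\<close>:
  \<open>P\<^bsub>j,k\<^esub> \<circ> F\<^sub>0 = s\<^sub>k 5\<^bsup>-j\<^esup> P\<^bsub>j,k\<^esub>\<close> with \<open>s\<^sub>1 = 1\<close>,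
  \<open>s\<^sub>2 = 3/5\<close>, \<open>s\<^sub>3 = 1/5\<close>, and \<open>\<bar>P\<^bsub>j,k\<^esub>\<bar> \<le> 13\<^bsup>j\<^esup>\<close> on the gasket.
  Hence on \<open>F\<^sub>0\<^sup>m(SG)\<close>, for large \<open>m\<close>, the leading monomial with the largest scaling factor
  dominates all other terms of the series, uniformly. In (a) it is some \<open>P\<^bsub>j,3\<^esub>\<close>, which is
  antisymmetric about the axis through \<open>q\<^sub>0\<close>, so that \<open>f\<close> changes sign on the connected set
  \<open>F\<^sub>0\<^sup>m(F\<^sub>1(SG) \<union> F\<^sub>2(SG))\<close>; in (b) it is some \<open>P\<^bsub>j,1\<^esub>\<close>, which is bounded away
  from 0 on \<open>F\<^sub>1(SG) \<union> F\<^sub>2(SG)\<close>.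

  To construct the monomials, the weak equation \<open>\<Delta> u = g\<close> is shown to be equivalent to linear equations
  for the values of \<open>u\<close> at the three midpoints of each cell. These equations are self-similar; they are
  solved cell by cell, with a contraction by the factor \<open>3/5\<close> from one level to the next.\<close>

section \<open>Barycentric coordinates\<close>

text \<open>\<open>SG\<close>, \<open>sg_measure\<close> and \<open>P j k\<close> are definite
  descriptions and iterated Laplacians are a relation, so existence and uniqueness come before any
  computation. Testing the weak equation with a tent in one cell gives an equation for its three
  midpoints that corner values and data solve explicitly; this serves existence and uniqueness
  alike. Energy scales by 5/3 and mass by 1/3 under passage to a cell, so the Laplacian scales by
  1/5 = (3/5)(1/3). This factor lets the sources decay along words and turns the series on
  \<open>F_0^m(SG)\<close> into a power series in 5^-m, where a geometric bound on the monomials is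
  enough; 13 rounds up the 12.5 that one Poisson step costs. The number 3/5 occurs in two roles: as
  the symmetric eigenvalue of harmonic restriction, which governs the convergence of solutions, and
  as the largest quotient of a competing scaling factor by the leading one that the hypotheses of
  (a) and of (b) allow.\<close>

lemma less_3_iff: "(i::nat) < 3 \<longleftrightarrow> i = 0 \<or> i = 1 \<or> i = 2"
  by auto

lemma all_less_3: "(\<forall>i<3. Q i) \<longleftrightarrow> Q 0 \<and> Q 1 \<and> Q (2::nat)"
  by (auto simp: less_3_iff)

lemma sum_less_3: "(\<Sum>i<3. g i) = g 0 + g 1 + g (2::nat)"
  by (simp add: eval_nat_numeral)

text \<open>In these coordinates \<open>sgmap j\<close> halves every entry and adds 1/2 to entry j,
  so where cells lie and meet becomes linear arithmetic.\<close>

definition bary :: "nat \<Rightarrow> point \<Rightarrow> real" where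
  "bary i x = (if i mod 3 = 0 then 2 * snd x / sqrt 3
     else if i mod 3 = 1 then 1 - fst x - snd x / sqrt 3 else fst x - snd x / sqrt 3)"

lemma bary_corner: "i < 3 \<Longrightarrow> j < 3 \<Longrightarrow> bary i (corner j) = of_bool (i = j)"
  by (auto simp: less_3_iff bary_def corner_def)

lemma bary_sgmap:
  "i < 3 \<Longrightarrow> j < 3 \<Longrightarrow> bary i (sgmap j x) = (bary i x + of_bool (i = j)) / 2"
  by (auto simp: less_3_iff bary_def corner_def sgmap_def field_simps)

lemma bary_sum: "bary 0 x + bary 1 x + bary 2 x = 1"
  by (simp add: bary_def)

lemma bary_eqI:
  assumes "\<And>i. i < 3 \<Longrightarrow> bary i x = bary i y"
  shows "x = y"
  using assms[of 0] assms[of 1] by (simp add: bary_def prod_eq_iff)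

lemma continuous_on_bary [continuous_intros]: "continuous_on S (bary i)"
  unfolding bary_def by (cases "i mod 3 = 0"; cases "i mod 3 = 1") (simp; intro continuous_intros; simp)+

lemma inj_sgmap: "inj (sgmap i)"
  by (auto simp: inj_def sgmap_def)

lemma sgmap_eq_iff [simp]: "sgmap i x = sgmap i y \<longleftrightarrow> x = y"
  using inj_sgmap[of i] by (auto dest: injD)

lemma sgmap_corner [simp]: "sgmap i (corner i) = corner i"
  by (simp add: sgmap_def)

lemma sgmap_corner_commute: "sgmap i (corner j) = sgmap j (corner i)"
  by (simp add: sgmap_def algebra_simps)
     (metis scaleR_half_double scaleR_right_distrib add.commute)

lemma dist_sgmap: "dist (sgmap i x) (sgmap i y) = dist x y / 2"
proof -
  have "sgmap i x - sgmap i y = (1/2) *\<^sub>R (x - y)"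
    by (simp add: sgmap_def scaleR_right_diff_distrib)
  then show ?thesis by (simp add: dist_norm)
qed

lemma continuous_on_sgmap [continuous_intros]: "continuous_on S (sgmap i)"
  unfolding sgmap_def by (intro continuous_intros)

definition sginv :: "nat \<Rightarrow> point \<Rightarrow> point" where
  "sginv i x = 2 *\<^sub>R x - corner i"

lemma sginv_sgmap [simp]: "sginv i (sgmap i x) = x"
  by (simp add: sginv_def sgmap_def algebra_simps scaleR_2)

lemma continuous_on_sginv [continuous_intros]: "continuous_on S (sginv i)"
  unfolding sginv_def by (intro continuous_intros)

lemma sgmap_mod: "sgmap (i mod 3) = sgmap i" and corner_mod: "corner (i mod 3) = corner i"
  by (auto simp: sgmap_def corner_def fun_eq_iff)

text \<open>Numbered by the opposite corner; together with the corners these are all vertices of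
  level 1.\<close>

definition midpt :: "nat \<Rightarrow> point" where
  "midpt k = sgmap (k + 1) (corner (k + 2))"

lemma sgmap_corner_midpt:
  assumes "i < 3" "j < 3" "i \<noteq> j"
  shows "sgmap i (corner j) = midpt (3 - i - j)"
proof -
  have "corner 3 = corner 0" "corner 4 = corner 1" "sgmap 3 = sgmap 0"
    by (simp_all add: corner_def sgmap_def fun_eq_iff)
  then have "sgmap 1 (corner 2) = midpt 0" "sgmap 2 (corner 0) = midpt 1" "sgmap 0 (corner 1) = midpt 2"
    by (simp_all add: midpt_def numeral_eq_Suc)
  moreover from this
  have "sgmap 2 (corner 1) = midpt 0" "sgmap 0 (corner 2) = midpt 1" "sgmap 1 (corner 0) = midpt 2"
    by (metis sgmap_corner_commute)+
  ultimately show ?thesis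
    using assms by (auto simp: less_3_iff)
qed

section \<open>The gasket\<close>

text \<open>The largest distance from a point of \<open>K\<close> to \<open>L\<close> is attained in
  some cell, where it is at most half of such a distance, so it is 0. One inclusion is stated
  because the hypotheses are symmetric; it also serves the reflection.\<close>

lemma similar_sets_unique:
  assumes K: "K \<noteq> {}" "compact K" "K = (\<Union>i<3. sgmap i ` K)"
    and L: "L \<noteq> {}" "compact L" "L = (\<Union>i<3. sgmap i ` L)"
  shows "K \<subseteq> L"
proof -
  obtain x where x: "x \<in> K" "\<And>y. y \<in> K \<Longrightarrow> infdist y L \<le> infdist x L"
    using continuous_attains_sup[OF K(2,1), of "\<lambda>y. infdist y L"]
      continuous_on_infdist[OF continuous_on_id, of K L] by blast
  obtain i y where iy: "i < 3" "y \<in> K" "x = sgmap i y"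
    using x(1) by (subst (asm) K(3)) auto
  obtain z where z: "z \<in> L" "infdist y L = dist y z"
    using infdist_attains_inf[of L y] L compact_imp_closed by blast
  have "sgmap i z \<in> L"
    using z iy by (subst L(3)) auto
  then have "infdist x L \<le> dist x (sgmap i z)"
    by (rule infdist_le)
  also have "\<dots> = infdist y L / 2"
    by (simp add: z iy dist_sgmap)
  also have "\<dots> \<le> infdist x L / 2"
    using x iy by auto
  finally have "infdist x L = 0"
    using infdist_nonneg[of x L] by linarith
  show ?thesis
  proof
    fix y assume "y \<in> K"
    then have "infdist y L = 0"
      using x(2)[of y] \<open>infdist x L = 0\<close> infdist_nonneg[of y L] by simp
    then show "y \<in> L"
      using in_closed_iff_infdist_zero[of L y] L compact_imp_closed by auto
  qed
qed

definition triangle :: "point set" where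
  "triangle = {x. \<forall>i<3. 0 \<le> bary i x}"

primrec pregasket :: "nat \<Rightarrow> point set" where
  "pregasket 0 = triangle"
| "pregasket (Suc n) = (\<Union>i<3. sgmap i ` pregasket n)"

lemma compact_triangle: "compact triangle"
proof -
  have "triangle \<subseteq> cball (0,0) 4"
  proof
    fix x assume "x \<in> triangle"
    then have b: "0 \<le> snd x / sqrt 3" "snd x / sqrt 3 \<le> fst x" "fst x + snd x / sqrt 3 \<le> 1"
      by (auto simp: triangle_def all_less_3 bary_def)
    have "snd x \<le> 2 * (snd x / sqrt 3)"
      using b(1) mult_left_mono[of "sqrt 3" 2 "snd x / sqrt 3"] real_le_lsqrt[of 2 3]
      by (simp add: mult.commute)
    with b have "0 \<le> fst x" "fst x \<le> 1" "0 \<le> snd x" "snd x \<le> 2"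
      by (auto simp: zero_le_divide_iff)
    then have "norm (fst x) + norm (snd x) \<le> 4"
      by auto
    then show "x \<in> cball (0,0) 4"
      using norm_Pair_le[of "fst x" "snd x"] by (simp add: dist_norm norm_minus_commute flip: zero_prod_def)
  qed
  moreover have "closed {x. 0 \<le> bary i x}" for i
    by (intro closed_Collect_le continuous_intros)
  then have "closed triangle"
    unfolding triangle_def by (auto simp: all_less_3 intro!: closed_Collect_conj)
  ultimately show ?thesis
    using bounded_subset compact_eq_bounded_closed bounded_cball by blast
qed

lemma compact_pregasket: "compact (pregasket n)"
  by (induction n) (auto intro!: compact_triangle compact_UN compact_continuous_image continuous_intros)

lemma corner_mem_pregasket: "i < 3 \<Longrightarrow> corner i \<in> pregasket n"
proof (induction n)
  case 0
  then show ?case by (auto simp: triangle_def bary_corner)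
next
  case (Suc n)
  then have "sgmap i (corner i) \<in> pregasket (Suc n)" by (auto simp del: sgmap_corner)
  then show ?case by simp
qed

lemma pregasket_Suc_subset: "pregasket (Suc n) \<subseteq> pregasket n"
  by (induction n) (force simp: triangle_def bary_sgmap)+

lemma pregasket_antimono: "m \<le> n \<Longrightarrow> pregasket n \<subseteq> pregasket m"
  by (rule lift_Suc_antimono_le[of pregasket]) (use pregasket_Suc_subset in auto)

text \<open>The delicate point is to exchange union and intersection: the sequence decreases, so a
  point that leaves each of the three images at some level has left all of them at the largest of
  these levels.\<close>

lemma similar_set_exists: "(\<Inter>n. pregasket n) = (\<Union>i<3. sgmap i ` (\<Inter>n. pregasket n))"
proof (intro equalityI subsetI)
  fix x assume x: "x \<in> (\<Inter>n. pregasket n)"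
  have "\<exists>i<3. \<forall>n. x \<in> sgmap i ` pregasket n"
  proof (rule ccontr)
    assume "\<not> ?thesis"
    then obtain N where N: "\<And>i. i < 3 \<Longrightarrow> x \<notin> sgmap i ` pregasket (N i)"
      by metis
    define n where "n = Max (N ` {..<3})"
    have "x \<notin> sgmap i ` pregasket n" if "i < 3" for i
      using N[OF that] pregasket_antimono[of "N i" n] that unfolding n_def by auto
    then have "x \<notin> pregasket (Suc n)" by auto
    with x show False by blast
  qed
  then obtain i where i: "i < 3" "\<And>n. x \<in> sgmap i ` pregasket n" by auto
  then have "sginv i x \<in> pregasket n" "x = sgmap i (sginv i x)" for n
    by (metis imageE sginv_sgmap)+
  with i show "x \<in> (\<Union>i<3. sgmap i ` (\<Inter>n. pregasket n))"
    by blast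
next
  fix x assume "x \<in> (\<Union>i<3. sgmap i ` (\<Inter>n. pregasket n))"
  then have "x \<in> pregasket (Suc n)" for n by auto
  then show "x \<in> (\<Inter>n. pregasket n)" using pregasket_Suc_subset by blast
qed

lemma SG_properties: "SG \<noteq> {}" "compact SG" "SG = (\<Union>i<3. sgmap i ` SG)"
proof -
  have "\<exists>!K. K \<noteq> {} \<and> compact K \<and> K = (\<Union>i<3. sgmap i ` K)"
  proof (rule ex_ex1I)
    have "compact (\<Inter>n. pregasket n)"
      by (rule compact_Inter) (auto simp: compact_pregasket)
    moreover have "corner 0 \<in> (\<Inter>n. pregasket n)"
      using corner_mem_pregasket[of 0] by simp
    ultimately show "\<exists>K. K \<noteq> {} \<and> compact K \<and> K = (\<Union>i<3. sgmap i ` K)"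
      by (intro exI[of _ "\<Inter>n. pregasket n"] conjI similar_set_exists) blast+
  next
    fix K L assume *: "K \<noteq> {} \<and> compact K \<and> K = (\<Union>i<3. sgmap i ` K)"
      "L \<noteq> {} \<and> compact L \<and> L = (\<Union>i<3. sgmap i ` L)"
    show "K = L"
    proof (rule equalityI)
      show "K \<subseteq> L" using * by (elim conjE) (rule similar_sets_unique)
      show "L \<subseteq> K" using * by (elim conjE) (rule similar_sets_unique)
    qed
  qed
  note * = theI'[OF this, folded SG_def]
  show "SG \<noteq> {}" "compact SG" "SG = (\<Union>i<3. sgmap i ` SG)"
    by (rule *[THEN conjunct1] *[THEN conjunct2, THEN conjunct1] *[THEN conjunct2, THEN conjunct2])+
qed

lemma closed_SG: "closed SG"
  using SG_properties(2) by (rule compact_imp_closed)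

lemma sgmap_mem:
  assumes "i < 3" "x \<in> SG" shows "sgmap i x \<in> SG"
  using assms by (intro subsetD[OF equalityD2[OF SG_properties(3)]]) blast

lemma SG_cases:
  assumes "x \<in> SG"
  obtains i y where "i < 3" "y \<in> SG" "x = sgmap i y"
  using subsetD[OF equalityD1[OF SG_properties(3)] assms] that by blast

text \<open>A minimum point lies in a cell, so the minimum m satisfies m >= m/2.\<close>

lemma bary_nonneg:
  assumes "x \<in> SG" "i < 3"
  shows "0 \<le> bary i x"
proof -
  obtain x' where x': "x' \<in> SG" "\<And>y. y \<in> SG \<Longrightarrow> bary i x' \<le> bary i y"
    using continuous_attains_inf[OF SG_properties(2,1), of "bary i"] continuous_on_bary by blast
  obtain j y where jy: "j < 3" "y \<in> SG" "x' = sgmap j y"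
    using SG_cases[OF x'(1)] .
  have "bary i x' \<le> bary i y" "bary i x' = (bary i y + of_bool (i = j)) / 2"
    using x' jy assms by (auto simp: bary_sgmap)
  then have "0 \<le> bary i x'" by (auto split: if_splits simp: of_bool_def)
  with x'(2)[OF assms(1)] show ?thesis by simp
qed

lemma bary_le_1:
  assumes "x \<in> SG" "i < 3"
  shows "bary i x \<le> 1"
  using bary_nonneg[OF assms(1), of 0] bary_nonneg[OF assms(1), of 1] bary_nonneg[OF assms(1), of 2]
    bary_sum[of x] assms(2) by (auto simp: less_3_iff)

lemma bary_eq_1:
  assumes "x \<in> SG" "i < 3" "bary i x = 1"
  shows "x = corner i"
proof (rule bary_eqI)
  fix j :: nat assume "j < 3"
  then show "bary j x = bary j (corner i)"
    using bary_nonneg[OF assms(1), of 0] bary_nonneg[OF assms(1), of 1] bary_nonneg[OF assms(1), of 2]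
      bary_sum[of x] assms(2,3) by (auto simp: less_3_iff bary_corner)
qed

text \<open>Applying \<open>sgmap i\<close> to a maximum point of \<open>bary i\<close> shows that
  the maximum M satisfies M >= (M + 1)/2. So it is 1, a value taken only at the corner.\<close>

lemma corner_mem_SG: "corner i \<in> SG"
proof -
  have "corner (i mod 3) \<in> SG"
  proof -
    define i' where "i' = i mod 3"
    have i': "i' < 3" by (simp add: i'_def)
    obtain x' where x': "x' \<in> SG" "\<And>y. y \<in> SG \<Longrightarrow> bary i' y \<le> bary i' x'"
      using continuous_attains_sup[OF SG_properties(2,1), of "bary i'"] continuous_on_bary by blast
    have "bary i' (sgmap i' x') \<le> bary i' x'"
      using x' i' sgmap_mem by auto
    then have "bary i' x' = 1"
      using bary_le_1[OF x'(1) i'] i' by (simp add: bary_sgmap)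
    with x' i' bary_eq_1 show ?thesis unfolding i'_def[symmetric] by blast
  qed
  then show ?thesis by (simp add: corner_mod)
qed

lemma midpt_mem_SG: "midpt k \<in> SG"
  unfolding midpt_def using sgmap_mem[of "(k+1) mod 3", OF _ corner_mem_SG] by (simp add: sgmap_mod)

text \<open>Comparing coordinate j gives \<open>bary j x = bary j y + 1\<close>, which the bounds 0
  and 1 allow only at a corner; likewise for coordinate i.\<close>

lemma cells_meet:
  assumes "i < 3" "j < 3" "i \<noteq> j" "x \<in> SG" "y \<in> SG" "sgmap i x = sgmap j y"
  shows "x = corner j" "y = corner i"
proof -
  have *: "(bary k x + of_bool (k = i)) / 2 = (bary k y + of_bool (k = j)) / 2" if "k < 3" for k
    using bary_sgmap[OF that assms(1)] bary_sgmap[OF that assms(2)] assms(6) by metis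
  have "bary j x = 1"
    using *[OF assms(2)] bary_nonneg[OF assms(5,2)] bary_le_1[OF assms(4,2)] assms by simp
  then show "x = corner j" using bary_eq_1 assms by blast
  have "bary i y = 1"
    using *[OF assms(1)] bary_nonneg[OF assms(4,1)] bary_le_1[OF assms(5,1)] assms by simp
  then show "y = corner i" using bary_eq_1 assms by blast
qed

section \<open>Words\<close>

abbreviation valid :: "nat list \<Rightarrow> bool" where
  "valid w \<equiv> set w \<subseteq> {..<3}"

lemma wordmap_mem: "valid w \<Longrightarrow> x \<in> SG \<Longrightarrow> wordmap w x \<in> SG"
  by (induction w) (auto simp: sgmap_mem)

lemma dist_wordmap: "dist (wordmap w x) (wordmap w y) = (1/2) ^ length w * dist x y"
  by (induction w) (auto simp: dist_sgmap)

lemma continuous_on_wordmap [continuous_intros]: "continuous_on S (wordmap w)"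
proof (induction w arbitrary: S)
  case (Cons i w)
  then show ?case
    by (auto simp: comp_def intro!: continuous_on_compose2[OF continuous_on_sgmap])
qed (simp add: id_def)

lemma words_0: "words 0 = {[]}"
  by (auto simp: words_def)

lemma words_Suc: "words (Suc m) = (\<lambda>(i, w). i # w) ` ({..<3} \<times> words m)"
  by (force simp: words_def length_Suc_conv image_iff)

lemma finite_words: "finite (words m)"
  by (induction m) (auto simp: words_0 words_Suc)

lemma words_valid: "w \<in> words m \<Longrightarrow> valid w \<and> length w = m"
  by (auto simp: words_def)

lemma sum_words_Suc: "(\<Sum>w\<in>words (Suc m). g w) = (\<Sum>i<3. \<Sum>w\<in>words m. g (i # w))"
  unfolding words_Suc sum.cartesian_product by (subst sum.reindex) (auto simp: inj_on_def case_prod_unfold)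

lemma SG_cell_cover: "x \<in> SG \<Longrightarrow> \<exists>w\<in>words m. \<exists>y\<in>SG. x = wordmap w y"
proof (induction m arbitrary: x)
  case 0
  then show ?case by (auto simp: words_0)
next
  case (Suc m)
  obtain i y where iy: "i < 3" "y \<in> SG" "x = sgmap i y"
    using SG_cases[OF Suc.prems] .
  with Suc.IH[of y] obtain w z where "w \<in> words m" "z \<in> SG" "y = wordmap w z"
    by auto
  with iy have "i # w \<in> words (Suc m)" "x = wordmap (i # w) z"
    by (auto simp: words_Suc)
  with \<open>z \<in> SG\<close> show ?case by metis
qed

lemma cells_small_oscillation:
  fixes v :: "point \<Rightarrow> real"
  assumes "continuous_on SG v" "e > 0"
  obtains N where "\<And>m w x y. m \<ge> N \<Longrightarrow> w \<in> words m \<Longrightarrow> x \<in> SG \<Longrightarrow> y \<in> SG \<Longrightarrow>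
    \<bar>v (wordmap w x) - v (wordmap w y)\<bar> < e"
proof -
  have "uniformly_continuous_on SG v"
    using assms SG_properties compact_uniformly_continuous by blast
  then obtain d where d: "d > 0" "\<And>x y. x \<in> SG \<Longrightarrow> y \<in> SG \<Longrightarrow> dist x y < d \<Longrightarrow> dist (v x) (v y) < e"
    using assms(2) unfolding uniformly_continuous_on_def by metis
  obtain D where D: "D > 0" "\<And>x y. x \<in> SG \<Longrightarrow> y \<in> SG \<Longrightarrow> dist x y \<le> D"
  proof -
    have "bounded SG" using SG_properties compact_imp_bounded by blast
    then obtain D where "\<forall>x\<in>SG. \<forall>y\<in>SG. dist x y \<le> D"
      using bounded_two_points by blast
    then show ?thesis by (intro that[of "max D 1"]) force+
  qed
  obtain N where N: "(1/2::real) ^ N < d / D"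
    using real_arch_pow_inv[of "d / D" "1/2"] d D by auto
  show ?thesis
  proof (rule that[of N])
    fix m w x y assume *: "m \<ge> N" "w \<in> words m" "x \<in> SG" "y \<in> SG"
    have "dist (wordmap w x) (wordmap w y) \<le> (1/2) ^ m * D"
      using * words_valid[OF *(2)] D by (auto simp: dist_wordmap intro!: mult_left_mono)
    also have "\<dots> \<le> (1/2) ^ N * D"
      using *(1) D by (intro mult_right_mono power_decreasing) auto
    also have "\<dots> < d" using N D by (simp add: pos_less_divide_eq)
    finally have "dist (v (wordmap w x)) (v (wordmap w y)) < e"
      using * words_valid[OF *(2)] by (intro d wordmap_mem) auto
    then show "\<bar>v (wordmap w x) - v (wordmap w y)\<bar> < e" by (simp add: dist_real_def)
  qed
qed

text \<open>Every cell contains an image of \<open>corner 0\<close> and cells shrink, so these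
  vertices alone are dense.\<close>

lemma vertices_dense:
  fixes u v :: "point \<Rightarrow> real"
  assumes "continuous_on SG u" "continuous_on SG v"
    and "\<And>w. valid w \<Longrightarrow> u (wordmap w (corner 0)) = v (wordmap w (corner 0))"
    and "x \<in> SG"
  shows "u x = v x"
proof (rule ccontr)
  let ?d = "\<lambda>x. u x - v x"
  assume "u x \<noteq> v x"
  then have "\<bar>?d x\<bar> > 0" by simp
  moreover have "continuous_on SG ?d" by (intro continuous_intros assms)
  ultimately obtain N where N: "\<And>m w x' y. m \<ge> N \<Longrightarrow> w \<in> words m \<Longrightarrow> x' \<in> SG \<Longrightarrow> y \<in> SG \<Longrightarrow>
    \<bar>?d (wordmap w x') - ?d (wordmap w y)\<bar> < \<bar>?d x\<bar>"
    using cells_small_oscillation[of ?d "\<bar>?d x\<bar>"] by blast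
  obtain w y where wy: "w \<in> words N" "y \<in> SG" "x = wordmap w y"
    using SG_cell_cover[OF assms(4), of N] by metis
  have "?d (wordmap w (corner 0)) = 0"
    using assms(3) words_valid[OF wy(1)] by simp
  with N[OF order.refl wy(1,2) corner_mem_SG[of 0]] wy(3) show False
    by simp
qed

text \<open>Connectedness of \<open>SG\<close> in combinatorial form: cells i and j share the point
  \<open>sgmap i (corner j) = sgmap j (corner i)\<close>, which transports the value of
  \<open>q\<close> at every level.\<close>

lemma locally_constant_on_cells:
  assumes "\<And>w x y. w \<in> words n \<Longrightarrow> x \<in> SG \<Longrightarrow> y \<in> SG \<Longrightarrow> q (wordmap w x) = q (wordmap w y)"
    and "x \<in> SG" "y \<in> SG"
  shows "q x = q y"
  using assms
proof (induction n arbitrary: q x y)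
  case 0
  from 0(1)[OF _ 0(2,3), of "[]"] show ?case by (simp add: words_0)
next
  case (Suc n)
  have *: "q (sgmap i x) = q (sgmap i y)" if "i < 3" "x \<in> SG" "y \<in> SG" for i x y
  proof -
    have step: "(q \<circ> sgmap i) (wordmap w x) = (q \<circ> sgmap i) (wordmap w y)"
      if "w \<in> words n" "x \<in> SG" "y \<in> SG" for w x y
    proof -
      have "i # w \<in> words (Suc n)" using that \<open>i < 3\<close> by (auto simp: words_Suc)
      from Suc.prems(1)[OF this that(2,3)] show ?thesis by simp
    qed
    have "(q \<circ> sgmap i) x = (q \<circ> sgmap i) y"
      by (rule Suc.IH[where q = "q \<circ> sgmap i", OF step that(2,3)])
    then show ?thesis by simp
  qed
  obtain i x' where ix: "i < 3" "x' \<in> SG" "x = sgmap i x'"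
    using SG_cases[OF Suc.prems(2)] .
  obtain j y' where jy: "j < 3" "y' \<in> SG" "y = sgmap j y'"
    using SG_cases[OF Suc.prems(3)] .
  show ?case
    using *[OF ix(1,2) corner_mem_SG[of j]] *[OF jy(1) corner_mem_SG[of i] jy(2)] ix jy
      sgmap_corner_commute[of i j] by simp
qed

section \<open>Gluing\<close>

text \<open>At a shared point the first matching cell decides; agreement at the junctions, assumed
  in \<open>glue_sgmap\<close>, makes the order irrelevant.\<close>

definition glue :: "(nat \<Rightarrow> point \<Rightarrow> real) \<Rightarrow> point \<Rightarrow> real" where
  "glue v x = (if x \<in> sgmap 0 ` SG then v 0 (sginv 0 x)
     else if x \<in> sgmap 1 ` SG then v 1 (sginv 1 x) else v 2 (sginv 2 x))"

lemma glue_sgmap: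
  assumes v: "\<And>i j. i < 3 \<Longrightarrow> j < 3 \<Longrightarrow> v i (corner j) = v j (corner i)"
    and "i < 3" "x \<in> SG"
  shows "glue v (sgmap i x) = v i x"
proof -
  have *: "v j (sginv j (sgmap i x)) = v i x" if "j < 3" "sgmap i x \<in> sgmap j ` SG" for j
  proof (cases "j = i")
    case False
    from that obtain y where "y \<in> SG" "sgmap i x = sgmap j y" by auto
    with cells_meet[of i j x y] False assms that v[of i j] show ?thesis
      by simp
  qed simp
  show ?thesis
    using *[of 0] *[of 1] *[of 2] assms(2,3) by (auto simp: glue_def less_3_iff)
qed

lemma continuous_on_SGI:
  fixes u :: "point \<Rightarrow> real"
  assumes "\<And>i. i < 3 \<Longrightarrow> continuous_on SG (u \<circ> sgmap i)"
  shows "continuous_on SG u"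
proof -
  have "continuous_on (sgmap i ` SG) u" if "i < 3" for i
  proof -
    have "continuous_on (sgmap i ` SG) ((u \<circ> sgmap i) \<circ> sginv i)"
    proof (rule continuous_on_compose[OF continuous_on_sginv])
      have "sginv i ` sgmap i ` SG = SG"
        by (simp add: image_image)
      then show "continuous_on (sginv i ` sgmap i ` SG) (u \<circ> sgmap i)"
        using assms[OF that] by simp
    qed
    then show ?thesis
      by (rule continuous_on_eq) auto
  qed
  moreover have "closed (sgmap i ` SG)" for i
    by (intro compact_imp_closed compact_continuous_image continuous_intros SG_properties)
  ultimately show ?thesis
    by (intro continuous_on_subset[OF continuous_on_closed_Union equalityD1[OF SG_properties(3)]]) auto
qed

lemma continuous_on_comp_sgmap:
  assumes "continuous_on SG u" "i < 3"
  shows "continuous_on SG (u \<circ> sgmap i)"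
  using assms
  by (intro continuous_on_compose continuous_on_subset[OF assms(1)] continuous_intros)
     (auto simp: sgmap_mem)

lemma continuous_on_comp_wordmap:
  assumes "continuous_on SG u" "valid w"
  shows "continuous_on SG (u \<circ> wordmap w)"
  using assms
  by (intro continuous_on_compose continuous_on_subset[OF assms(1)] continuous_intros)
     (auto simp: wordmap_mem)

lemma continuous_on_glue:
  assumes "\<And>i j. i < 3 \<Longrightarrow> j < 3 \<Longrightarrow> v i (corner j) = v j (corner i)"
    and "\<And>i. i < 3 \<Longrightarrow> continuous_on SG (v i)"
  shows "continuous_on SG (glue v)"
proof (rule continuous_on_SGI)
  fix i :: nat assume "i < 3"
  then show "continuous_on SG (glue v \<circ> sgmap i)"
    by (intro continuous_on_eq[OF assms(2)]) (auto simp: glue_sgmap[of v, OF assms(1)])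
qed

section \<open>Solving the vertex equations\<close>

text \<open>The solution of \<open>4 m\<^sub>k - m\<^sub>i - m\<^sub>j - a\<^sub>i - a\<^sub>j = c\<^sub>k\<close> for \<open>{i, j, k} = {0, 1, 2}\<close>,
  which is the Poisson equation on the first graph approximation.\<close>

definition mid :: "(nat \<Rightarrow> real) \<Rightarrow> (nat \<Rightarrow> real) \<Rightarrow> nat \<Rightarrow> real" where
  "mid a c k = (2 * (a 0 + a 1 + a 2) - a k + (c 0 + c 1 + c 2) / 2 + c k) / 5"

text \<open>The value at \<open>F\<^sub>i(q\<^sub>j)\<close>, which is the midpoint opposite to the corner \<open>3 - i - j\<close> if \<open>i \<noteq> j\<close>.\<close>

definition child :: "(nat \<Rightarrow> real) \<Rightarrow> (nat \<Rightarrow> real) \<Rightarrow> nat \<Rightarrow> nat \<Rightarrow> real" where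
  "child a c i j = (if j = i then a i else mid a c (3 - i - j))"

lemma child_commute: "i < 3 \<Longrightarrow> j < 3 \<Longrightarrow> child a c i j = child a c j i"
  by (auto simp: child_def less_3_iff)

lemma child_same [simp]: "child a c i i = a i"
  by (simp add: child_def)

text \<open>The discrete Poisson equation at every vertex outside \<open>V0\<close>, indexed by the
  cell of which the vertex is a midpoint. Corner values and data thus determine all vertex values by
  recursion on words.\<close>

definition solves :: "(point \<Rightarrow> real) \<Rightarrow> (nat list \<Rightarrow> nat \<Rightarrow> real) \<Rightarrow> bool" where
  "solves u b \<longleftrightarrow> (\<forall>w. valid w \<longrightarrow> (\<forall>k<3. u (wordmap w (midpt k)) =
     mid (\<lambda>i. u (wordmap w (corner i))) (b w) k))"

lemma solvesD:
  "solves u b \<Longrightarrow> valid w \<Longrightarrow> k < 3 \<Longrightarrow>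
    u (wordmap w (midpt k)) = mid (\<lambda>i. u (wordmap w (corner i))) (b w) k"
  by (simp add: solves_def)

lemma solves_shift:
  assumes "solves u b" "i < 3"
  shows "solves (u \<circ> sgmap i) (\<lambda>w. b (i # w))"
  unfolding solves_def using solvesD[OF assms(1), of "i # _"] assms(2) by auto

lemma solves_child:
  assumes "solves u b" "i < 3" "j < 3"
  shows "u (sgmap i (corner j)) = child (\<lambda>i. u (corner i)) (b []) i j"
  using solvesD[OF assms(1), of "[]" "3 - i - j"] assms(2,3)
  by (cases "i = j") (auto simp: child_def sgmap_corner_midpt)

lemma solves_cong:
  assumes "solves u b" "\<And>x. x \<in> SG \<Longrightarrow> u x = u' x"
    and "\<And>w k. valid w \<Longrightarrow> k < 3 \<Longrightarrow> b w k = b' w k"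
  shows "solves u' b'"
  unfolding solves_def
proof (intro allI impI)
  fix w and k :: nat assume wk: "valid w" "k < 3"
  show "u' (wordmap w (midpt k)) = mid (\<lambda>i. u' (wordmap w (corner i))) (b' w) k"
    using solvesD[OF assms(1) wk] wk
    by (simp add: mid_def assms(2,3)[symmetric] wordmap_mem corner_mem_SG midpt_mem_SG)
qed

lemma mid_linear:
  "mid (\<lambda>i. s * a i + t * a' i) (\<lambda>k. s * c k + t * c' k) k = s * mid a c k + t * mid a' c' k"
  by (simp add: mid_def field_simps)

lemma solves_linear:
  assumes "solves u b" "solves v d"
  shows "solves (\<lambda>x. s * u x + t * v x) (\<lambda>w k. s * b w k + t * d w k)"
  using assms by (simp add: solves_def mid_linear)

lemma solves_vertices_eq:
  assumes "solves u b" "solves v b" "valid w"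
    and "\<And>i. i < 3 \<Longrightarrow> u (corner i) = v (corner i)" and "i < 3"
  shows "u (wordmap w (corner i)) = v (wordmap w (corner i))"
  using assms
proof (induction w arbitrary: u v b)
  case (Cons j w)
  have "(u \<circ> sgmap j) (wordmap w (corner i)) = (v \<circ> sgmap j) (wordmap w (corner i))"
  proof (rule Cons.IH[OF solves_shift solves_shift])
    fix k :: nat assume "k < 3"
    then show "(u \<circ> sgmap j) (corner k) = (v \<circ> sgmap j) (corner k)"
      using Cons.prems by (auto simp: solves_child child_def mid_def)
  qed (use Cons.prems in auto)
  then show ?case by simp
qed simp

lemma solves_unique:
  assumes "solves u b" "solves v b" "continuous_on SG u" "continuous_on SG v"
    and "\<And>i. i < 3 \<Longrightarrow> u (corner i) = v (corner i)" and "x \<in> SG"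
  shows "u x = v x"
  using assms(3,4) _ assms(6)
  by (rule vertices_dense) (auto intro!: solves_vertices_eq[OF assms(1,2)] assms(5))

section \<open>Existence of solutions for decaying data\<close>

definition affine3 :: "(nat \<Rightarrow> real) \<Rightarrow> point \<Rightarrow> real" where
  "affine3 a x = a 0 * bary 0 x + a 1 * bary 1 x + a 2 * bary 2 x"

text \<open>Correct vertex values down to level n, with affine interpolation inside each cell of
  level n.\<close>

primrec approx :: "nat \<Rightarrow> (nat \<Rightarrow> real) \<Rightarrow> (nat list \<Rightarrow> nat \<Rightarrow> real) \<Rightarrow> point \<Rightarrow> real" where
  "approx 0 = (\<lambda>a b. affine3 a)"
| "approx (Suc n) = (\<lambda>a b. glue (\<lambda>i. approx n (child a (b []) i) (\<lambda>w. b (i # w))))"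

lemma approx_corner: "i < 3 \<Longrightarrow> approx n a b (corner i) = a i"
proof (induction n arbitrary: a b i)
  case 0
  then show ?case by (auto simp: less_3_iff affine3_def bary_corner)
next
  case (Suc n)
  let ?v = "\<lambda>i. approx n (child a (b []) i) (\<lambda>w. b (i # w))"
  have "glue ?v (sgmap i (corner i)) = ?v i (corner i)"
    by (rule glue_sgmap) (auto simp: Suc child_commute corner_mem_SG)
  then show ?case by (simp add: Suc)
qed

lemma approx_sgmap:
  assumes "i < 3" "x \<in> SG"
  shows "approx (Suc n) a b (sgmap i x) = approx n (child a (b []) i) (\<lambda>w. b (i # w)) x"
  using assms by (simp, intro glue_sgmap) (auto simp: approx_corner child_commute)

lemma continuous_on_approx: "continuous_on SG (approx n a b)"
proof (induction n arbitrary: a b)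
  case 0
  show ?case by (auto simp: affine3_def intro!: continuous_intros)
next
  case (Suc n)
  show ?case by (auto intro!: continuous_on_glue Suc simp: approx_corner child_commute)
qed

lemma affine3_bound:
  assumes "x \<in> SG" "\<And>i. i < 3 \<Longrightarrow> \<bar>a i\<bar> \<le> e"
  shows "\<bar>affine3 a x\<bar> \<le> e"
proof -
  have "\<bar>a i * bary i x\<bar> \<le> e * bary i x" if "i < 3" for i
    using assms(2)[OF that] bary_nonneg[OF assms(1) that] by (simp add: abs_mult mult_right_mono)
  from this[of 0] this[of 1] this[of 2]
  have "\<bar>affine3 a x\<bar> \<le> e * (bary 0 x + bary 1 x + bary 2 x)"
    by (simp add: affine3_def distrib_left)
  then show ?thesis unfolding bary_sum by simp
qed

text \<open>The rate 1/5 is the scaling of the Laplacian under passage to a subcell;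
  \<open>source g\<close> has it when g is bounded.\<close>

definition decaying :: "real \<Rightarrow> (nat list \<Rightarrow> nat \<Rightarrow> real) \<Rightarrow> bool" where
  "decaying B b \<longleftrightarrow> (\<forall>w. valid w \<longrightarrow> (\<forall>k<3. \<bar>b w k\<bar> \<le> B * (1/5) ^ length w))"

lemma decaying_shift:
  assumes "decaying B b" "i < 3"
  shows "decaying (B / 5) (\<lambda>w. b (i # w))"
  unfolding decaying_def
proof (intro allI impI)
  fix w and k :: nat assume "valid w" "k < 3"
  with assms have "\<bar>b (i # w) k\<bar> \<le> B * (1/5) ^ length (i # w)"
    using spec[OF assms(1)[unfolded decaying_def], of "i # w"] by simp
  then show "\<bar>b (i # w) k\<bar> \<le> B / 5 * (1/5) ^ length w" by simp
qed

text \<open>In a subcell the oscillation \<open>D\<close> becomes at most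
  \<open>3/5 * D + 4/5 * B\<close> and the source bound becomes \<open>B / 5\<close>. The weight 2
  is chosen so that \<open>D + 2 * B\<close> shrinks by exactly 3/5.\<close>

lemma approx_step:
  assumes "decaying B b" "\<And>i j. i < 3 \<Longrightarrow> j < 3 \<Longrightarrow> a i - a j \<le> D" "x \<in> SG"
  shows "\<bar>approx (Suc n) a b x - approx n a b x\<bar> \<le> (3/5) ^ n * (D + 2 * B)"
  using assms
proof (induction n arbitrary: a b x D B)
  case 0
  have c: "\<bar>b [] 0\<bar> \<le> B" "\<bar>b [] 1\<bar> \<le> B" "\<bar>b [] 2\<bar> \<le> B"
    using 0(1) unfolding decaying_def by (auto dest!: spec[of _ "[]"])
  have D: "a 0 - a 1 \<le> D" "a 1 - a 0 \<le> D" "a 0 - a 2 \<le> D" "a 2 - a 0 \<le> D" "a 1 - a 2 \<le> D" "a 2 - a 1 \<le> D"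
    using 0(2) by auto
  obtain i y where iy: "i < 3" "y \<in> SG" "x = sgmap i y"
    using SG_cases[OF 0(3)] .
  \<comment> \<open>Restricted to a cell, an affine function has averages as corner values, so the
    difference of levels 1 and 0 is affine on the cell.\<close>
  have "affine3 a (sgmap i y) = affine3 (\<lambda>j. (a i + a j) / 2) y"
  proof -
    have "affine3 (\<lambda>j. (a i + a j) / 2) y = (a i * (bary 0 y + bary 1 y + bary 2 y) + affine3 a y) / 2"
      by (simp add: affine3_def field_simps)
    also have "\<dots> = (a i + affine3 a y) / 2"
      unfolding bary_sum by simp
    also have "\<dots> = affine3 a (sgmap i y)"
      using iy(1) by (auto simp: less_3_iff affine3_def bary_sgmap field_simps)
    finally show ?thesis ..
  qed
  then have "approx (Suc 0) a b x - approx 0 a b x =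
      affine3 (\<lambda>j. child a (b []) i j - (a i + a j) / 2) y"
    unfolding iy(3) approx_sgmap[OF iy(1,2)] by (simp add: affine3_def algebra_simps)
  also have "\<bar>\<dots>\<bar> \<le> D + 2 * B"
  proof (rule affine3_bound[OF iy(2)])
    fix j :: nat assume "j < 3"
    then show "\<bar>child a (b []) i j - (a i + a j) / 2\<bar> \<le> D + 2 * B"
      using iy(1) c D by (auto simp: less_3_iff child_def mid_def abs_le_iff field_simps)
  qed
  finally show ?case by simp
next
  case (Suc n)
  have c: "\<bar>b [] 0\<bar> \<le> B" "\<bar>b [] 1\<bar> \<le> B" "\<bar>b [] 2\<bar> \<le> B"
    using Suc.prems(1) unfolding decaying_def by (auto dest!: spec[of _ "[]"])
  have D: "a 0 - a 1 \<le> D" "a 1 - a 0 \<le> D" "a 0 - a 2 \<le> D" "a 2 - a 0 \<le> D" "a 1 - a 2 \<le> D" "a 2 - a 1 \<le> D"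
    using Suc.prems(2) by auto
  obtain i y where iy: "i < 3" "y \<in> SG" "x = sgmap i y"
    using SG_cases[OF Suc.prems(3)] .
  let ?a = "child a (b []) i" and ?b = "\<lambda>w. b (i # w)" and ?D = "3/5 * D + B"
  have "\<bar>approx (Suc n) ?a ?b y - approx n ?a ?b y\<bar> \<le> (3/5) ^ n * ((3/5 * D + 4/5 * B) + 2 * (B / 5))"
  proof (rule Suc.IH[OF decaying_shift[OF Suc.prems(1) iy(1)] _ iy(2)])
    fix j k :: nat assume "j < 3" "k < 3"
    then show "?a j - ?a k \<le> 3/5 * D + 4/5 * B"
      using iy(1) c D by (auto simp: less_3_iff child_def mid_def abs_le_iff field_simps)
  qed
  then show ?case
    unfolding iy(3) approx_sgmap[OF iy(1,2)] by (simp add: algebra_simps)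
qed

definition Sol :: "(nat \<Rightarrow> real) \<Rightarrow> (nat list \<Rightarrow> nat \<Rightarrow> real) \<Rightarrow> point \<Rightarrow> real" where
  "Sol a b x = affine3 a x + (\<Sum>n. approx (Suc n) a b x - approx n a b x)"

text \<open>The factor 5/2 sums the geometric series of ratio 3/5 from \<open>approx_step\<close>;
  uniformity of the limit yields continuity.\<close>

lemma Sol_properties:
  assumes "decaying B b" "\<And>i j. i < 3 \<Longrightarrow> j < 3 \<Longrightarrow> a i - a j \<le> D"
  shows uniform_limit_Sol: "uniform_limit SG (\<lambda>n. approx n a b) (Sol a b) sequentially"
    and Sol_affine_bound: "x \<in> SG \<Longrightarrow> \<bar>Sol a b x - affine3 a x\<bar> \<le> 5/2 * (D + 2 * B)"
proof -
  let ?M = "\<lambda>n. (3/5::real) ^ n * (D + 2 * B)" and ?d = "\<lambda>n x. approx (Suc n) a b x - approx n a b x"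
  have M: "norm (?d n x) \<le> ?M n" if "x \<in> SG" for n x
    using approx_step[OF assms that] by simp
  have sM: "?M sums (5/2 * (D + 2 * B))"
    using sums_mult2[OF geometric_sums[of "3/5::real"], of "D + 2 * B"] by simp
  have "uniform_limit SG (\<lambda>n x. affine3 a x + (\<Sum>i<n. ?d i x)) (Sol a b) sequentially"
    unfolding Sol_def[abs_def]
    by (intro uniform_limit_add uniform_limit_const Weierstrass_m_test[of SG ?d ?M] M sums_summable[OF sM])
  then show "uniform_limit SG (\<lambda>n. approx n a b) (Sol a b) sequentially"
    by (simp add: sum_lessThan_telescope[of "\<lambda>n. approx n a b _"] del: approx.simps(2))
  show "\<bar>Sol a b x - affine3 a x\<bar> \<le> 5/2 * (D + 2 * B)" if "x \<in> SG"
    using norm_suminf_le[of "\<lambda>n. ?d n x" ?M, OF M[OF that] sums_summable[OF sM]] sums_unique[OF sM]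
    by (simp add: Sol_def del: approx.simps(2))
qed

lemma oscillation_bound_exists:
  obtains D :: real where "\<And>i j. i < 3 \<Longrightarrow> j < 3 \<Longrightarrow> a i - a (j::nat) \<le> D"
proof
  fix i j :: nat assume "i < 3" "j < 3"
  then show "a i - a j \<le> 2 * (\<bar>a 0\<bar> + \<bar>a 1\<bar> + \<bar>a 2\<bar>)"
    by (auto simp: less_3_iff)
qed

lemma approx_tendsto_Sol:
  assumes "decaying B b" "x \<in> SG"
  shows "(\<lambda>n. approx n a b x) \<longlonglongrightarrow> Sol a b x"
  using oscillation_bound_exists[of a] uniform_limit_Sol[OF assms(1)] tendsto_uniform_limitI assms(2)
  by metis

lemma continuous_on_Sol:
  assumes "decaying B b"
  shows "continuous_on SG (Sol a b)"
  using oscillation_bound_exists[of a] uniform_limit_Sol[OF assms, of a]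
  by (metis uniform_limit_theorem continuous_on_approx eventually_sequentially sequentially_bot)

lemma Sol_corner:
  assumes "decaying B b" "i < 3"
  shows "Sol a b (corner i) = a i"
  using approx_tendsto_Sol[OF assms(1) corner_mem_SG, of a i] assms(2)
  by (simp add: approx_corner LIMSEQ_const_iff)

text \<open>Exact for the approximations, with the level lowered by one, hence also for their
  limits.\<close>

lemma Sol_sgmap:
  assumes "decaying B b" "i < 3" "x \<in> SG"
  shows "Sol a b (sgmap i x) = Sol (child a (b []) i) (\<lambda>w. b (i # w)) x"
proof (rule LIMSEQ_unique)
  show "(\<lambda>n. approx (Suc n) a b (sgmap i x)) \<longlonglongrightarrow> Sol a b (sgmap i x)"
    by (intro LIMSEQ_Suc approx_tendsto_Sol[OF assms(1)] sgmap_mem assms)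
  show "(\<lambda>n. approx (Suc n) a b (sgmap i x)) \<longlonglongrightarrow> Sol (child a (b []) i) (\<lambda>w. b (i # w)) x"
    unfolding approx_sgmap[OF assms(2,3)]
    by (rule approx_tendsto_Sol[OF decaying_shift[OF assms(1,2)] assms(3)])
qed

lemma solves_Sol:
  assumes "decaying B b"
  shows "solves (Sol a b) b"
proof -
  have "Sol a b (wordmap w (midpt k)) = mid (\<lambda>i. Sol a b (wordmap w (corner i))) (b w) k"
    if "valid w" "k < 3" for w k
    using that assms
  proof (induction w arbitrary: a b B)
    case Nil
    define i j where "i = (k + 1) mod 3" and "j = (k + 2) mod 3"
    have ij: "i < 3" "j < 3" "i \<noteq> j" "3 - i - j = k"
      using Nil(2) by (auto simp: i_def j_def less_3_iff)
    have "Sol a b (midpt k) = Sol a b (sgmap i (corner j))"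
      using ij by (simp add: sgmap_corner_midpt)
    also have "\<dots> = mid a (b []) k"
      using ij by (simp add: Sol_sgmap[OF Nil(3)] corner_mem_SG
          Sol_corner[OF decaying_shift[OF Nil(3)]] child_def)
    finally show ?case
      by (simp add: mid_def Sol_corner[OF Nil(3)] Nil(2))
  next
    case (Cons i w)
    then show ?case
      by (simp add: mid_def Sol_sgmap[OF Cons.prems(3)] wordmap_mem corner_mem_SG midpt_mem_SG
          Cons.IH[OF _ _ decaying_shift[OF Cons.prems(3)]])
  qed
  then show ?thesis by (simp add: solves_def)
qed

text \<open>Corner values in [-A, A] oscillate by at most 2A, so the correction is at most 5A + 5B;
  the affine part adds A.\<close>

lemma Sol_bound:
  assumes "decaying B b" "\<And>i. i < 3 \<Longrightarrow> \<bar>a i\<bar> \<le> A" "x \<in> SG"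
  shows "\<bar>Sol a b x\<bar> \<le> 6 * A + 5 * B"
proof -
  have "a i - a j \<le> 2 * A" if "i < 3" "j < 3" for i j
    using assms(2)[OF that(1)] assms(2)[OF that(2)] by linarith
  then have "\<bar>Sol a b x - affine3 a x\<bar> \<le> 5/2 * (2 * A + 2 * B)"
    by (intro Sol_affine_bound assms)
  moreover have "\<bar>affine3 a x\<bar> \<le> A"
    by (intro affine3_bound assms)
  ultimately show ?thesis
    unfolding abs_le_iff by (simp add: field_simps)
qed

section \<open>Harmonic functions\<close>

definition harmonic_ext :: "(nat \<Rightarrow> real) \<Rightarrow> point \<Rightarrow> real" where
  "harmonic_ext a = Sol a (\<lambda>w k. 0)"

lemma decaying_0: "decaying 0 (\<lambda>w k. 0)"
  by (simp add: decaying_def)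

lemmas continuous_on_harm = continuous_on_Sol[OF decaying_0, folded harmonic_ext_def]
lemmas harm_corner = Sol_corner[OF decaying_0, folded harmonic_ext_def]
lemmas harm_sgmap = Sol_sgmap[OF decaying_0, folded harmonic_ext_def]
lemmas solves_harm = solves_Sol[OF decaying_0, folded harmonic_ext_def]

lemma harm_unique:
  assumes "solves u (\<lambda>w k. 0)" "continuous_on SG u" "x \<in> SG"
  shows "u x = harmonic_ext (\<lambda>i. u (corner i)) x"
  by (rule solves_unique[OF assms(1) solves_harm assms(2) continuous_on_harm _ assms(3)])
     (simp add: harm_corner)

lemma harm_linear:
  assumes "x \<in> SG"
  shows "harmonic_ext (\<lambda>i. s * a i + t * a' i) x = s * harmonic_ext a x + t * harmonic_ext a' x"
proof (rule solves_unique[OF solves_harm])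
  show "solves (\<lambda>x. s * harmonic_ext a x + t * harmonic_ext a' x) (\<lambda>w k. 0)"
    using solves_linear[OF solves_harm solves_harm, of s a t a'] by simp
qed (auto simp: harm_corner assms intro!: continuous_intros continuous_on_harm)

lemma harm_const:
  assumes "x \<in> SG"
  shows "harmonic_ext (\<lambda>i. s) x = s"
  using harm_unique[of "\<lambda>x. s" x] assms by (simp add: solves_def mid_def)

text \<open>With zero source \<open>mid\<close> is an average of the corner values with weights 2/5,
  2/5, 1/5, so nonnegativity descends to all subcells.\<close>

lemma harm_nonneg:
  assumes "\<And>i. i < 3 \<Longrightarrow> 0 \<le> a i" "x \<in> SG"
  shows "0 \<le> harmonic_ext a x"
proof -
  have "0 \<le> approx n a (\<lambda>w k. 0) x" for n
    using assms
  proof (induction n arbitrary: a x)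
    case 0
    then show ?case by (simp add: affine3_def bary_nonneg)
  next
    case (Suc n)
    obtain i y where iy: "i < 3" "y \<in> SG" "x = sgmap i y"
      using SG_cases[OF Suc.prems(2)] .
    have "0 \<le> child a (\<lambda>k. 0) i j" if "j < 3" for j
      using Suc.prems(1)[of 0] Suc.prems(1)[of 1] Suc.prems(1)[of 2] iy(1) that
      by (auto simp: less_3_iff child_def mid_def)
    from Suc.IH[OF this iy(2)] show ?case
      unfolding iy(3) approx_sgmap[OF iy(1,2)] .
  qed
  then show ?thesis
    unfolding harmonic_ext_def
    by (intro LIMSEQ_le_const[OF approx_tendsto_Sol[OF decaying_0 assms(2)]]) blast
qed

definition hbasis :: "nat \<Rightarrow> point \<Rightarrow> real" where
  "hbasis j = harmonic_ext (\<lambda>i. of_bool (i mod 3 = j mod 3))"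

lemma continuous_on_hbasis: "continuous_on SG (hbasis j)"
  unfolding hbasis_def by (rule continuous_on_harm)

lemma hbasis_nonneg: "x \<in> SG \<Longrightarrow> 0 \<le> hbasis j x"
  unfolding hbasis_def by (intro harm_nonneg) auto

lemma hbasis_corner: "i < 3 \<Longrightarrow> hbasis j (corner i) = of_bool (i = j mod 3)"
  by (simp add: hbasis_def harm_corner)

lemma harm_hbasis:
  assumes "x \<in> SG"
  shows "harmonic_ext a x = a 0 * hbasis 0 x + a 1 * hbasis 1 x + a 2 * hbasis 2 x"
proof (rule solves_unique[OF solves_harm])
  have "solves (\<lambda>x. 1 * (a 0 * hbasis 0 x + a 1 * hbasis 1 x) + a 2 * hbasis 2 x)
    (\<lambda>w k. 1 * (a 0 * 0 + a 1 * 0) + a 2 * 0)"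
    unfolding hbasis_def by (intro solves_linear solves_harm)
  then show "solves (\<lambda>x. a 0 * hbasis 0 x + a 1 * hbasis 1 x + a 2 * hbasis 2 x) (\<lambda>w k. 0)"
    by simp
qed (auto simp: assms less_3_iff hbasis_corner harm_corner
    intro!: continuous_intros continuous_on_hbasis continuous_on_harm)

lemma hbasis_sum: "x \<in> SG \<Longrightarrow> hbasis 0 x + hbasis 1 x + hbasis 2 x = 1"
  using harm_hbasis[of x "\<lambda>i. 1"] harm_const[of x 1] by simp

text \<open>Maximum principle: the harmonic basis functions are nonnegative with sum 1, so each
  value is a convex combination of corner values.\<close>

lemma harm_bound:
  assumes "x \<in> SG" "\<And>i. i < 3 \<Longrightarrow> \<bar>a i - t\<bar> \<le> e"
  shows "\<bar>harmonic_ext a x - t\<bar> \<le> e"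
proof -
  have *: "\<bar>(a i - t) * hbasis i x\<bar> \<le> e * hbasis i x" if "i < 3" for i
    using assms(2)[OF that] hbasis_nonneg[OF assms(1), of i] by (simp add: abs_mult mult_right_mono)
  have "harmonic_ext a x - t = (a 0 - t) * hbasis 0 x + (a 1 - t) * hbasis 1 x + (a 2 - t) * hbasis 2 x"
    using hbasis_sum[OF assms(1)] by (simp add: harm_hbasis[OF assms(1)]) algebra
  also have "\<bar>\<dots>\<bar> \<le> e * (hbasis 0 x + hbasis 1 x + hbasis 2 x)"
    using *[of 0] *[of 1] *[of 2] by (simp add: distrib_left)
  finally show ?thesis unfolding hbasis_sum[OF assms(1)] by simp
qed

section \<open>The self-similar measure\<close>

text \<open>The point with address \<open>\<omega>\<close>. Since \<open>sgmap i x\<close> is the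
  average of x and \<open>corner i\<close>, an infinite composition of these contractions unfolds to
  this series.\<close>

definition coding :: "nat stream \<Rightarrow> point" where
  "coding \<omega> = (\<Sum>n. (1/2) ^ Suc n *\<^sub>R corner (\<omega> !! n))"

lemma norm_corner_le: "norm (corner i) \<le> 1"
  by (auto simp: corner_def norm_Pair power2_eq_square real_sqrt_mult_self)

lemma summable_coding: "summable (\<lambda>n. (1/2::real) ^ Suc n *\<^sub>R corner (\<omega> !! n))"
proof (rule summable_comparison_test)
  show "summable (\<lambda>n. (1/2::real) ^ Suc n)"
    using summable_geometric[of "1/2::real"] by (subst summable_Suc_iff) simp
  show "\<exists>N. \<forall>n\<ge>N. norm ((1/2::real) ^ Suc n *\<^sub>R corner (\<omega> !! n)) \<le> (1/2) ^ Suc n"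
    using norm_corner_le by (auto intro!: mult_left_le)
qed

lemma coding_Stream: "coding (i ## \<omega>) = sgmap i (coding \<omega>)"
proof -
  have "coding (i ## \<omega>) = (\<Sum>n. (1/2) ^ Suc (Suc n) *\<^sub>R corner (\<omega> !! n)) + (1/2) *\<^sub>R corner i"
    unfolding coding_def using suminf_split_head[OF summable_coding[of "i ## \<omega>"]] by simp
  also have "(\<Sum>n. (1/2) ^ Suc (Suc n) *\<^sub>R corner (\<omega> !! n)) = (1/2) *\<^sub>R coding \<omega>"
    unfolding coding_def using suminf_scaleR_right[OF summable_coding[of \<omega>], of "1/2"] by simp
  also have "(1/2) *\<^sub>R coding \<omega> + (1/2) *\<^sub>R corner i = sgmap i (coding \<omega>)"
    by (simp add: sgmap_def algebra_simps)
       (metis scaleR_half_double scaleR_right_distrib)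
  finally show ?thesis .
qed

lemma norm_coding_le: "norm (coding \<omega>) \<le> 1"
proof -
  have sums: "(\<lambda>n. (1/2::real) ^ Suc n) sums 1"
    by (rule power_half_series)
  have "norm ((1/2::real) ^ Suc n *\<^sub>R corner (\<omega> !! n)) \<le> (1/2) ^ Suc n" for n
    using norm_corner_le by (auto intro!: mult_left_le)
  then have "norm (coding \<omega>) \<le> (\<Sum>n. (1/2::real) ^ Suc n)"
    unfolding coding_def by (rule norm_suminf_le[OF _ sums_summable[OF sums]])
  then show ?thesis using sums_unique[OF sums] by simp
qed

lemma infdist_sgmap_SG: "infdist (sgmap i x) SG \<le> infdist x SG / 2"
proof -
  obtain z where z: "z \<in> SG" "infdist x SG = dist x z"
    using infdist_attains_inf[OF closed_SG SG_properties(1)] by metis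
  have "sgmap i z \<in> SG"
    using sgmap_mem[of "i mod 3" z] z by (simp add: sgmap_mod)
  from infdist_le[OF this, of "sgmap i x"] show ?thesis
    by (simp add: z(2) dist_sgmap)
qed

text \<open>Prepending a digit at least halves the distance to \<open>SG\<close>, and all distances
  are at most 2, so they vanish. Digits beyond 2 do no harm because corners are read mod 3.\<close>

lemma coding_mem_SG: "coding \<omega> \<in> SG"
proof -
  have *: "infdist (coding \<omega>) SG \<le> 2 * (1/2) ^ n" for n \<omega>
  proof (induction n arbitrary: \<omega>)
    case 0
    have "infdist (coding \<omega>) SG \<le> dist (coding \<omega>) (corner 0)"
      by (intro infdist_le corner_mem_SG)
    also have "\<dots> \<le> norm (coding \<omega>) + norm (corner 0)"
      by (simp add: dist_norm norm_triangle_ineq4)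
    also have "\<dots> \<le> 2"
      using norm_coding_le[of \<omega>] norm_corner_le[of 0] by linarith
    finally show ?case by simp
  next
    case (Suc n)
    have "coding \<omega> = sgmap (shd \<omega>) (coding (stl \<omega>))"
      using coding_Stream[of "shd \<omega>" "stl \<omega>"] by simp
    then show ?case
      using infdist_sgmap_SG[of "shd \<omega>" "coding (stl \<omega>)"] Suc.IH[of "stl \<omega>"] by simp
  qed
  have "(\<lambda>n. 2 * (1/2::real) ^ n) \<longlonglongrightarrow> 2 * 0"
    by (intro tendsto_intros LIMSEQ_power_zero) simp
  then have "infdist (coding \<omega>) SG \<le> 2 * 0"
    by (rule LIMSEQ_le_const) (use * in blast)
  then show ?thesis
    using infdist_nonneg[of "coding \<omega>" SG] in_closed_iff_infdist_zero[OF closed_SG SG_properties(1)]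
    by simp
qed

abbreviation digits :: "nat pmf" where
  "digits \<equiv> pmf_of_set {..<3}"

lemma measurable_coding [measurable]: "coding \<in> borel_measurable (stream_space (measure_pmf digits))"
proof -
  have [measurable]: "corner \<in> measurable (measure_pmf digits) borel"
    by simp
  show ?thesis unfolding coding_def[abs_def] by measurable
qed

text \<open>The law of a point with independent uniform digits; it is the witness for
  \<open>sg_measure\<close>.\<close>

definition coding_measure :: "point measure" where
  "coding_measure = distr (stream_space (measure_pmf digits)) borel coding"

lemma sets_coding_measure [simp]: "sets coding_measure = sets borel"
  by (simp add: coding_measure_def)

lemma prob_space_coding_measure: "prob_space coding_measure"
  unfolding coding_measure_def
  by (intro prob_space.prob_space_distr prob_space.prob_space_stream_space measurable_coding)
     (rule measure_pmf.prob_space_axioms)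

lemma borel_measurable_sgmap: "sgmap i \<in> borel_measurable borel"
  by (intro borel_measurable_continuous_onI continuous_on_sgmap)

text \<open>Conditioning on the first digit.\<close>

lemma measure_coding_measure:
  assumes [measurable]: "A \<in> sets borel"
  shows "measure coding_measure A =
    (measure coding_measure (sgmap 0 -` A) + measure coding_measure (sgmap 1 -` A)
      + measure coding_measure (sgmap 2 -` A)) / 3"
proof -
  let ?S = "stream_space (measure_pmf digits)"
  have space: "space ?S = UNIV" by (simp add: space_stream_space)
  have m: "measure coding_measure A = measure ?S {\<omega>. coding \<omega> \<in> A}" if "A \<in> sets borel" for A
    unfolding coding_measure_def using that
    by (subst measure_distr) (auto simp: space vimage_def)
  have "ennreal (measure ?S {\<omega>. coding \<omega> \<in> A}) =
      (\<integral>\<^sup>+i. measure ?S {\<omega>. coding (i ## \<omega>) \<in> A} \<partial>measure_pmf digits)"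
    using prob_space.prob_stream_space[OF measure_pmf.prob_space_axioms[of digits], of "\<lambda>\<omega>. coding \<omega> \<in> A"]
      measurable_sets[OF measurable_coding assms]
    by (simp add: space vimage_def)
  also have "\<dots> = (\<integral>\<^sup>+i. measure coding_measure (sgmap i -` A) \<partial>measure_pmf digits)"
  proof (rule nn_integral_cong)
    fix i
    have "sgmap i -` A \<in> sets borel"
      using measurable_sets[OF borel_measurable_sgmap assms, of i] by simp
    from m[OF this] show "ennreal (measure ?S {\<omega>. coding (i ## \<omega>) \<in> A}) =
        measure coding_measure (sgmap i -` A)"
      by (simp add: coding_Stream)
  qed
  also have "\<dots> = (\<Sum>i<3. ennreal (measure coding_measure (sgmap i -` A))) / 3"
    by (subst nn_integral_pmf_of_set) (auto simp: lessThan_empty_iff)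
  also have "\<dots> = ennreal (\<Sum>i<3. measure coding_measure (sgmap i -` A)) / ennreal 3"
    by (subst sum_ennreal) auto
  also have "\<dots> = ennreal ((\<Sum>i<3. measure coding_measure (sgmap i -` A)) / 3)"
    by (rule divide_ennreal) (auto intro: sum_nonneg)
  finally show ?thesis
    unfolding m[OF assms, symmetric] by (subst (asm) ennreal_inj) (auto simp: sum_less_3)
qed

lemma measure_coding_measure_SG: "measure coding_measure SG = 1"
proof -
  have "SG \<in> sets borel" using closed_SG by simp
  then have "measure coding_measure SG = measure (stream_space (measure_pmf digits)) UNIV"
    unfolding coding_measure_def
    by (subst measure_distr) (auto simp: vimage_def coding_mem_SG space_stream_space)
  also have "\<dots> = 1"
    using prob_space.prob_space[OF prob_space.prob_space_stream_space[OF measure_pmf.prob_space_axioms[of digits]]]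
    by (simp add: space_stream_space)
  finally show ?thesis .
qed

lemma measure_coding_measure_disjoint:
  assumes "A \<in> sets borel" "A \<inter> SG = {}"
  shows "measure coding_measure A = 0"
proof -
  interpret prob_space coding_measure by (rule prob_space_coding_measure)
  have "SG \<in> sets borel" using closed_SG by simp
  with assms have "measure coding_measure (A \<union> SG) = measure coding_measure A + 1"
    by (subst finite_measure_Union) (auto simp: measure_coding_measure_SG)
  with prob_le_1[of "A \<union> SG"] measure_nonneg[of coding_measure A] show ?thesis by linarith
qed

lemma no_point_in_three_cells:
  assumes "x \<in> SG" "y \<in> SG" "z \<in> SG" "sgmap 0 x = sgmap 1 y" "sgmap 0 x = sgmap 2 z"
  shows False
proof -
  have "corner 1 = corner 2"
    using cells_meet(1)[of 0 1 x y] cells_meet(1)[of 0 2 x z] assms by simp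
  then show False by (simp add: corner_def)
qed

text \<open>A point lies in at most two of the three cells, so the largest mass \<open>s\<close> of a point
  satisfies \<open>s \<le> 2/3 s\<close>.\<close>

lemma measure_coding_measure_point: "measure coding_measure {x} = 0"
proof -
  interpret prob_space coding_measure by (rule prob_space_coding_measure)
  define s where "s = (SUP x. measure coding_measure {x})"
  have bdd: "bdd_above (range (\<lambda>x. measure coding_measure {x}))"
    by (intro bdd_aboveI[of _ 1]) auto
  have s: "measure coding_measure {x} \<le> s" for x
    unfolding s_def by (intro cSUP_upper bdd) auto
  have s0: "0 \<le> s" using s[of undefined] measure_nonneg order_trans by blast
  have vim: "sgmap i -` {x} \<subseteq> {sginv i x}" for i x
    by (rule subsetI) (metis sginv_sgmap singletonI vimage_singleton_eq)
  have le: "measure coding_measure (sgmap i -` {x}) \<le> s" for i x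
    using finite_measure_mono[OF vim, of i x] s[of "sginv i x"] by simp
  have "measure coding_measure {x} \<le> 2/3 * s" for x
  proof -
    have "\<exists>i<3. sgmap i -` {x} \<inter> SG = {}"
    proof (rule ccontr)
      assume "\<not> ?thesis"
      then have "\<exists>y\<in>SG. sgmap i y = x" if "i < 3" for i
        using that by blast
      then obtain y where y: "\<And>i. i < 3 \<Longrightarrow> y i \<in> SG \<and> sgmap i (y i) = x"
        by metis
      show False
        using y[of 0] y[of 1] y[of 2] no_point_in_three_cells[of "y 0" "y 1" "y 2"] by simp
    qed
    then obtain i where "i < 3" "sgmap i -` {x} \<inter> SG = {}"
      by blast
    moreover have "sgmap i -` {x} \<in> sets borel" for i
      using measurable_sets[OF borel_measurable_sgmap, of "{x}" i] by simp
    ultimately have "measure coding_measure (sgmap i -` {x}) = 0"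
      using measure_coding_measure_disjoint by blast
    with \<open>i < 3\<close> le[of 0 x] le[of 1 x] le[of 2 x] show ?thesis
      by (subst measure_coding_measure) (auto simp: less_3_iff)
  qed
  then have "s \<le> 2/3 * s"
    unfolding s_def by (intro cSUP_least) auto
  with s[of x] s0 measure_nonneg[of coding_measure "{x}"] show ?thesis by linarith
qed

lemma closed_cell: "closed (cell w)"
  unfolding cell_def
  by (intro compact_imp_closed compact_continuous_image continuous_on_wordmap SG_properties)

lemma cell_borel: "cell w \<in> sets borel"
  using closed_cell by simp

lemma cell_subset_SG: "valid w \<Longrightarrow> cell w \<subseteq> SG"
  by (auto simp: cell_def wordmap_mem)

text \<open>Of the preimages of the cell under the three maps, one is the smaller cell; each other
  one meets \<open>SG\<close> in at most one corner, a null set.\<close>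

lemma measure_coding_measure_cell:
  "valid w \<Longrightarrow> measure coding_measure (cell w) = (1/3) ^ length w"
proof (induction w)
  case Nil
  then show ?case by (simp add: cell_def measure_coding_measure_SG)
next
  case (Cons i w)
  interpret prob_space coding_measure by (rule prob_space_coding_measure)
  have i: "i < 3" and w: "valid w" using Cons.prems by auto
  have vimage_borel: "sgmap j -` cell (i # w) \<in> sets borel" for j
    using measurable_sets[OF borel_measurable_sgmap cell_borel, of j "i # w"] by simp
  have same: "sgmap i -` cell (i # w) = cell w"
    by (auto simp: cell_def)
  have other: "measure coding_measure (sgmap j -` cell (i # w)) = 0" if j: "j < 3" "j \<noteq> i" for j
  proof -
    have "(sgmap j -` cell (i # w) - {corner i}) \<inter> SG = {}"
    proof (rule equals0I)
      fix z assume z: "z \<in> (sgmap j -` cell (i # w) - {corner i}) \<inter> SG"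
      then obtain y where "y \<in> SG" "sgmap j z = sgmap i (wordmap w y)"
        by (auto simp: cell_def)
      then have "z = corner i"
        using cells_meet(1)[OF j(1) i j(2) _ wordmap_mem[OF w]] z by blast
      with z show False by simp
    qed
    then have "measure coding_measure (sgmap j -` cell (i # w) - {corner i}) = 0"
      using vimage_borel by (intro measure_coding_measure_disjoint) auto
    moreover have "measure coding_measure (sgmap j -` cell (i # w)) \<le>
        measure coding_measure ((sgmap j -` cell (i # w) - {corner i}) \<union> {corner i})"
      using vimage_borel by (intro finite_measure_mono) auto
    moreover have "\<dots> \<le> measure coding_measure (sgmap j -` cell (i # w) - {corner i}) +
        measure coding_measure {corner i}"
      using vimage_borel by (intro measure_Un_le) auto
    ultimately show ?thesis
      using measure_coding_measure_point[of "corner i"] measure_nonneg by (simp add: order_antisym)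
  qed
  have "measure coding_measure (cell (i # w)) = measure coding_measure (cell w) / 3"
    using i same other[of 0] other[of 1] other[of 2]
    by (subst measure_coding_measure[OF cell_borel]) (auto simp: less_3_iff)
  with Cons.IH w show ?case by simp
qed

section \<open>Uniqueness of the self-similar measure\<close>

definition self_similar :: "point measure \<Rightarrow> bool" where
  "self_similar M \<longleftrightarrow> prob_space M \<and> sets M = sets borel \<and>
     (\<forall>m. \<forall>w\<in>words m. measure M (cell w) = (1/3) ^ m)"

lemma self_similar_coding_measure: "self_similar coding_measure"
  unfolding self_similar_def
  using prob_space_coding_measure measure_coding_measure_cell words_valid by auto

text \<open>A Riemann sum with one sample point per m-cell, written recursively so that the
  self-similarity of the integral can be read off.\<close>

primrec vertex_mean :: "nat \<Rightarrow> (point \<Rightarrow> real) \<Rightarrow> real" where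
  "vertex_mean 0 = (\<lambda>g. g (corner 0))"
| "vertex_mean (Suc m) = (\<lambda>g. (\<Sum>i<3. vertex_mean m (g \<circ> sgmap i)) / 3)"

lemma vertex_mean_words:
  "vertex_mean m g = (1/3) ^ m * (\<Sum>w\<in>words m. g (wordmap w (corner 0)))"
  by (induction m arbitrary: g) (simp_all add: words_0 sum_words_Suc flip: sum_distrib_left)

lemma card_words: "card (words m) = 3 ^ m"
proof (induction m)
  case (Suc m)
  have "card (words (Suc m)) = card ({..<3::nat} \<times> words m)"
    unfolding words_Suc by (rule card_image) (auto simp: inj_on_def)
  then show ?case using Suc by (simp add: card_cartesian_product)
qed (simp add: words_0)

lemma integrable_on_cell:
  assumes M: "prob_space M" "sets M = sets borel" and g: "continuous_on SG g" "valid w"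
  shows "integrable M (\<lambda>x. indicator (cell w) x * g x :: real)"
proof -
  interpret prob_space M by fact
  have "compact (g ` SG)"
    using g SG_properties by (intro compact_continuous_image)
  then obtain B where B: "\<And>x. x \<in> SG \<Longrightarrow> \<bar>g x\<bar> \<le> B"
    using compact_imp_bounded bounded_iff by (metis imageI real_norm_def)
  have "(\<lambda>x. indicator (cell w) x *\<^sub>R g x) \<in> borel_measurable borel"
    by (intro borel_measurable_continuous_on_indicator cell_borel
        continuous_on_subset[OF g(1)] cell_subset_SG g)
  then have "(\<lambda>x. indicator (cell w) x * g x) \<in> borel_measurable M"
    by (simp add: measurable_cong_sets[OF M(2)])
  moreover have "AE x in M. norm (indicator (cell w) x * g x) \<le> \<bar>B\<bar>"
    using B cell_subset_SG[OF g(2)] by (intro AE_I2) (force simp: indicator_def)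
  ultimately show ?thesis by (intro integrable_const_bound)
qed

text \<open>The weights of cells are prescribed, so continuous functions have the same integrals for
  every self-similar measure. This gives uniqueness as well as a way to compute.\<close>

lemma vertex_mean_tendsto:
  assumes M: "self_similar M" and g: "continuous_on SG g"
  shows "(\<lambda>m. vertex_mean m g) \<longlonglongrightarrow> (LINT x:SG|M. g x)"
proof (rule LIMSEQ_I)
  fix e :: real assume "e > 0"
  interpret prob_space M using M by (simp add: self_similar_def)
  have sets: "sets M = sets borel" and meas: "\<And>m w. w \<in> words m \<Longrightarrow> measure M (cell w) = (1/3) ^ m"
    using M by (auto simp: self_similar_def)
  have SGcell: "SG = cell []" by (simp add: cell_def)
  have int: "integrable M (\<lambda>x. indicator (cell w) x * h x :: real)" if "continuous_on SG h" "valid w" for w h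
    using integrable_on_cell[OF prob_space_axioms sets that] .
  have int1: "integrable M (\<lambda>x. indicator (cell w) x :: real)" if "valid w" for w
    using int[of "\<lambda>_. 1" w] that by simp
  have lint1: "(LINT x|M. indicator (cell w) x :: real) = (1/3) ^ m" if "w \<in> words m" for w m
    using meas[OF that] sets by (simp add: cell_borel sets_eq_imp_space_eq)
  obtain N where N: "\<And>m w x y. m \<ge> N \<Longrightarrow> w \<in> words m \<Longrightarrow> x \<in> SG \<Longrightarrow> y \<in> SG \<Longrightarrow>
    \<bar>g (wordmap w x) - g (wordmap w y)\<bar> < e / 2"
    using cells_small_oscillation[OF g, of "e / 2"] \<open>e > 0\<close> by auto
  have "\<bar>vertex_mean m g - (LINT x:SG|M. g x)\<bar> < e" if "m \<ge> N" for m
  proof -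
    let ?ind = "\<lambda>x. \<Sum>w\<in>words m. indicator (cell w) x :: real"
    have valid: "valid w" if "w \<in> words m" for w using words_valid[OF that] by simp
    \<comment> \<open>Cells overlap, but in a null set: the sum of the cell indicators dominates the
      indicator of \<open>SG\<close>, and both have integral 1.\<close>
    have ge: "indicator SG x \<le> ?ind x" for x
    proof (cases "x \<in> SG")
      case True
      then obtain w where w: "w \<in> words m" "x \<in> cell w"
        using SG_cell_cover[of x m] by (auto simp: cell_def)
      then have "indicator SG x \<le> (indicator (cell w) x :: real)" by simp
      also have "\<dots> \<le> ?ind x"
        by (intro member_le_sum w finite_words) auto
      finally show ?thesis .
    qed (auto intro: sum_nonneg)
    have "(LINT x|M. ?ind x - indicator SG x) = (\<Sum>w\<in>words m. (1/3) ^ m) - 1"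
      using int1 int1[of "[]"] lint1[of _ m] lint1[of "[]" 0] valid
      by (subst Bochner_Integration.integral_diff)
         (auto simp: SGcell[symmetric] words_0 intro!: Bochner_Integration.integrable_sum)
    also have "\<dots> = 0"
      by (simp add: card_words power_divide)
    finally have "AE x in M. ?ind x - indicator SG x = 0"
      using int1 int1[of "[]"] valid ge
      by (subst (asm) integral_nonneg_eq_0_iff_AE)
         (auto simp: SGcell[symmetric] intro!: Bochner_Integration.integrable_sum)
    then have "AE x in M. indicator SG x * g x = (\<Sum>w\<in>words m. indicator (cell w) x * g x)"
      by eventually_elim (simp flip: sum_distrib_right)
    then have "(LINT x:SG|M. g x) = (LINT x|M. (\<Sum>w\<in>words m. indicator (cell w) x * g x))"
      unfolding set_lebesgue_integral_def using int[OF g] int[OF g, of "[]"] valid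
      by (intro integral_cong_AE) (auto simp: SGcell[symmetric])
    also have "\<dots> = (\<Sum>w\<in>words m. LINT x|M. indicator (cell w) x * g x)"
      using int[OF g] valid by (intro Bochner_Integration.integral_sum) auto
    finally have eq: "(LINT x:SG|M. g x) = \<dots>" .
    have le: "\<bar>(1/3) ^ m * g (wordmap w (corner 0)) - (LINT x|M. indicator (cell w) x * g x)\<bar> \<le> (1/3) ^ m * (e / 2)"
      if w: "w \<in> words m" for w
    proof -
      note N' = N[OF \<open>m \<ge> N\<close> w corner_mem_SG[of 0]]
      let ?c = "g (wordmap w (corner 0))"
      have "(1/3) ^ m * ?c - (LINT x|M. indicator (cell w) x * g x) = (LINT x|M. indicator (cell w) x * (?c - g x))"
        using int[OF g valid[OF w]] int1[OF valid[OF w]] lint1[OF w]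
        by (simp add: right_diff_distrib)
      also have "\<bar>\<dots>\<bar> \<le> (LINT x|M. \<bar>indicator (cell w) x * (?c - g x)\<bar>)"
        by (rule integral_abs_bound)
      also have "\<dots> \<le> (LINT x|M. indicator (cell w) x * (e / 2))"
      proof (rule integral_mono)
        show "integrable M (\<lambda>x. \<bar>indicator (cell w) x * (?c - g x)\<bar>)"
          by (intro integrable_abs int valid w continuous_intros g)
        show "\<bar>indicator (cell w) x * (?c - g x)\<bar> \<le> indicator (cell w) x * (e / 2)" for x
          using N' \<open>e > 0\<close>
          by (auto simp: indicator_def cell_def less_imp_le)
      qed (use int1[OF valid[OF w]] in auto)
      also have "\<dots> = (1/3) ^ m * (e / 2)" using lint1[OF w] by simp
      finally show ?thesis .
    qed
    have "\<bar>vertex_mean m g - (LINT x:SG|M. g x)\<bar> =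
        \<bar>\<Sum>w\<in>words m. (1/3) ^ m * g (wordmap w (corner 0)) - (LINT x|M. indicator (cell w) x * g x)\<bar>"
      unfolding eq by (simp add: vertex_mean_words sum_distrib_left sum_subtractf)
    also have "\<dots> \<le> (\<Sum>w\<in>words m. (1/3) ^ m * (e / 2))"
      by (intro order_trans[OF sum_abs] sum_mono le)
    also have "\<dots> = e / 2"
      by (simp add: card_words power_divide)
    finally show ?thesis using \<open>e > 0\<close> by simp
  qed
  then show "\<exists>N. \<forall>m\<ge>N. norm (vertex_mean m g - (LINT x:SG|M. g x)) < e"
    by auto
qed

text \<open>The distance to a closed set yields continuous functions decreasing to its indicator, so
  its mass is a limit of integrals that are already determined.\<close>

lemma self_similar_closed:
  assumes M: "self_similar M" and C: "closed C" "C \<noteq> {}"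
  shows "(\<lambda>n. LINT x:SG|M. max 0 (1 - real n * infdist x C)) \<longlonglongrightarrow> measure M C"
proof -
  interpret prob_space M using M by (simp add: self_similar_def)
  have sets: "sets M = sets borel" using M by (simp add: self_similar_def)
  have "measure M (cell []) = 1"
    using M unfolding self_similar_def by (auto dest!: spec[of _ 0] simp: words_0)
  then have "AE x in M. x \<in> SG"
    by (subst prob_eq_1[symmetric]) (auto simp: cell_def sets closed_SG)
  have meas: "(\<lambda>x. indicator SG x *\<^sub>R max 0 (1 - real n * infdist x C)) \<in> borel_measurable M" for n
    unfolding measurable_cong_sets[OF sets refl]
    by (intro borel_measurable_continuous_on_indicator continuous_intros) (simp add: closed_SG)
  have C': "C \<in> sets M" using C sets by simp
  have "(\<lambda>n. LINT x:SG|M. max 0 (1 - real n * infdist x C)) \<longlonglongrightarrow> (LINT x|M. indicator C x)"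
    unfolding set_lebesgue_integral_def
  proof (rule integral_dominated_convergence[where w = "\<lambda>_. 1"])
    show "AE x in M. (\<lambda>n. indicator SG x *\<^sub>R max 0 (1 - real n * infdist x C)) \<longlonglongrightarrow> indicator C x"
      using \<open>AE x in M. x \<in> SG\<close>
    proof eventually_elim
      case (elim x)
      show ?case
      proof (cases "x \<in> C")
        case False
        then have "infdist x C > 0"
          using in_closed_iff_infdist_zero[OF C] infdist_nonneg[of x C] by (simp add: less_le)
        then obtain N where N: "1 < real N * infdist x C"
          using reals_Archimedean3 by blast
        have "eventually (\<lambda>n. max 0 (1 - real n * infdist x C) = 0) sequentially"
        proof (rule eventually_sequentiallyI[of N])
          fix n assume "N \<le> n"
          then have "real N * infdist x C \<le> real n * infdist x C"
            by (intro mult_right_mono infdist_nonneg) simp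
          with N show "max 0 (1 - real n * infdist x C) = 0" by simp
        qed
        then show ?thesis
          using False elim by (simp add: tendsto_eventually)
      qed (use elim in simp)
    qed
    show "AE x in M. norm (indicator SG x *\<^sub>R max 0 (1 - real n * infdist x C)) \<le> 1" for n
      by (intro AE_I2) (auto simp: indicator_def infdist_nonneg)
  qed (use meas C' in auto)
  then show ?thesis using C' by simp
qed

text \<open>Integrals of continuous functions fix the masses of closed sets, an intersection-stable
  generator of the Borel sets.\<close>

lemma self_similar_unique:
  assumes M: "self_similar M" and N: "self_similar N"
  shows "M = N"
proof -
  interpret M: prob_space M using M by (simp add: self_similar_def)
  interpret N: prob_space N using N by (simp add: self_similar_def)
  have borel: "sets borel = sigma_sets UNIV (Collect closed :: point set set)"
    by (subst borel_eq_closed) simp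
  have "emeasure M C = emeasure N C" if "closed C" for C
  proof (cases "C = {}")
    case False
    have "(LINT x:SG|M. max 0 (1 - real n * infdist x C)) = (LINT x:SG|N. max 0 (1 - real n * infdist x C))" for n
      by (intro LIMSEQ_unique[OF vertex_mean_tendsto[OF M] vertex_mean_tendsto[OF N]] continuous_intros)
    then have "measure M C = measure N C"
      using self_similar_closed[OF M that False] self_similar_closed[OF N that False]
      by (auto intro: LIMSEQ_unique)
    then show ?thesis by (simp add: M.emeasure_eq_measure N.emeasure_eq_measure)
  qed simp
  then show ?thesis
    using M N borel
    by (intro measure_eqI_generator_eq[where E = "Collect closed" and \<Omega> = UNIV and A = "\<lambda>_. UNIV"])
       (auto simp: self_similar_def Int_stable_def M.emeasure_eq_measure)
qed

lemma self_similar_sg_measure: "self_similar sg_measure"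
  unfolding sg_measure_def self_similar_def[symmetric]
  by (rule theI[where P = self_similar, OF self_similar_coding_measure]) (rule self_similar_unique[OF _ self_similar_coding_measure])

section \<open>Integration over the gasket\<close>

definition Int_SG :: "(point \<Rightarrow> real) \<Rightarrow> real" where
  "Int_SG g = (LINT x:SG|sg_measure. g x)"

lemma vertex_mean_tendsto_Int_SG: "continuous_on SG g \<Longrightarrow> (\<lambda>m. vertex_mean m g) \<longlonglongrightarrow> Int_SG g"
  unfolding Int_SG_def by (rule vertex_mean_tendsto[OF self_similar_sg_measure])

lemma Int_SG_cong:
  assumes "\<And>x. x \<in> SG \<Longrightarrow> f x = g x"
  shows "Int_SG f = Int_SG g"
  unfolding Int_SG_def set_lebesgue_integral_def
  by (rule Bochner_Integration.integral_cong) (auto simp: assms indicator_def)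

text \<open>This and the following rules are inherited from the Riemann sums, so continuity takes
  the place of integrability conditions.\<close>

lemma Int_SG_linear:
  assumes "continuous_on SG f" "continuous_on SG g"
  shows "Int_SG (\<lambda>x. s * f x + t * g x) = s * Int_SG f + t * Int_SG g"
proof (rule LIMSEQ_unique[OF vertex_mean_tendsto_Int_SG])
  have "vertex_mean m (\<lambda>x. s * f x + t * g x) = s * vertex_mean m f + t * vertex_mean m g" for m
    by (simp add: vertex_mean_words sum.distrib sum_distrib_left algebra_simps)
  then show "(\<lambda>m. vertex_mean m (\<lambda>x. s * f x + t * g x)) \<longlonglongrightarrow> s * Int_SG f + t * Int_SG g"
    using assms by (auto intro!: tendsto_intros vertex_mean_tendsto_Int_SG)
qed (intro continuous_intros assms)

lemma Int_SG_mult: "continuous_on SG f \<Longrightarrow> Int_SG (\<lambda>x. s * f x) = s * Int_SG f"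
  using Int_SG_linear[of f f s 0] by simp

lemma Int_SG_const: "Int_SG (\<lambda>x. s) = s"
proof (rule LIMSEQ_unique[OF vertex_mean_tendsto_Int_SG])
  have "vertex_mean m (\<lambda>x. s) = s" for m
    by (simp add: vertex_mean_words card_words power_divide)
  then show "(\<lambda>m. vertex_mean m (\<lambda>x. s)) \<longlonglongrightarrow> s" by simp
qed simp

lemma Int_SG_mono:
  assumes "continuous_on SG f" "continuous_on SG g" "\<And>x. x \<in> SG \<Longrightarrow> f x \<le> g x"
  shows "Int_SG f \<le> Int_SG g"
proof (rule LIMSEQ_le[OF vertex_mean_tendsto_Int_SG vertex_mean_tendsto_Int_SG])
  show "\<exists>N. \<forall>n\<ge>N. vertex_mean n f \<le> vertex_mean n g"
    unfolding vertex_mean_words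
    by (intro exI[of _ 0] allI impI mult_left_mono sum_mono assms wordmap_mem corner_mem_SG)
       (auto dest: words_valid)
qed fact+

lemma Int_SG_bound:
  assumes "continuous_on SG f" "\<And>x. x \<in> SG \<Longrightarrow> \<bar>f x\<bar> \<le> B"
  shows "\<bar>Int_SG f\<bar> \<le> B"
  using Int_SG_mono[OF assms(1) continuous_on_const[of _ B]] Int_SG_const[of B]
    Int_SG_mono[OF continuous_on_const[of _ "-B"] assms(1)] Int_SG_const[of "-B"] assms(2)
  by (simp add: abs_le_iff minus_le_iff)

lemma Int_SG_sgmap:
  assumes "continuous_on SG g"
  shows "Int_SG g = (Int_SG (g \<circ> sgmap 0) + Int_SG (g \<circ> sgmap 1) + Int_SG (g \<circ> sgmap 2)) / 3"
proof (rule LIMSEQ_unique)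
  show "(\<lambda>m. vertex_mean (Suc m) g) \<longlonglongrightarrow> Int_SG g"
    by (rule LIMSEQ_Suc[OF vertex_mean_tendsto_Int_SG[OF assms]])
  show "(\<lambda>m. vertex_mean (Suc m) g) \<longlonglongrightarrow>
      (Int_SG (g \<circ> sgmap 0) + Int_SG (g \<circ> sgmap 1) + Int_SG (g \<circ> sgmap 2)) / 3"
    unfolding vertex_mean.simps(2) sum_less_3
    by (intro tendsto_intros vertex_mean_tendsto_Int_SG continuous_on_comp_sgmap assms) auto
qed

section \<open>The weak Laplacian\<close>

text \<open>The piecewise harmonic function with value 1 at the midpoint number \<open>k\<close> and 0 at the
  other vertices of level 1.\<close>

definition tent :: "nat \<Rightarrow> point \<Rightarrow> real" where
  "tent k = glue (\<lambda>i. harmonic_ext (\<lambda>j. of_bool (i \<noteq> j \<and> j \<noteq> k \<and> k \<noteq> i)))"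

lemma tent_sgmap:
  "i < 3 \<Longrightarrow> x \<in> SG \<Longrightarrow> tent k (sgmap i x) = harmonic_ext (\<lambda>j. of_bool (i \<noteq> j \<and> j \<noteq> k \<and> k \<noteq> i)) x"
  unfolding tent_def by (intro glue_sgmap) (auto simp: harm_corner)

lemma continuous_on_tent: "continuous_on SG (tent k)"
  unfolding tent_def by (intro continuous_on_glue continuous_on_harm) (auto simp: harm_corner)

lemma tent_corner: "i < 3 \<Longrightarrow> tent k (corner i) = 0"
  using tent_sgmap[of i "corner i" k] by (simp add: corner_mem_SG harm_corner)

lemma tent_nonneg: "x \<in> SG \<Longrightarrow> 0 \<le> tent k x"
  by (erule SG_cases) (auto simp: tent_sgmap intro!: harm_nonneg)

lemma tent_le_1: "x \<in> SG \<Longrightarrow> tent k x \<le> 1"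
proof (erule SG_cases)
  fix i y assume "i < 3" "y \<in> SG" "x = sgmap i y"
  then show "tent k x \<le> 1"
    using harm_bound[of y "\<lambda>j. of_bool (i \<noteq> j \<and> j \<noteq> k \<and> k \<noteq> i)" 0 1]
    by (auto simp: tent_sgmap abs_le_iff)
qed

definition beta :: "nat \<Rightarrow> (point \<Rightarrow> real) \<Rightarrow> real" where
  "beta k g = Int_SG (\<lambda>x. g x * tent k x)"

lemma beta_linear:
  assumes "continuous_on SG f" "continuous_on SG g"
  shows "beta k (\<lambda>x. s * f x + t * g x) = s * beta k f + t * beta k g"
  using Int_SG_linear[of "\<lambda>x. f x * tent k x" "\<lambda>x. g x * tent k x" s t]
  by (simp add: beta_def assms continuous_on_mult continuous_on_tent algebra_simps)

lemma beta_cong: "(\<And>x. x \<in> SG \<Longrightarrow> f x = g x) \<Longrightarrow> beta k f = beta k g"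
  unfolding beta_def by (intro Int_SG_cong) simp

lemma beta_bound:
  assumes "continuous_on SG f" "\<And>x. x \<in> SG \<Longrightarrow> \<bar>f x\<bar> \<le> B"
  shows "\<bar>beta k f\<bar> \<le> B"
  unfolding beta_def
proof (rule Int_SG_bound)
  fix x assume x: "x \<in> SG"
  have "\<bar>f x\<bar> * \<bar>tent k x\<bar> \<le> B * 1"
    using assms(2)[OF x] tent_nonneg[OF x, of k] tent_le_1[OF x, of k] by (intro mult_mono) auto
  then show "\<bar>f x * tent k x\<bar> \<le> B" by (simp add: abs_mult)
qed (intro continuous_intros assms continuous_on_tent)

text \<open>A tent in cell \<open>w\<close> contributes the energy factor
  \<open>(5/3) ^ (length w + 1)\<close> and the mass factor \<open>(1/3) ^ length w\<close> to the
  weak equation; the coefficient is minus the quotient of mass by energy.\<close>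

definition source :: "(point \<Rightarrow> real) \<Rightarrow> nat list \<Rightarrow> nat \<Rightarrow> real" where
  "source g w k = - (3/5) * (1/5) ^ length w * beta k (g \<circ> wordmap w)"

lemma source_Cons:
  "source g (i # w) k = 1/5 * source (g \<circ> sgmap i) w k"
  by (simp add: source_def comp_assoc)

lemma source_linear:
  assumes "continuous_on SG f" "continuous_on SG g" "valid w"
  shows "source (\<lambda>x. s * f x + t * g x) w k = s * source f w k + t * source g w k"
  using beta_linear[OF continuous_on_comp_wordmap[OF assms(1,3)] continuous_on_comp_wordmap[OF assms(2,3)],
      of k s t]
  by (simp add: source_def comp_def algebra_simps)

lemma source_mult:
  "continuous_on SG f \<Longrightarrow> valid w \<Longrightarrow> source (\<lambda>x. s * f x) w k = s * source f w k"
  using source_linear[of f f w s 0 k] by simp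

lemma source_cong:
  "(\<And>x. x \<in> SG \<Longrightarrow> f x = g x) \<Longrightarrow> valid w \<Longrightarrow> source f w k = source g w k"
  unfolding source_def by (metis beta_cong comp_apply wordmap_mem)

lemma decaying_source:
  assumes "continuous_on SG f" "\<And>x. x \<in> SG \<Longrightarrow> \<bar>f x\<bar> \<le> B"
  shows "decaying B (source f)"
  unfolding decaying_def
proof (intro allI impI)
  fix w and k :: nat assume w: "valid w"
  have "\<bar>beta k (f \<circ> wordmap w)\<bar> \<le> B"
    using assms w by (intro beta_bound continuous_on_comp_wordmap) (auto simp: wordmap_mem)
  then have "3/5 * (1/5) ^ length w * \<bar>beta k (f \<circ> wordmap w)\<bar> \<le> 1 * (1/5) ^ length w * B"
    by (intro mult_mono) auto
  then show "\<bar>source f w k\<bar> \<le> B * (1/5) ^ length w"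
    by (simp add: source_def abs_mult mult.commute)
qed

text \<open>Equivalent to \<open>has_laplacian\<close> by \<open>has_laplacian_iff\<close>, but
  local to cells and free of energies.\<close>

definition pointwise_laplacian :: "(point \<Rightarrow> real) \<Rightarrow> (point \<Rightarrow> real) \<Rightarrow> bool" where
  "pointwise_laplacian u g \<longleftrightarrow> continuous_on SG u \<and> continuous_on SG g \<and> solves u (source g)"

text \<open>Scaling law of the Laplacian: 1/5 is the product of the energy factor 3/5 and the mass
  factor 1/3.\<close>

lemma pointwise_laplacian_sgmap:
  assumes "pointwise_laplacian u g" "i < 3"
  shows "pointwise_laplacian (u \<circ> sgmap i) (\<lambda>x. 1/5 * (g \<circ> sgmap i) x)"
proof -
  have g: "continuous_on SG (g \<circ> sgmap i)" and u: "continuous_on SG (u \<circ> sgmap i)"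
    by (rule continuous_on_comp_sgmap[OF _ assms(2)], use assms(1) in \<open>simp add: pointwise_laplacian_def\<close>)+
  have "solves (u \<circ> sgmap i) (source (\<lambda>x. 1/5 * (g \<circ> sgmap i) x))"
  proof (rule solves_cong)
    show "solves (u \<circ> sgmap i) (\<lambda>w. source g (i # w))"
      using assms by (intro solves_shift) (auto simp: pointwise_laplacian_def)
    show "source g (i # w) k = source (\<lambda>x. 1/5 * (g \<circ> sgmap i) x) w k" if "valid w" for w k
      unfolding source_mult[OF g that] source_Cons ..
  qed simp
  then show ?thesis
    unfolding pointwise_laplacian_def by (intro conjI u continuous_on_mult_left g)
qed

section \<open>Graph energies\<close>

lemma V_0: "V 0 = V0"
  by (simp add: V_def words_0)

lemma V_Suc: "V (Suc m) = (\<Union>i<3. sgmap i ` V m)"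
proof (intro equalityI subsetI)
  fix x assume "x \<in> V (Suc m)"
  then obtain i w p where "i < 3" "w \<in> words m" "p \<in> V0" "x = sgmap i (wordmap w p)"
    unfolding V_def words_Suc by auto
  then show "x \<in> (\<Union>i<3. sgmap i ` V m)"
    unfolding V_def by blast
next
  fix x assume "x \<in> (\<Union>i<3. sgmap i ` V m)"
  then obtain i w p where "i < 3" "w \<in> words m" "p \<in> V0" "x = wordmap (i # w) p"
    unfolding V_def by auto
  moreover from this have "i # w \<in> words (Suc m)" by (auto simp: words_Suc)
  ultimately show "x \<in> V (Suc m)"
    unfolding V_def by blast
qed

lemma V_subset_SG: "V m \<subseteq> SG"
  by (induction m) (auto simp: V_0 V_Suc V0_def corner_mem_SG sgmap_mem)

lemma finite_V: "finite (V m)"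
  by (induction m) (auto simp: V_0 V_Suc V0_def)

lemma corner_mem_V: "i < 3 \<Longrightarrow> corner i \<in> V m"
proof (induction m)
  case 0
  then show ?case by (auto simp: V_0 V0_def less_3_iff)
next
  case (Suc m)
  then have "sgmap i (corner i) \<in> V (Suc m)" unfolding V_Suc by blast
  then show ?case by simp
qed

lemma adj_irrefl: "\<not> adj m x x"
  by (simp add: adj_def)

lemma adj_mem_SG: "adj m x y \<Longrightarrow> x \<in> SG \<and> y \<in> SG"
  using V_subset_SG by (auto simp: adj_def)

text \<open>A vertex in cell i may be listed as an image under another map j. It is then a junction,
  and its preimage is a corner, which belongs to every \<open>V m\<close>.\<close>

lemma sgmap_mem_V_Suc:
  assumes "i < 3" "x \<in> SG" "sgmap i x \<in> V (Suc m)"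
  shows "x \<in> V m"
proof -
  obtain j y where jy: "j < 3" "y \<in> V m" "sgmap i x = sgmap j y"
    using assms(3) by (auto simp: V_Suc)
  show ?thesis
  proof (cases "i = j")
    case False
    then have "x = corner j"
      using cells_meet(1)[OF assms(1) jy(1) _ assms(2)] jy V_subset_SG by blast
    then show ?thesis using corner_mem_V jy by simp
  qed (use jy in simp)
qed

lemma adj_Suc:
  "adj (Suc m) x y \<longleftrightarrow> (\<exists>i<3. \<exists>x' y'. x = sgmap i x' \<and> y = sgmap i y' \<and> adj m x' y')"
proof
  assume *: "adj (Suc m) x y"
  then obtain i w where iw: "i < 3" "w \<in> words m" "x \<in> cell (i # w)" "y \<in> cell (i # w)"
    by (auto simp: adj_def words_Suc)
  then have "x \<in> sgmap i ` cell w" "y \<in> sgmap i ` cell w"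
    by (simp_all add: cell_def image_comp)
  then obtain x' y' where xy: "x' \<in> cell w" "y' \<in> cell w" "x = sgmap i x'" "y = sgmap i y'"
    by blast
  have "x' \<in> SG" "y' \<in> SG"
    using xy cell_subset_SG words_valid[OF iw(2)] by auto
  with * iw xy have "adj m x' y'"
    using sgmap_mem_V_Suc[OF iw(1)] by (auto simp: adj_def)
  with iw xy show "\<exists>i<3. \<exists>x' y'. x = sgmap i x' \<and> y = sgmap i y' \<and> adj m x' y'"
    by blast
next
  assume "\<exists>i<3. \<exists>x' y'. x = sgmap i x' \<and> y = sgmap i y' \<and> adj m x' y'"
  then obtain i x' y' w where *: "i < 3" "x = sgmap i x'" "y = sgmap i y'" "adj m x' y'"
      "w \<in> words m" "x' \<in> cell w" "y' \<in> cell w"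
    unfolding adj_def by blast
  then have "i # w \<in> words (Suc m)" "x \<in> cell (i # w)" "y \<in> cell (i # w)"
    by (auto simp: words_Suc cell_def)
  with * show "adj (Suc m) x y"
    unfolding adj_def V_Suc by auto
qed

lemma adj_Suc_set:
  "{(x, y). adj (Suc m) x y} = (\<Union>i<3. map_prod (sgmap i) (sgmap i) ` {(x, y). adj m x y})"
  by (auto simp: adj_Suc) force

lemma finite_adj: "finite {(x, y). adj m x y}"
  by (rule finite_subset[of _ "V m \<times> V m"]) (auto simp: adj_def finite_V)

text \<open>Two different cells share at most one point, hence no edge, so the edge sum splits; 5/3
  is the change of renormalisation.\<close>

lemma graph_energy_Suc:
  "graph_energy (Suc m) u v = 5/3 * (graph_energy m (u \<circ> sgmap 0) (v \<circ> sgmap 0)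
     + graph_energy m (u \<circ> sgmap 1) (v \<circ> sgmap 1) + graph_energy m (u \<circ> sgmap 2) (v \<circ> sgmap 2))"
proof -
  let ?R = "{(x, y). adj m x y}" and ?f = "\<lambda>u v (x, y). (u x - u y) * (v x - v y)"
  let ?m = "\<lambda>i. map_prod (sgmap i) (sgmap i)"
  have disj: "?m i ` ?R \<inter> ?m j ` ?R = {}" if ij: "i < 3" "j < 3" "i \<noteq> j" for i j
  proof (rule equals0I)
    fix p assume "p \<in> ?m i ` ?R \<inter> ?m j ` ?R"
    then obtain x y x' y' where *: "adj m x y" "adj m x' y'" "sgmap i x = sgmap j x'" "sgmap i y = sgmap j y'"
      by auto
    then have "x = y"
      using cells_meet(1)[OF ij] adj_mem_SG by metis
    with * adj_irrefl show False by blast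
  qed
  have "(\<Sum>p\<in>{(x, y). adj (Suc m) x y}. ?f u v p) = (\<Sum>i<3. \<Sum>p\<in>?m i ` ?R. ?f u v p)"
    unfolding adj_Suc_set by (intro sum.UNION_disjoint) (use disj finite_adj in auto)
  also have "\<dots> = (\<Sum>i<3. \<Sum>p\<in>?R. ?f (u \<circ> sgmap i) (v \<circ> sgmap i) p)"
  proof (rule sum.cong[OF refl])
    fix i
    have "inj_on (?m i) ?R"
      by (intro inj_onI) auto
    then show "(\<Sum>p\<in>?m i ` ?R. ?f u v p) = (\<Sum>p\<in>?R. ?f (u \<circ> sgmap i) (v \<circ> sgmap i) p)"
      by (subst sum.reindex) (auto intro!: sum.cong)
  qed
  finally show ?thesis
    unfolding graph_energy_def sum_less_3 by (simp add: field_simps)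
qed

definition form3 :: "(nat \<Rightarrow> real) \<Rightarrow> (nat \<Rightarrow> real) \<Rightarrow> real" where
  "form3 a b = (a 0 - a 1) * (b 0 - b 1) + (a 1 - a 2) * (b 1 - b 2) + (a 0 - a 2) * (b 0 - b 2)"

lemma distinct_pairs:
  "a \<noteq> b \<Longrightarrow> a \<noteq> c \<Longrightarrow> b \<noteq> c \<Longrightarrow> {(x, y). x \<in> {a, b, c} \<and> y \<in> {a, b, c} \<and> x \<noteq> y} =
    {(a, b), (b, a), (a, c), (c, a), (b, c), (c, b)}"
  by auto

lemma graph_energy_0: "graph_energy 0 u v = form3 (\<lambda>i. u (corner i)) (\<lambda>i. v (corner i))"
proof -
  have d: "corner 0 \<noteq> corner 1" "corner 0 \<noteq> corner 2" "corner 1 \<noteq> corner 2"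
    by (auto simp: corner_def)
  have "adj 0 x y \<longleftrightarrow> x \<in> V0 \<and> y \<in> V0 \<and> x \<noteq> y" for x y
    using V_subset_SG[of 0] by (auto simp: adj_def V_0 words_0 cell_def)
  then have R: "{(x, y). adj 0 x y} = {(corner 0, corner 1), (corner 1, corner 0), (corner 0, corner 2),
      (corner 2, corner 0), (corner 1, corner 2), (corner 2, corner 1)}"
    by (simp only: V0_def distinct_pairs[OF d])
  show ?thesis
    unfolding graph_energy_def R form3_def
    using d d[symmetric] by (simp del: One_nat_def) (simp add: algebra_simps)
qed

lemma graph_energy_1:
  "graph_energy (Suc 0) u v = 5/3 * (form3 (\<lambda>j. u (sgmap 0 (corner j))) (\<lambda>j. v (sgmap 0 (corner j)))
     + form3 (\<lambda>j. u (sgmap 1 (corner j))) (\<lambda>j. v (sgmap 1 (corner j)))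
     + form3 (\<lambda>j. u (sgmap 2 (corner j))) (\<lambda>j. v (sgmap 2 (corner j))))"
  by (simp add: graph_energy_Suc graph_energy_0)

lemma graph_energy_commute: "graph_energy m u v = graph_energy m v u"
  unfolding graph_energy_def by (simp add: mult.commute)

lemma graph_energy_cong:
  assumes "\<And>x. x \<in> SG \<Longrightarrow> u x = u' x" "\<And>x. x \<in> SG \<Longrightarrow> v x = v' x"
  shows "graph_energy m u v = graph_energy m u' v'"
proof -
  have "(\<Sum>(x, y)\<in>{(x, y). adj m x y}. (u x - u y) * (v x - v y)) =
      (\<Sum>(x, y)\<in>{(x, y). adj m x y}. (u' x - u' y) * (v' x - v' y))"
    by (rule sum.cong) (auto simp: assms dest!: adj_mem_SG)
  then show ?thesis by (simp add: graph_energy_def)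
qed

lemma vertex_value:
  "i < 3 \<Longrightarrow> j < 3 \<Longrightarrow> u (sgmap i (corner j)) = (if i = j then u (corner i) else u (midpt (3 - i - j)))"
  by (auto simp: sgmap_corner_midpt)

text \<open>Summation by parts on level 1: the harmonic part of \<open>v\<close> at the midpoints
  reproduces the level 0 energy, and the rest \<open>d v k\<close> pairs with the sources of
  \<open>u\<close>.\<close>

lemma first_level_green:
  assumes "solves u b"
  defines "d \<equiv> \<lambda>v k. v (midpt k) - mid (\<lambda>i. v (corner i)) (\<lambda>k. 0) k"
  shows "graph_energy (Suc 0) u v = graph_energy 0 u v +
    5/3 * (b [] 0 * d v 0 + b [] 1 * d v 1 + b [] 2 * d v 2)"
proof -
  have u: "u (midpt k) = mid (\<lambda>i. u (corner i)) (b []) k" if "k < 3" for k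
    using solvesD[OF assms(1), of "[]" k] that by simp
  show ?thesis
    unfolding graph_energy_1 graph_energy_0 form3_def d_def
    by (simp add: vertex_value u) (simp add: mid_def field_simps)
qed

text \<open>With zero sources \<open>first_level_green\<close> has no correction, on any cell and
  thus at any level; \<open>v\<close> is arbitrary.\<close>

lemma graph_energy_harmonic:
  assumes "solves h (\<lambda>w k. 0)"
  shows "graph_energy m h v = graph_energy 0 h v"
  using assms
proof (induction m arbitrary: h v)
  case (Suc m)
  have "graph_energy m (h \<circ> sgmap i) (v \<circ> sgmap i) = graph_energy 0 (h \<circ> sgmap i) (v \<circ> sgmap i)" if "i < 3" for i
    using Suc.IH[OF solves_shift[OF Suc.prems that]] .
  then have "graph_energy (Suc m) h v = graph_energy (Suc 0) h v"
    by (simp add: graph_energy_Suc)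
  also have "\<dots> = graph_energy 0 h v"
    using first_level_green[OF Suc.prems, of v] by simp
  finally show ?case .
qed simp

section \<open>Gauss-Green formula\<close>

abbreviation bdry_ext :: "(point \<Rightarrow> real) \<Rightarrow> point \<Rightarrow> real" where
  "bdry_ext v \<equiv> harmonic_ext (\<lambda>i. v (corner i))"

text \<open>Passing from the level 0 to the level 1 harmonic interpolant of \<open>v\<close> changes
  the level 1 values only at the midpoints, by \<open>d k\<close>; the change is therefore this
  combination of tents.\<close>

lemma tent_expansion:
  fixes v :: "point \<Rightarrow> real"
  defines "d \<equiv> \<lambda>k. v (midpt k) - mid (\<lambda>i. v (corner i)) (\<lambda>k. 0) k"
  assumes "i < 3" "x \<in> SG"
  shows "d 0 * tent 0 (sgmap i x) + d 1 * tent 1 (sgmap i x) + d 2 * tent 2 (sgmap i x) =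
    bdry_ext (v \<circ> sgmap i) x - bdry_ext v (sgmap i x)"
proof -
  have "v (sgmap i (corner j)) - child (\<lambda>i. v (corner i)) (\<lambda>k. 0) i j =
      (if i = j then 0 else d (3 - i - j))" if "j < 3" for j
    using assms(2) that by (simp add: vertex_value child_def d_def)
  note * = this[of 0] this[of 1] this[of 2]
  have "bdry_ext (v \<circ> sgmap i) x - bdry_ext v (sgmap i x) =
    harmonic_ext (\<lambda>j. 1 * v (sgmap i (corner j)) + (-1) * child (\<lambda>i. v (corner i)) (\<lambda>k. 0) i j) x"
    unfolding harm_sgmap[OF assms(2,3)] by (subst harm_linear[OF assms(3)]) simp
  also have "\<dots> = d 0 * tent 0 (sgmap i x) + d 1 * tent 1 (sgmap i x) + d 2 * tent 2 (sgmap i x)"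
    using assms(2) unfolding tent_sgmap[OF assms(2,3)] harm_hbasis[OF assms(3)]
    by (simp add: * del: One_nat_def) (auto simp: less_3_iff)
  finally show ?thesis ..
qed

text \<open>Its vanishing in the limit is the weak equation tested with
  \<open>v - bdry_ext v\<close>: the energy of \<open>u\<close> with a harmonic function is that of
  level 0, which sees only the corners.\<close>

definition green_defect :: "nat \<Rightarrow> (point \<Rightarrow> real) \<Rightarrow> (point \<Rightarrow> real) \<Rightarrow> (point \<Rightarrow> real) \<Rightarrow> real" where
  "green_defect m u v g =
     graph_energy m u v - graph_energy 0 u v + Int_SG (\<lambda>x. g x * (v x - bdry_ext v x))"

text \<open>The step from level 0 to level 1 is absorbed exactly: it changes the energy by minus the
  integral of g against \<open>T\<close>, and \<open>T\<close> is the change of the harmonic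
  interpolant. The remaining integral splits with 1/3 = (5/3)(1/5).\<close>

lemma green_defect_Suc:
  assumes u: "pointwise_laplacian u g" and v: "continuous_on SG v"
  shows "green_defect (Suc m) u v g =
    5/3 * (green_defect m (u \<circ> sgmap 0) (v \<circ> sgmap 0) (\<lambda>x. 1/5 * (g \<circ> sgmap 0) x)
      + green_defect m (u \<circ> sgmap 1) (v \<circ> sgmap 1) (\<lambda>x. 1/5 * (g \<circ> sgmap 1) x)
      + green_defect m (u \<circ> sgmap 2) (v \<circ> sgmap 2) (\<lambda>x. 1/5 * (g \<circ> sgmap 2) x))"
proof -
  define d where "d = (\<lambda>k. v (midpt k) - mid (\<lambda>i. v (corner i)) (\<lambda>k. 0) k)"
  define T where "T = (\<lambda>x. d 0 * tent 0 x + d 1 * tent 1 x + d 2 * tent 2 x)"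
  have g: "continuous_on SG g" using u by (simp add: pointwise_laplacian_def)
  have T: "continuous_on SG T"
    unfolding T_def by (intro continuous_intros continuous_on_tent)
  note c = continuous_on_harm continuous_on_tent
  have "Int_SG (\<lambda>x. g x * T x) = d 0 * beta 0 g + d 1 * beta 1 g + d 2 * beta 2 g"
  proof -
    have "Int_SG (\<lambda>x. g x * T x) = Int_SG (\<lambda>x. 1 * (d 0 * (g x * tent 0 x) + d 1 * (g x * tent 1 x)) + d 2 * (g x * tent 2 x))"
      by (rule Int_SG_cong) (simp add: T_def algebra_simps)
    also have "\<dots> = d 0 * beta 0 g + d 1 * beta 1 g + d 2 * beta 2 g"
      unfolding beta_def
      by (subst Int_SG_linear, (intro continuous_intros c g)+)+ simp
    finally show ?thesis .
  qed
  moreover have "source g [] k = - (3/5) * beta k g" for k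
    by (simp add: source_def comp_def)
  moreover have "graph_energy (Suc 0) u v = graph_energy 0 u v +
      5/3 * (source g [] 0 * d 0 + source g [] 1 * d 1 + source g [] 2 * d 2)"
    using first_level_green[of u "source g" v] u by (simp add: pointwise_laplacian_def d_def)
  ultimately have E1: "graph_energy (Suc 0) u v = graph_energy 0 u v - Int_SG (\<lambda>x. g x * T x)"
    by (simp add: algebra_simps)
  have cell: "Int_SG (\<lambda>x. 1/5 * (g \<circ> sgmap i) x * ((v \<circ> sgmap i) x - bdry_ext (v \<circ> sgmap i) x)) =
      1/5 * Int_SG ((\<lambda>x. g x * (v x - bdry_ext v x - T x)) \<circ> sgmap i)" if "i < 3" for i
  proof -
    have "Int_SG (\<lambda>x. 1/5 * ((\<lambda>x. g x * (v x - bdry_ext v x - T x)) \<circ> sgmap i) x) =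
        1/5 * Int_SG ((\<lambda>x. g x * (v x - bdry_ext v x - T x)) \<circ> sgmap i)"
      by (intro Int_SG_mult continuous_on_comp_sgmap that continuous_intros g v c T)
    moreover have "Int_SG (\<lambda>x. 1/5 * (g \<circ> sgmap i) x * ((v \<circ> sgmap i) x - bdry_ext (v \<circ> sgmap i) x)) =
        Int_SG (\<lambda>x. 1/5 * ((\<lambda>x. g x * (v x - bdry_ext v x - T x)) \<circ> sgmap i) x)"
    proof (rule Int_SG_cong)
      fix x assume "x \<in> SG"
      from tent_expansion[OF that this, of v]
      have "T (sgmap i x) = bdry_ext (v \<circ> sgmap i) x - bdry_ext v (sgmap i x)"
        by (simp add: T_def d_def)
      then show "1/5 * (g \<circ> sgmap i) x * ((v \<circ> sgmap i) x - bdry_ext (v \<circ> sgmap i) x) =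
          1/5 * ((\<lambda>x. g x * (v x - bdry_ext v x - T x)) \<circ> sgmap i) x"
        by simp
    qed
    ultimately show ?thesis by simp
  qed
  have split: "Int_SG (\<lambda>x. g x * (v x - bdry_ext v x)) - Int_SG (\<lambda>x. g x * T x) =
      Int_SG (\<lambda>x. g x * (v x - bdry_ext v x - T x))"
    using Int_SG_linear[of "\<lambda>x. g x * (v x - bdry_ext v x)" "\<lambda>x. g x * T x" 1 "-1"]
    by (simp add: right_diff_distrib[symmetric] g v c T continuous_intros)
  have "Int_SG (\<lambda>x. g x * (v x - bdry_ext v x - T x)) =
      (Int_SG ((\<lambda>x. g x * (v x - bdry_ext v x - T x)) \<circ> sgmap 0)
      + Int_SG ((\<lambda>x. g x * (v x - bdry_ext v x - T x)) \<circ> sgmap 1)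
      + Int_SG ((\<lambda>x. g x * (v x - bdry_ext v x - T x)) \<circ> sgmap 2)) / 3"
    by (intro Int_SG_sgmap continuous_intros g v c T)
  then show ?thesis
    unfolding green_defect_def using E1 split cell[of 0] cell[of 1] cell[of 2]
      graph_energy_Suc[of m u v] graph_energy_Suc[of 0 u v]
    by (simp add: field_simps)
qed

text \<open>The factor 5/3, three cells and sources reduced to one fifth multiply to 1, so the bound
  does not grow with the level, while \<open>e\<close> is the oscillation on m-cells only.\<close>

lemma green_defect_bound:
  assumes "pointwise_laplacian u g" "continuous_on SG v" "\<And>x. x \<in> SG \<Longrightarrow> \<bar>g x\<bar> \<le> B"
    and "\<And>w x y. w \<in> words m \<Longrightarrow> x \<in> SG \<Longrightarrow> y \<in> SG \<Longrightarrow> \<bar>v (wordmap w x) - v (wordmap w y)\<bar> \<le> e"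
  shows "\<bar>green_defect m u v g\<bar> \<le> B * e"
  using assms
proof (induction m arbitrary: u v g B)
  case 0
  have g: "continuous_on SG g" using 0(1) by (simp add: pointwise_laplacian_def)
  have "\<bar>Int_SG (\<lambda>x. g x * (v x - bdry_ext v x))\<bar> \<le> B * e"
  proof (rule Int_SG_bound)
    fix x assume x: "x \<in> SG"
    have osc: "\<bar>v y - v x\<bar> \<le> e" if "y \<in> SG" for y
      using 0(4)[of "[]" y x] that x by (simp add: words_0)
    have "\<bar>bdry_ext v x - v x\<bar> \<le> e"
      by (intro harm_bound x osc corner_mem_SG)
    with 0(3)[OF x] show "\<bar>g x * (v x - bdry_ext v x)\<bar> \<le> B * e"
      unfolding abs_mult by (intro mult_mono) auto
  qed (intro continuous_intros g 0 continuous_on_harm)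
  then show ?case by (simp add: green_defect_def)
next
  case (Suc m)
  have "\<bar>green_defect m (u \<circ> sgmap i) (v \<circ> sgmap i) (\<lambda>x. 1/5 * (g \<circ> sgmap i) x)\<bar> \<le> (1/5 * B) * e"
    if i: "i < 3" for i
  proof (rule Suc.IH[OF pointwise_laplacian_sgmap[OF Suc.prems(1) i] continuous_on_comp_sgmap[OF Suc.prems(2) i]])
    fix w x y assume "w \<in> words m" "x \<in> SG" "y \<in> SG"
    then show "\<bar>(v \<circ> sgmap i) (wordmap w x) - (v \<circ> sgmap i) (wordmap w y)\<bar> \<le> e"
      using Suc.prems(4)[of "i # w" x y] i by (auto simp: words_Suc)
  qed (use Suc.prems(3) sgmap_mem[OF i] in auto)
  note bound = this[unfolded mult.assoc]
  have average: "\<bar>5/3 * (x + y + z)\<bar> \<le> t"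
    if "\<bar>x\<bar> \<le> 1/5 * t" "\<bar>y\<bar> \<le> 1/5 * t" "\<bar>z\<bar> \<le> 1/5 * t" for x y z t :: real
    using that unfolding abs_le_iff by (simp add: field_simps)
  show ?case
    unfolding green_defect_Suc[OF Suc.prems(1,2)] by (intro average bound) simp_all
qed

lemma gauss_green:
  assumes u: "pointwise_laplacian u g" and v: "continuous_on SG v"
  shows "(\<lambda>m. graph_energy m u v) \<longlonglongrightarrow> graph_energy 0 u v - Int_SG (\<lambda>x. g x * (v x - bdry_ext v x))"
proof -
  have "compact (g ` SG)"
    using u SG_properties by (intro compact_continuous_image) (auto simp: pointwise_laplacian_def)
  then obtain B where B: "B > 0" "\<And>x. x \<in> SG \<Longrightarrow> \<bar>g x\<bar> \<le> B"
    using compact_imp_bounded[of "g ` SG"] by (auto simp: bounded_pos)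
  have "(\<lambda>m. green_defect m u v g) \<longlonglongrightarrow> 0"
  proof (rule LIMSEQ_I)
    fix e :: real assume "e > 0"
    then obtain N where N: "\<And>m w x y. m \<ge> N \<Longrightarrow> w \<in> words m \<Longrightarrow> x \<in> SG \<Longrightarrow> y \<in> SG \<Longrightarrow>
        \<bar>v (wordmap w x) - v (wordmap w y)\<bar> < e / (2 * B)"
      using cells_small_oscillation[OF v, of "e / (2 * B)"] B(1) by auto
    have "\<bar>green_defect m u v g\<bar> < e" if "m \<ge> N" for m
    proof -
      have "\<bar>green_defect m u v g\<bar> \<le> B * (e / (2 * B))"
        by (rule green_defect_bound[OF u v B(2)]) (auto intro: less_imp_le N that)
      also have "\<dots> < e" using B(1) \<open>e > 0\<close> by simp
      finally show ?thesis .
    qed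
    then show "\<exists>N. \<forall>m\<ge>N. norm (green_defect m u v g - 0) < e" by auto
  qed
  then have "(\<lambda>m. green_defect m u v g + (graph_energy 0 u v - Int_SG (\<lambda>x. g x * (v x - bdry_ext v x))))
      \<longlonglongrightarrow> 0 + (graph_energy 0 u v - Int_SG (\<lambda>x. g x * (v x - bdry_ext v x)))"
    by (intro tendsto_add tendsto_const)
  then show ?thesis by (simp add: green_defect_def)
qed

lemma has_laplacian_if_pointwise:
  assumes u: "pointwise_laplacian u g"
  shows "has_laplacian u g"
  unfolding has_laplacian_def
proof (intro conjI ballI impI)
  have c: "continuous_on SG u" "continuous_on SG g"
    using u by (auto simp: pointwise_laplacian_def)
  then show "continuous_on SG g" by simp
  \<comment> \<open>Gauss-Green with v = u supplies the convergence of the energies of u.\<close>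
  show "u \<in> domE"
    using gauss_green[OF u c(1)] c(1) by (auto simp: domE_def convergent_def)
  fix v assume v: "v \<in> domE" "\<forall>x\<in>V0. v x = 0"
  have v0: "v (corner i) = 0" if "i < 3" for i
    using v(2) that by (auto simp: V0_def less_3_iff)
  have "bdry_ext v x = 0" if "x \<in> SG" for x
    using harm_hbasis[OF that, of "\<lambda>i. v (corner i)"] by (simp add: v0)
  then have "Int_SG (\<lambda>x. g x * (v x - bdry_ext v x)) = Int_SG (\<lambda>x. g x * v x)"
    by (intro Int_SG_cong) simp
  moreover have "graph_energy 0 u v = 0"
    by (simp add: graph_energy_0 form3_def v0)
  ultimately show "energy u v = - (LINT x:SG|sg_measure. g x * v x)"
    using gauss_green[OF u, of v] v(1) unfolding energy_def domE_def
    by (intro limI) (simp add: Int_SG_def)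
qed

section \<open>Test functions\<close>

text \<open>A tent transplanted into cell \<open>w\<close> and extended by 0; it vanishes at the
  corners of that cell, so the pieces fit.\<close>

primrec test :: "nat list \<Rightarrow> nat \<Rightarrow> point \<Rightarrow> real" where
  "test [] = tent"
| "test (i # w) = (\<lambda>k. glue (\<lambda>j. if j = i then test w k else (\<lambda>x. 0)))"

lemma test_properties:
  assumes "valid w"
  shows continuous_on_test: "continuous_on SG (test w k)"
    and test_corner: "i < 3 \<Longrightarrow> test w k (corner i) = 0"
    and test_sgmap: "valid (j # w) \<Longrightarrow> i < 3 \<Longrightarrow> x \<in> SG \<Longrightarrow>
      test (j # w) k (sgmap i x) = (if i = j then test w k x else 0)"
proof -
  have *: "continuous_on SG (test w k) \<and> (\<forall>i<3. test w k (corner i) = 0)"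
    using assms
  proof (induction w)
    case Nil
    then show ?case by (simp add: continuous_on_tent tent_corner)
  next
    case (Cons j w)
    let ?v = "\<lambda>i. if i = j then test w k else (\<lambda>x. 0)"
    have IH: "continuous_on SG (test w k)" "\<And>i. i < 3 \<Longrightarrow> test w k (corner i) = 0"
      using Cons by auto
    have "glue ?v (sgmap i (corner i)) = ?v i (corner i)" if "i < 3" for i
      by (rule glue_sgmap) (use that IH corner_mem_SG in auto)
    moreover have "continuous_on SG (glue ?v)"
      by (rule continuous_on_glue) (use IH in auto)
    ultimately show ?case using IH by auto
  qed
  then show "continuous_on SG (test w k)" "i < 3 \<Longrightarrow> test w k (corner i) = 0" by auto
  assume **: "valid (j # w)" "i < 3" "x \<in> SG"
  have "glue (\<lambda>i. if i = j then test w k else (\<lambda>x. 0)) (sgmap i x) =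
      (if i = j then test w k else (\<lambda>x. 0)) x"
    by (rule glue_sgmap) (use * ** in auto)
  then show "test (j # w) k (sgmap i x) = (if i = j then test w k x else 0)" by simp
qed

text \<open>The tent is harmonic on each cell of level 1, so its energy with any function is
  constant from that level on.\<close>

lemma graph_energy_tent: "graph_energy (Suc n) u (tent k) = graph_energy (Suc 0) u (tent k)"
proof -
  have "graph_energy n (u \<circ> sgmap i) (tent k \<circ> sgmap i) = graph_energy 0 (u \<circ> sgmap i) (tent k \<circ> sgmap i)"
    if "i < 3" for i
  proof -
    let ?h = "harmonic_ext (\<lambda>j. of_bool (i \<noteq> j \<and> j \<noteq> k \<and> k \<noteq> i))"
    have "graph_energy m (u \<circ> sgmap i) (tent k \<circ> sgmap i) = graph_energy 0 ?h (u \<circ> sgmap i)" for m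
    proof -
      have "graph_energy m (u \<circ> sgmap i) (tent k \<circ> sgmap i) = graph_energy m (u \<circ> sgmap i) ?h"
        by (rule graph_energy_cong) (auto simp: tent_sgmap that)
      also have "\<dots> = graph_energy 0 ?h (u \<circ> sgmap i)"
        by (subst graph_energy_commute) (rule graph_energy_harmonic[OF solves_harm])
      finally show ?thesis .
    qed
    from this[of n] this[of 0] show ?thesis by (rule trans[OF _ sym])
  qed
  then show ?thesis by (simp add: graph_energy_Suc)
qed

lemma graph_energy_1_tent:
  assumes "k < 3"
  defines "i \<equiv> (k + 1) mod 3" and "j \<equiv> (k + 2) mod 3"
  shows "graph_energy (Suc 0) u (tent k) =
    5/3 * (4 * u (midpt k) - u (midpt i) - u (midpt j) - u (corner i) - u (corner j))"
proof -
  have t: "tent k (sgmap i (corner j)) = of_bool (i \<noteq> j \<and> j \<noteq> k \<and> k \<noteq> i)" if "i < 3" "j < 3" for i j k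
    using that by (simp add: tent_sgmap corner_mem_SG harm_corner)
  show ?thesis
    using assms(1) unfolding graph_energy_1 form3_def i_def j_def less_3_iff
    by (elim disjE) (simp_all add: t tent_corner, simp_all add: vertex_value algebra_simps flip: numeral_2_eq_2)
qed

text \<open>The free index \<open>n\<close> records that the energies are constant from level
  \<open>length w + 1\<close> on, so their limit is attained.\<close>

lemma graph_energy_test:
  "valid w \<Longrightarrow> graph_energy (Suc n + length w) u (test w k) =
    (5/3) ^ length w * graph_energy (Suc 0) (u \<circ> wordmap w) (tent k)"
proof (induction w arbitrary: u)
  case Nil
  then show ?case using graph_energy_tent by (simp add: comp_def)
next
  case (Cons i w)
  let ?m = "Suc n + length w"
  have "graph_energy ?m (u \<circ> sgmap j) (test (i # w) k \<circ> sgmap j) =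
      of_bool (j = i) * graph_energy ?m (u \<circ> sgmap j) (test w k)" if "j < 3" for j
  proof (cases "j = i")
    case True
    then show ?thesis
      using that Cons.prems test_sgmap[of w i j]
      by (simp del: test.simps, intro graph_energy_cong) (auto simp del: test.simps)
  next
    case False
    have "graph_energy ?m (u \<circ> sgmap j) (test (i # w) k \<circ> sgmap j) = graph_energy ?m (u \<circ> sgmap j) (\<lambda>x. 0)"
      using that Cons.prems test_sgmap[of w i j] False
      by (intro graph_energy_cong) (auto simp del: test.simps)
    then show ?thesis using False by (simp add: graph_energy_def)
  qed
  from this[of 0] this[of 1] this[of 2]
  have "graph_energy (Suc ?m) u (test (i # w) k) = 5/3 * graph_energy ?m (u \<circ> sgmap i) (test w k)"
    using Cons.prems by (subst graph_energy_Suc) (auto simp: less_3_iff simp del: test.simps)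
  also have "\<dots> = (5/3) ^ length (i # w) * graph_energy (Suc 0) (u \<circ> wordmap (i # w)) (tent k)"
    using Cons by (simp add: comp_def)
  finally show ?case by (simp only: length_Cons add_Suc_right)
qed

lemma Int_SG_test:
  "valid w \<Longrightarrow> continuous_on SG g \<Longrightarrow> Int_SG (\<lambda>x. g x * test w k x) = (1/3) ^ length w * beta k (g \<circ> wordmap w)"
proof (induction w arbitrary: g)
  case Nil
  then show ?case by (simp add: beta_def)
next
  case (Cons i w)
  have *: "Int_SG ((\<lambda>x. g x * test (i # w) k x) \<circ> sgmap j) =
      of_bool (j = i) * Int_SG (\<lambda>x. (g \<circ> sgmap j) x * test w k x)" if "j < 3" for j
  proof -
    have "Int_SG ((\<lambda>x. g x * test (i # w) k x) \<circ> sgmap j) = Int_SG (\<lambda>x. of_bool (j = i) * ((g \<circ> sgmap j) x * test w k x))"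
      using that Cons.prems test_sgmap[of w i j] by (intro Int_SG_cong) (auto simp del: test.simps)
    then show ?thesis using Int_SG_const[of 0] by (cases "j = i") auto
  qed
  have "Int_SG (\<lambda>x. g x * test (i # w) k x) = Int_SG (\<lambda>x. (g \<circ> sgmap i) x * test w k x) / 3"
    using Cons.prems *[of 0] *[of 1] *[of 2] continuous_on_test[of "i # w"]
    by (subst Int_SG_sgmap) (auto simp: less_3_iff simp del: test.simps intro!: continuous_intros)
  also have "\<dots> = (1/3) ^ length (i # w) * beta k (g \<circ> wordmap (i # w))"
    using Cons continuous_on_comp_sgmap[of g i] by (simp add: comp_def)
  finally show ?case .
qed

lemma midI:
  assumes "4 * m 0 - m 1 - m 2 - a 1 - a 2 = c 0" "4 * m 1 - m 2 - m 0 - a 2 - a 0 = c 1"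
    "4 * m 2 - m 0 - m 1 - a 0 - a 1 = c 2" "k < (3::nat)"
  shows "m k = mid a c k"
  using assms by (auto simp: less_3_iff mid_def field_simps)

lemma pointwise_if_has_laplacian:
  assumes "has_laplacian u g"
  shows "pointwise_laplacian u g"
proof -
  have u: "continuous_on SG u" and g: "continuous_on SG g"
    and weak: "\<And>v. v \<in> domE \<Longrightarrow> \<forall>x\<in>V0. v x = 0 \<Longrightarrow> energy u v = - Int_SG (\<lambda>x. g x * v x)"
    using assms by (auto simp: has_laplacian_def domE_def Int_SG_def)
  have eq: "graph_energy (Suc 0) (u \<circ> wordmap w) (tent k) = 5/3 * source g w k" if w: "valid w" for w k
  proof -
    \<comment> \<open>Stated for every f: f = u evaluates the weak equation, and f =
      \<open>test w k\<close> shows that the test function lies in \<open>domE\<close>.\<close>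
    have lim: "(\<lambda>m. graph_energy m f (test w k)) \<longlonglongrightarrow>
        (5/3) ^ length w * graph_energy (Suc 0) (f \<circ> wordmap w) (tent k)" for f
      by (rule LIMSEQ_offset[where k = "Suc (length w)"]) (use graph_energy_test[OF w] in simp)
    have "test w k \<in> domE"
      using lim continuous_on_test[OF w] by (auto simp: domE_def convergent_def)
    moreover have "\<forall>x\<in>V0. test w k x = 0"
      by (simp add: V0_def test_corner[OF w])
    ultimately have "energy u (test w k) = - Int_SG (\<lambda>x. g x * test w k x)"
      by (rule weak)
    moreover have "energy u (test w k) = (5/3) ^ length w * graph_energy (Suc 0) (u \<circ> wordmap w) (tent k)"
      unfolding energy_def by (intro limI lim)
    ultimately have "(5/3) ^ length w * graph_energy (Suc 0) (u \<circ> wordmap w) (tent k) =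
        - ((1/3) ^ length w * beta k (g \<circ> wordmap w))"
      by (simp add: Int_SG_test[OF w g])
    also have "\<dots> = (5/3) ^ length w * (5/3 * source g w k)"
      by (simp add: source_def flip: power_mult_distrib)
    finally show ?thesis by simp
  qed
  have "u (wordmap w (midpt k)) = mid (\<lambda>i. u (wordmap w (corner i))) (source g w) k"
    if w: "valid w" and k: "k < 3" for w k
    using eq[OF w, of 0] eq[OF w, of 1] eq[OF w, of 2]
    by (intro midI[of "\<lambda>k. u (wordmap w (midpt k))" _ _ k, OF _ _ _ k])
       (simp_all add: graph_energy_1_tent flip: numeral_2_eq_2)
  then show ?thesis
    using u g by (simp add: pointwise_laplacian_def solves_def)
qed

lemma has_laplacian_iff: "has_laplacian u g \<longleftrightarrow> pointwise_laplacian u g"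
  using has_laplacian_if_pointwise pointwise_if_has_laplacian by blast

section \<open>A function determines its Laplacian\<close>

lemma mid_inj:
  assumes "\<And>k. k < 3 \<Longrightarrow> mid a c k = mid a d k" "k < (3::nat)"
  shows "c k = d k"
  using assms(1)[of 0] assms(1)[of 1] assms(1)[of 2] assms(2)
  by (auto simp: less_3_iff mid_def field_simps)

text \<open>On cell i the tents add up to 1 minus the basis function of corner i, and the three
  basis functions have total integral 1; hence (3 - 1)/3.\<close>

lemma sum_beta_const: "beta 0 (\<lambda>x. e) + beta 1 (\<lambda>x. e) + beta 2 (\<lambda>x. e) = 2/3 * e"
proof -
  let ?T = "\<lambda>x. 1 * (1 * tent 0 x + 1 * tent 1 x) + 1 * tent 2 x"
  have cell: "Int_SG (?T \<circ> sgmap i) = 1 - Int_SG (hbasis i)" if "i < 3" for i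
  proof -
    have "Int_SG (?T \<circ> sgmap i) = Int_SG (\<lambda>x. 1 * 1 + (-1) * hbasis i x)"
    proof (rule Int_SG_cong)
      fix x assume x: "x \<in> SG"
      show "(?T \<circ> sgmap i) x = 1 * 1 + (-1) * hbasis i x"
        using that hbasis_sum[OF x] by (auto simp: less_3_iff tent_sgmap x harm_hbasis[OF x])
    qed
    also have "\<dots> = 1 * Int_SG (\<lambda>x. 1) + (-1) * Int_SG (hbasis i)"
      by (intro Int_SG_linear continuous_on_const continuous_on_hbasis)
    finally show ?thesis by (simp add: Int_SG_const)
  qed
  have "Int_SG (\<lambda>x. 1 * (1 * hbasis 0 x + 1 * hbasis 1 x) + 1 * hbasis 2 x) = Int_SG (\<lambda>x. 1)"
    using hbasis_sum by (intro Int_SG_cong) simp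
  moreover have "Int_SG (\<lambda>x. 1 * (1 * hbasis 0 x + 1 * hbasis 1 x) + 1 * hbasis 2 x) =
      Int_SG (hbasis 0) + Int_SG (hbasis 1) + Int_SG (hbasis 2)"
    by (subst Int_SG_linear, (intro continuous_intros continuous_on_hbasis)+)+ simp
  ultimately have h: "Int_SG (hbasis 0) + Int_SG (hbasis 1) + Int_SG (hbasis 2) = 1"
    by (simp add: Int_SG_const)
  have "Int_SG ?T = (Int_SG (?T \<circ> sgmap 0) + Int_SG (?T \<circ> sgmap 1) + Int_SG (?T \<circ> sgmap 2)) / 3"
    by (intro Int_SG_sgmap continuous_intros continuous_on_tent)
  also have "\<dots> = 2/3"
    using h cell[of 0] cell[of 1] cell[of 2] by simp
  finally have "Int_SG ?T = 2/3" .
  moreover have "Int_SG ?T = Int_SG (tent 0) + Int_SG (tent 1) + Int_SG (tent 2)"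
    by (subst Int_SG_linear, (intro continuous_intros continuous_on_tent)+)+ simp
  moreover have "beta k (\<lambda>x. e) = e * Int_SG (tent k)" for k
    unfolding beta_def by (intro Int_SG_mult continuous_on_tent)
  ultimately show ?thesis
    by (simp flip: distrib_left)
qed

lemma beta_mono:
  assumes "continuous_on SG f" "continuous_on SG g" "\<And>x. x \<in> SG \<Longrightarrow> f x \<le> g x"
  shows "beta k f \<le> beta k g"
  unfolding beta_def using assms
  by (intro Int_SG_mono continuous_intros continuous_on_tent mult_right_mono tent_nonneg) auto

text \<open>A continuous function that is positive at a point is bounded below on a small cell, where
  it would have a positive integral against the sum of the tents.\<close>

lemma beta_zero_imp_nonpos:
  assumes d: "continuous_on SG d" and "\<And>w k. valid w \<Longrightarrow> k < 3 \<Longrightarrow> beta k (d \<circ> wordmap w) = 0"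
    and "x \<in> SG"
  shows "d x \<le> 0"
proof (rule ccontr)
  assume pos: "\<not> d x \<le> 0"
  define e where "e = d x / 2"
  have "e > 0" using pos by (simp add: e_def)
  then obtain N where N: "\<And>m w x y. m \<ge> N \<Longrightarrow> w \<in> words m \<Longrightarrow> x \<in> SG \<Longrightarrow> y \<in> SG \<Longrightarrow>
      \<bar>d (wordmap w x) - d (wordmap w y)\<bar> < e"
    using cells_small_oscillation[OF d] by blast
  obtain w y where w: "w \<in> words N" "y \<in> SG" "x = wordmap w y"
    using SG_cell_cover[OF assms(3)] by metis
  have valid: "valid w" using words_valid[OF w(1)] by simp
  have "beta k (\<lambda>x. e) \<le> beta k (d \<circ> wordmap w)" for k
  proof (rule beta_mono)
    fix z assume "z \<in> SG"
    have "d x = 2 * e" by (simp add: e_def)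
    with N[OF order.refl w(1) \<open>z \<in> SG\<close> w(2)] w(3) show "e \<le> (d \<circ> wordmap w) z"
      unfolding abs_less_iff by simp
  qed (use continuous_on_comp_wordmap[OF d valid] in auto)
  from this[of 0] this[of 1] this[of 2] have "2/3 * e \<le> 0"
    using sum_beta_const[of e] assms(2)[OF valid] by simp
  with \<open>e > 0\<close> show False by simp
qed

text \<open>Midpoint values determine the sources, so u fixes the tent integrals of g on all cells,
  and these fix g. Iterated Laplacians being a relation, this makes jets independent of the chosen
  representative.\<close>

lemma has_laplacian_unique:
  assumes "has_laplacian u g" "has_laplacian u h" "x \<in> SG"
  shows "g x = h x"
proof -
  have g: "continuous_on SG g" "solves u (source g)" and h: "continuous_on SG h" "solves u (source h)"
    using assms by (auto simp: has_laplacian_iff pointwise_laplacian_def)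
  have b: "beta k (g \<circ> wordmap w) = beta k (h \<circ> wordmap w)" if w: "valid w" and k: "k < 3" for w k
  proof -
    have "mid (\<lambda>i. u (wordmap w (corner i))) (source g w) j =
        mid (\<lambda>i. u (wordmap w (corner i))) (source h w) j" if "j < 3" for j
      using solvesD[OF g(2) w that] solvesD[OF h(2) w that] by simp
    from mid_inj[OF this k] have "source g w k = source h w k" .
    then show ?thesis by (simp add: source_def)
  qed
  have le: "g x \<le> h x" if g: "continuous_on SG g" and h: "continuous_on SG h"
    and b: "\<And>w k. valid w \<Longrightarrow> k < 3 \<Longrightarrow> beta k (g \<circ> wordmap w) = beta k (h \<circ> wordmap w)" for g h
  proof -
    have "(\<lambda>x. 1 * g x + (-1) * h x) x \<le> 0"
    proof (rule beta_zero_imp_nonpos[OF _ _ assms(3)])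
      fix w and k :: nat assume w: "valid w" and k: "k < 3"
      show "beta k ((\<lambda>x. 1 * g x + (-1) * h x) \<circ> wordmap w) = 0"
        using beta_linear[OF continuous_on_comp_wordmap[OF g w] continuous_on_comp_wordmap[OF h w], of k 1 "-1"]
          b[OF w k] by (simp add: comp_def)
    qed (intro continuous_intros g h)
    then show ?thesis by simp
  qed
  show ?thesis
    using le[OF g(1) h(1) b] le[OF h(1) g(1) b[symmetric]] by simp
qed

lemma has_laplacian_cong:
  assumes "has_laplacian u g" "\<And>x. x \<in> SG \<Longrightarrow> u x = u' x"
  shows "has_laplacian u' g"
  using assms continuous_on_eq[of SG u u'] solves_cong[of u "source g" u' "source g"]
  unfolding has_laplacian_iff pointwise_laplacian_def by blast

section \<open>Iterated Laplacians\<close>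

lemma has_laplacian_cong_right:
  assumes "has_laplacian u g" "\<And>x. x \<in> SG \<Longrightarrow> g x = h x"
  shows "has_laplacian u h"
proof -
  have c: "continuous_on SG u" "continuous_on SG g" and s: "solves u (source g)"
    using assms(1) by (auto simp: has_laplacian_iff pointwise_laplacian_def)
  have "continuous_on SG h"
    by (rule continuous_on_eq[OF c(2) assms(2)])
  moreover have "solves u (source h)"
    by (rule solves_cong[OF s]) (simp_all add: source_cong[OF assms(2)])
  ultimately show ?thesis
    using c by (simp add: has_laplacian_iff pointwise_laplacian_def)
qed

lemma has_laplacian_pow_cong:
  assumes "has_laplacian_pow n u f" "\<And>x. x \<in> SG \<Longrightarrow> u x = u' x"
  shows "has_laplacian_pow n u' f"
proof (cases n)
  case 0
  then show ?thesis using assms by simp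
next
  case (Suc m)
  then obtain g where "has_laplacian u g" "has_laplacian_pow m g f"
    using assms(1) by auto
  from has_laplacian_cong[OF this(1) assms(2)] this(2) Suc show ?thesis
    by auto
qed

section \<open>Jets at the corner and their uniqueness\<close>

lemma funpow_sgmap_mem: "x \<in> SG \<Longrightarrow> (sgmap 0 ^^ m) x \<in> SG"
  by (induction m) (auto simp: sgmap_mem)

lemma has_normal_deriv_cong:
  assumes "has_normal_deriv u 0 d" "\<And>x. x \<in> SG \<Longrightarrow> u x = u' x"
  shows "has_normal_deriv u' 0 d"
  using assms(1) unfolding has_normal_deriv_def
  by (simp add: assms(2)[symmetric] corner_mem_SG funpow_sgmap_mem)

lemma has_tangential_deriv_cong:
  assumes "has_tangential_deriv u 0 d" "\<And>x. x \<in> SG \<Longrightarrow> u x = u' x"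
  shows "has_tangential_deriv u' 0 d"
  using assms(1) unfolding has_tangential_deriv_def
  by (simp add: assms(2)[symmetric] corner_mem_SG funpow_sgmap_mem)

text \<open>Restricting to cell 0 the harmonic functions that vanish at q_0 has the symmetric
  eigenvalue 3/5 and the antisymmetric eigenvalue 1/5, the reciprocals of the factors in the normal
  and tangential derivatives.\<close>

lemma harmonic_scaling:
  assumes "solves h (\<lambda>w k. 0)" "h (corner 0) = 0"
  shows "h ((sgmap 0 ^^ m) (corner 1)) + h ((sgmap 0 ^^ m) (corner 2)) = (3/5) ^ m * (h (corner 1) + h (corner 2))"
    and "h ((sgmap 0 ^^ m) (corner 1)) - h ((sgmap 0 ^^ m) (corner 2)) = (1/5) ^ m * (h (corner 1) - h (corner 2))"
proof -
  have "h ((sgmap 0 ^^ m) (corner 1)) + h ((sgmap 0 ^^ m) (corner 2)) = (3/5) ^ m * (h (corner 1) + h (corner 2)) \<and>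
    h ((sgmap 0 ^^ m) (corner 1)) - h ((sgmap 0 ^^ m) (corner 2)) = (1/5) ^ m * (h (corner 1) - h (corner 2))"
    using assms
  proof (induction m arbitrary: h)
    case (Suc m)
    have h: "h (sgmap 0 (corner 1)) = (2 * h (corner 1) + h (corner 2)) / 5"
      "h (sgmap 0 (corner 2)) = (h (corner 1) + 2 * h (corner 2)) / 5"
      using solves_child[OF Suc.prems(1), of 0 1] solves_child[OF Suc.prems(1), of 0 2] Suc.prems(2)
      by (auto simp: child_def mid_def)
    have "(h \<circ> sgmap 0) (corner 0) = 0" "solves (h \<circ> sgmap 0) (\<lambda>w k. 0)"
      using Suc.prems solves_shift[OF Suc.prems(1), of 0] by auto
    note IH = Suc.IH[OF this(2,1)]
    have "(h \<circ> sgmap 0) (corner 1) + (h \<circ> sgmap 0) (corner 2) = 3/5 * (h (corner 1) + h (corner 2))"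
      "(h \<circ> sgmap 0) (corner 1) - (h \<circ> sgmap 0) (corner 2) = 1/5 * (h (corner 1) - h (corner 2))"
      by (simp_all add: h field_simps del: One_nat_def)
    from IH[unfolded this] show ?case
      by (simp del: One_nat_def)
  qed simp
  then show "h ((sgmap 0 ^^ m) (corner 1)) + h ((sgmap 0 ^^ m) (corner 2)) = (3/5) ^ m * (h (corner 1) + h (corner 2))"
    "h ((sgmap 0 ^^ m) (corner 1)) - h ((sgmap 0 ^^ m) (corner 2)) = (1/5) ^ m * (h (corner 1) - h (corner 2))"
    by auto
qed

text \<open>The difference of the two functions is harmonic and 0 at q_0. By
  \<open>harmonic_scaling\<close> the sequences defining its derivatives are constant, so zero
  derivatives kill the sum and the difference of its other two corner values.\<close>

lemma poisson_unique_at_corner: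
  assumes u: "has_laplacian u g" "has_normal_deriv u 0 b" "has_tangential_deriv u 0 c"
    and v: "has_laplacian v h" "has_normal_deriv v 0 b" "has_tangential_deriv v 0 c"
    and eq: "\<And>x. x \<in> SG \<Longrightarrow> g x = h x" "u (corner 0) = v (corner 0)" and x: "x \<in> SG"
  shows "u x = v x"
proof -
  let ?h = "\<lambda>x. 1 * u x + (-1) * v x"
  have su: "solves u (source g)" and sv: "solves v (source h)"
    and cu: "continuous_on SG u" and cv: "continuous_on SG v"
    using u v by (auto simp: has_laplacian_iff pointwise_laplacian_def)
  have s: "solves ?h (\<lambda>w k. 0)"
    by (rule solves_cong[OF solves_linear[OF su sv, of 1 "-1"]]) (use source_cong[of g h] eq in auto)
  have h0: "?h (corner 0) = 0" using eq by simp
  have "(\<lambda>m. (5/3) ^ m * (2 * u (corner 0) - u ((sgmap 0 ^^ m) (corner 1)) - u ((sgmap 0 ^^ m) (corner 2)))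
      - (5/3) ^ m * (2 * v (corner 0) - v ((sgmap 0 ^^ m) (corner 1)) - v ((sgmap 0 ^^ m) (corner 2)))) \<longlonglongrightarrow> b - b"
    using u(2) v(2) unfolding has_normal_deriv_def by (intro tendsto_diff) (simp_all add: numeral_2_eq_2)
  moreover have "(5/3) ^ m * (2 * u (corner 0) - u ((sgmap 0 ^^ m) (corner 1)) - u ((sgmap 0 ^^ m) (corner 2)))
      - (5/3) ^ m * (2 * v (corner 0) - v ((sgmap 0 ^^ m) (corner 1)) - v ((sgmap 0 ^^ m) (corner 2)))
      = - (?h (corner 1) + ?h (corner 2))" for m
  proof -
    have "(5/3) ^ m * (2 * u (corner 0) - u ((sgmap 0 ^^ m) (corner 1)) - u ((sgmap 0 ^^ m) (corner 2)))
      - (5/3) ^ m * (2 * v (corner 0) - v ((sgmap 0 ^^ m) (corner 1)) - v ((sgmap 0 ^^ m) (corner 2)))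
      = - ((5/3) ^ m * (?h ((sgmap 0 ^^ m) (corner 1)) + ?h ((sgmap 0 ^^ m) (corner 2))))"
      using eq(2) by (simp add: algebra_simps)
    also have "\<dots> = - ((5/3) ^ m * (3/5) ^ m * (?h (corner 1) + ?h (corner 2)))"
      unfolding harmonic_scaling(1)[OF s h0] by simp
    finally show ?thesis by (simp flip: power_mult_distrib)
  qed
  ultimately have sum: "?h (corner 1) + ?h (corner 2) = 0"
    by (simp add: LIMSEQ_const_iff)
  have "(\<lambda>m. 5 ^ m * (u ((sgmap 0 ^^ m) (corner 1)) - u ((sgmap 0 ^^ m) (corner 2)))
      - 5 ^ m * (v ((sgmap 0 ^^ m) (corner 1)) - v ((sgmap 0 ^^ m) (corner 2)))) \<longlonglongrightarrow> c - c"
    using u(3) v(3) unfolding has_tangential_deriv_def by (intro tendsto_diff) (simp_all add: numeral_2_eq_2)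
  moreover have "5 ^ m * (u ((sgmap 0 ^^ m) (corner 1)) - u ((sgmap 0 ^^ m) (corner 2)))
      - 5 ^ m * (v ((sgmap 0 ^^ m) (corner 1)) - v ((sgmap 0 ^^ m) (corner 2)))
      = ?h (corner 1) - ?h (corner 2)" for m
  proof -
    have "5 ^ m * (u ((sgmap 0 ^^ m) (corner 1)) - u ((sgmap 0 ^^ m) (corner 2)))
      - 5 ^ m * (v ((sgmap 0 ^^ m) (corner 1)) - v ((sgmap 0 ^^ m) (corner 2)))
      = 5 ^ m * (?h ((sgmap 0 ^^ m) (corner 1)) - ?h ((sgmap 0 ^^ m) (corner 2)))"
      by (simp add: algebra_simps)
    also have "\<dots> = 5 ^ m * (1/5) ^ m * (?h (corner 1) - ?h (corner 2))"
      unfolding harmonic_scaling(2)[OF s h0] by simp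
    finally show ?thesis by (simp flip: power_mult_distrib)
  qed
  ultimately have "?h (corner 1) - ?h (corner 2) = 0"
    by (simp add: LIMSEQ_const_iff)
  with sum h0 have "?h (corner i) = 0" if "i < 3" for i
    using that by (auto simp: less_3_iff)
  moreover have "?h x = harmonic_ext (\<lambda>i. ?h (corner i)) x"
    by (rule harm_unique[OF s _ x]) (intro continuous_intros cu cv)
  ultimately have "?h x = 0"
    unfolding harm_hbasis[OF x] by simp
  then show ?thesis by simp
qed

text \<open>Arbitrary data replace the Kronecker deltas of \<open>is_monomial\<close>, so that
  passing to the Laplacian merely shifts the data and induction on j applies.\<close>

definition has_jets :: "nat \<Rightarrow> (point \<Rightarrow> real) \<Rightarrow> (nat \<Rightarrow> real) \<Rightarrow> (nat \<Rightarrow> real) \<Rightarrow> (nat \<Rightarrow> real) \<Rightarrow> bool" where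
  "has_jets j u a b c \<longleftrightarrow> has_laplacian_pow (Suc j) u (\<lambda>x. 0) \<and>
     (\<forall>n\<le>j. \<exists>g. has_laplacian_pow n u g \<and> g (corner 0) = a n \<and>
        has_normal_deriv g 0 (b n) \<and> has_tangential_deriv g 0 (c n))"

lemma is_monomial_iff:
  "is_monomial j k u \<longleftrightarrow> has_jets j u (\<lambda>n. of_bool (n = j \<and> k = 1))
     (\<lambda>n. of_bool (n = j \<and> k = 2)) (\<lambda>n. of_bool (n = j \<and> k = 3))"
  by (simp add: is_monomial_def has_jets_def)

lemma has_jets_0:
  assumes "has_jets j u a b c"
  shows "u (corner 0) = a 0" "has_normal_deriv u 0 (b 0)" "has_tangential_deriv u 0 (c 0)"
proof -
  obtain g where g: "\<And>x. x \<in> SG \<Longrightarrow> u x = g x" "g (corner 0) = a 0"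
      "has_normal_deriv g 0 (b 0)" "has_tangential_deriv g 0 (c 0)"
    using assms unfolding has_jets_def by (auto dest!: spec[of _ 0])
  then show "u (corner 0) = a 0" "has_normal_deriv u 0 (b 0)" "has_tangential_deriv u 0 (c 0)"
    using has_normal_deriv_cong[of g _ u] has_tangential_deriv_cong[of g _ u]
    by (simp_all add: corner_mem_SG)
qed

lemma has_jets_laplacian:
  assumes "has_jets (Suc j) u a b c" "has_laplacian u g"
  shows "has_jets j g (\<lambda>n. a (Suc n)) (\<lambda>n. b (Suc n)) (\<lambda>n. c (Suc n))"
proof -
  have step: "has_laplacian_pow n g f" if "has_laplacian_pow (Suc n) u f" for n f
  proof -
    from that obtain g' where g': "has_laplacian u g'" "has_laplacian_pow n g' f" by auto
    show ?thesis
      by (rule has_laplacian_pow_cong[OF g'(2) has_laplacian_unique[OF g'(1) assms(2)]])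
  qed
  show ?thesis
    unfolding has_jets_def
  proof (intro conjI allI impI)
    show "has_laplacian_pow (Suc j) g (\<lambda>x. 0)"
      using assms(1) unfolding has_jets_def by (intro step) simp
    fix n assume "n \<le> j"
    then have "Suc n \<le> Suc j" by simp
    with assms(1) obtain f where "has_laplacian_pow (Suc n) u f" "f (corner 0) = a (Suc n)"
        "has_normal_deriv f 0 (b (Suc n))" "has_tangential_deriv f 0 (c (Suc n))"
      unfolding has_jets_def by blast
    with step show "\<exists>f. has_laplacian_pow n g f \<and> f (corner 0) = a (Suc n) \<and>
        has_normal_deriv f 0 (b (Suc n)) \<and> has_tangential_deriv f 0 (c (Suc n))"
      by blast
  qed
qed

lemma has_jets_unique:
  assumes "has_jets j u a b c" "has_jets j v a b c" "x \<in> SG"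
  shows "u x = v x"
  using assms
proof (induction j arbitrary: u v a b c x)
  case 0
  obtain g h where "has_laplacian u g" "\<And>x. x \<in> SG \<Longrightarrow> g x = 0"
      "has_laplacian v h" "\<And>x. x \<in> SG \<Longrightarrow> h x = 0"
    using 0(1,2) unfolding has_jets_def by auto
  then show ?case
    using has_jets_0[OF 0(1)] has_jets_0[OF 0(2)] 0(3)
    by - (rule poisson_unique_at_corner[of u g "b 0" "c 0" v h], auto)
next
  case (Suc j)
  obtain g h where gh: "has_laplacian u g" "has_laplacian v h"
    using Suc.prems(1,2) unfolding has_jets_def by auto
  have "g y = h y" if "y \<in> SG" for y
    using Suc.IH[OF has_jets_laplacian[OF Suc.prems(1) gh(1)] has_jets_laplacian[OF Suc.prems(2) gh(2)] that] .
  then show ?case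
    using has_jets_0[OF Suc.prems(1)] has_jets_0[OF Suc.prems(2)] gh Suc.prems(3)
    by - (rule poisson_unique_at_corner[of u g "b 0" "c 0" v h], auto)
qed

lemma has_jets_cong:
  assumes "has_jets j u a b c" "\<And>x. x \<in> SG \<Longrightarrow> u x = v x"
  shows "has_jets j v a b c"
proof -
  have "has_laplacian_pow n v f" if "has_laplacian_pow n u f" for n f
    by (rule has_laplacian_pow_cong[OF that assms(2)])
  with assms(1) show ?thesis unfolding has_jets_def by blast
qed

text \<open>Uniqueness holds on \<open>SG\<close> only, so the witness for the definite description
  is cut off to 0 outside.\<close>

lemma P_eqI:
  assumes "is_monomial j k u" "x \<in> SG"
  shows "P j k x = u x"
proof -
  let ?u = "\<lambda>x. if x \<in> SG then u x else 0"
  have "P j k = ?u"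
    unfolding P_def
  proof (rule the_equality)
    have "is_monomial j k ?u"
      using assms(1) has_jets_cong[of j u _ _ _ ?u] unfolding is_monomial_iff by simp
    then show "is_monomial j k ?u \<and> (\<forall>x. x \<notin> SG \<longrightarrow> ?u x = 0)" by simp
    fix v assume v: "is_monomial j k v \<and> (\<forall>x. x \<notin> SG \<longrightarrow> v x = 0)"
    show "v = ?u"
    proof
      fix x
      show "v x = ?u x"
      proof (cases "x \<in> SG")
        case True
        have "v x = u x"
          by (rule has_jets_unique[OF v[THEN conjunct1, unfolded is_monomial_iff]
                assms(1)[unfolded is_monomial_iff] True])
        with True show ?thesis by simp
      qed (simp add: v[THEN conjunct2, rule_format])
    qed
  qed
  with assms(2) show ?thesis by simp
qed

section \<open>Reflection\<close>

definition mirror :: "point \<Rightarrow> point" where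
  "mirror x = (1 - fst x, snd x)"

text \<open>The permutation of corners induced by \<open>mirror\<close>: it fixes 0 and exchanges 1
  and 2.\<close>

definition rho :: "nat \<Rightarrow> nat" where
  "rho i = 2 * i mod 3"

lemma rho_less [simp]: "rho i < 3"
  by (simp add: rho_def)

lemma mirror_mirror [simp]: "mirror (mirror x) = x"
  by (simp add: mirror_def)

lemma mirror_corner: "mirror (corner i) = corner (rho i)"
proof -
  have "mirror (corner i) = corner (rho i)" if "i < 3" for i
    using that by (auto simp: mirror_def corner_def rho_def less_3_iff)
  from this[of "i mod 3"] show ?thesis
    by (simp add: corner_mod rho_def mod_mult_right_eq)
qed

lemma mirror_sgmap: "mirror (sgmap i x) = sgmap (rho i) (mirror x)"
proof -
  have "mirror (sgmap i x) = (1/2) *\<^sub>R (mirror x - mirror (corner i)) + mirror (corner i)"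
    by (simp add: mirror_def sgmap_def prod_eq_iff field_simps)
  then show ?thesis by (simp add: mirror_corner sgmap_def)
qed

lemma continuous_on_mirror: "continuous_on S mirror"
  unfolding mirror_def by (intro continuous_intros)

text \<open>The mirror image of \<open>SG\<close> satisfies the same fixed-point equation, with
  cells 1 and 2 exchanged.\<close>

lemma mirror_mem:
  assumes "x \<in> SG"
  shows "mirror x \<in> SG"
proof -
  have "mirror ` SG = (\<Union>i<3. sgmap i ` mirror ` SG)"
  proof (intro equalityI subsetI)
    fix y assume "y \<in> mirror ` SG"
    then obtain x where "x \<in> SG" "y = mirror x" by auto
    with SG_cases[of x] obtain i z where "i < 3" "z \<in> SG" "y = sgmap (rho i) (mirror z)"
      by (metis mirror_sgmap)
    then show "y \<in> (\<Union>i<3. sgmap i ` mirror ` SG)"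
      using rho_less[of i] by blast
  next
    fix y assume "y \<in> (\<Union>i<3. sgmap i ` mirror ` SG)"
    then obtain i z where *: "i < 3" "z \<in> SG" "y = sgmap i (mirror z)" by auto
    then have "y = mirror (sgmap (rho i) z)"
      by (auto simp: mirror_sgmap less_3_iff rho_def)
    then show "y \<in> mirror ` SG"
      using sgmap_mem[OF rho_less *(2)] by blast
  qed
  then have "mirror ` SG \<subseteq> SG"
    by (intro similar_sets_unique SG_properties compact_continuous_image continuous_on_mirror)
       (use SG_properties(1) in auto)
  with assms show ?thesis by auto
qed

lemma continuous_on_comp_mirror: "continuous_on SG u \<Longrightarrow> continuous_on SG (u \<circ> mirror)"
  by (intro continuous_on_compose continuous_on_mirror) (auto intro: continuous_on_subset simp: mirror_mem)

lemma mirror_midpt: "k < 3 \<Longrightarrow> mirror (midpt k) = midpt (rho k)"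
proof -
  have "mirror (midpt k) = sgmap (rho (k + 1)) (corner (rho (k + 2)))"
    by (simp add: midpt_def mirror_sgmap mirror_corner)
  then show "k < 3 \<Longrightarrow> ?thesis"
    by (auto simp: less_3_iff rho_def sgmap_corner_midpt simp del: One_nat_def)
qed

lemma mirror_wordmap: "mirror (wordmap w x) = wordmap (map rho w) (mirror x)"
  by (induction w) (auto simp: mirror_sgmap)

lemma valid_map_rho: "valid (map rho w)"
  by auto

lemma solves_mirror:
  assumes "solves u b"
  shows "solves (u \<circ> mirror) (\<lambda>w k. b (map rho w) (rho k))"
  unfolding solves_def
proof (intro allI impI)
  fix w and k :: nat assume "valid w" "k < 3"
  have "(u \<circ> mirror) (wordmap w (midpt k)) =
      mid (\<lambda>i. u (wordmap (map rho w) (corner i))) (b (map rho w)) (rho k)"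
    using solvesD[OF assms valid_map_rho rho_less, of w k] \<open>k < 3\<close> by (simp add: mirror_wordmap mirror_midpt)
  also have "\<dots> = mid (\<lambda>i. (u \<circ> mirror) (wordmap w (corner i))) (\<lambda>k. b (map rho w) (rho k)) k"
    using \<open>k < 3\<close> by (auto simp: less_3_iff mirror_wordmap mirror_corner mid_def rho_def)
  finally show "(u \<circ> mirror) (wordmap w (midpt k)) = \<dots>" .
qed

lemma harm_mirror:
  assumes "x \<in> SG"
  shows "harmonic_ext a (mirror x) = harmonic_ext (\<lambda>i. a (rho i)) x"
proof -
  have "(harmonic_ext a \<circ> mirror) x = harmonic_ext (\<lambda>i. (harmonic_ext a \<circ> mirror) (corner i)) x"
    by (intro harm_unique solves_mirror[OF solves_harm] continuous_on_comp_mirror continuous_on_harm assms)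
  then show ?thesis by (simp add: mirror_corner harm_corner)
qed

lemma tent_mirror:
  assumes "x \<in> SG" "k < 3"
  shows "tent k (mirror x) = tent (rho k) x"
proof -
  obtain i y where iy: "i < 3" "y \<in> SG" "x = sgmap i y"
    using SG_cases[OF assms(1)] .
  have "(rho i \<noteq> rho j \<and> rho j \<noteq> k \<and> k \<noteq> rho i) = (i \<noteq> j \<and> j \<noteq> rho k \<and> rho k \<noteq> i)" if "j < 3" for j
    using that iy(1) assms(2) unfolding less_3_iff by (elim disjE) (simp_all add: rho_def)
  from this[of 0] this[of 1] this[of 2] show ?thesis
    unfolding iy(3) mirror_sgmap tent_sgmap[OF iy(1,2)] tent_sgmap[OF rho_less mirror_mem[OF iy(2)]] harm_mirror[OF iy(2)]
      harm_hbasis[OF iy(2)]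
    by simp
qed

lemma vertex_mean_mirror: "vertex_mean m (g \<circ> mirror) = vertex_mean m g"
proof (induction m arbitrary: g)
  case (Suc m)
  have "(g \<circ> mirror) \<circ> sgmap i = (g \<circ> sgmap (rho i)) \<circ> mirror" for i
    by (auto simp: fun_eq_iff mirror_sgmap)
  then have "vertex_mean m ((g \<circ> mirror) \<circ> sgmap i) = vertex_mean m (g \<circ> sgmap (rho i))" for i
    by (simp only: Suc)
  then show ?case
    unfolding vertex_mean.simps(2) sum_less_3 by (simp add: rho_def)
qed (simp add: mirror_corner rho_def)

lemma Int_SG_mirror: "continuous_on SG g \<Longrightarrow> Int_SG (g \<circ> mirror) = Int_SG g"
  using vertex_mean_tendsto_Int_SG[OF continuous_on_comp_mirror, of g] vertex_mean_tendsto_Int_SG[of g]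
  by (auto simp: vertex_mean_mirror intro: LIMSEQ_unique)

lemma beta_mirror:
  assumes "continuous_on SG g" "k < 3"
  shows "beta k (g \<circ> mirror) = beta (rho k) g"
proof -
  have "beta k (g \<circ> mirror) = Int_SG ((\<lambda>x. g x * tent (rho k) x) \<circ> mirror)"
    unfolding beta_def
  proof (rule Int_SG_cong)
    fix x assume "x \<in> SG"
    from tent_mirror[OF mirror_mem[OF this] assms(2)]
    show "(g \<circ> mirror) x * tent k x = ((\<lambda>x. g x * tent (rho k) x) \<circ> mirror) x"
      by simp
  qed
  then show ?thesis
    using Int_SG_mirror[of "\<lambda>x. g x * tent (rho k) x"]
    by (simp add: beta_def continuous_on_mult continuous_on_tent assms)
qed

lemma source_mirror:
  assumes "continuous_on SG g" "k < 3"
  shows "source (g \<circ> mirror) w k = source g (map rho w) (rho k)"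
proof -
  have "(g \<circ> mirror) \<circ> wordmap w = (g \<circ> wordmap (map rho w)) \<circ> mirror"
    by (simp add: fun_eq_iff mirror_wordmap)
  then show ?thesis
    using beta_mirror[OF continuous_on_comp_wordmap[OF assms(1) valid_map_rho] assms(2)]
    by (simp add: source_def)
qed

section \<open>Construction of the monomials\<close>

text \<open>The Poisson step keeps \<open>e\<close> and replaces \<open>s\<close> by
  \<open>s / 5\<close>. The parity leaves a single unknown among the corner values and later
  supplies the change of sign.\<close>

definition scaled_symmetric :: "real \<Rightarrow> real \<Rightarrow> (point \<Rightarrow> real) \<Rightarrow> bool" where
  "scaled_symmetric s e u \<longleftrightarrow> continuous_on SG u \<and> (\<forall>x\<in>SG. u (sgmap 0 x) = s * u x) \<and>
     (\<forall>x\<in>SG. u (mirror x) = e * u x)"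

text \<open>The corner values are determined by the scaling condition at the midpoints next to \<open>q\<^sub>0\<close>.\<close>

lemma poisson_scaled_symmetric:
  assumes g: "scaled_symmetric s e g" "\<And>x. x \<in> SG \<Longrightarrow> \<bar>g x\<bar> \<le> B"
    and se: "e = 1 \<and> \<bar>s\<bar> \<le> 1 \<or> e = -1 \<and> \<bar>s\<bar> \<le> 1/5"
  obtains u where "pointwise_laplacian u g" "scaled_symmetric (s / 5) e u" "\<And>x. x \<in> SG \<Longrightarrow> \<bar>u x\<bar> \<le> 13 * B"
proof -
  define c where "c = source g []"
  have cg: "continuous_on SG g" and sg: "\<And>x. x \<in> SG \<Longrightarrow> g (sgmap 0 x) = s * g x"
    and rg: "\<And>x. x \<in> SG \<Longrightarrow> g (mirror x) = e * g x"
    using g by (auto simp: scaled_symmetric_def)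
  have dec: "decaying B (source g)"
    using decaying_source[OF cg g(2)] .
  have cB: "\<bar>c 0\<bar> \<le> B" "\<bar>c 1\<bar> \<le> B" "\<bar>c 2\<bar> \<le> B"
    using dec unfolding decaying_def c_def by (auto dest!: spec[of _ "[]"])
  have source_rho: "source g (map rho w) (rho k) = e * source g w k" if "valid w" "k < 3" for w k
  proof -
    have "source g (map rho w) (rho k) = source (\<lambda>x. e * g x) w k"
      unfolding source_mirror[OF cg that(2), symmetric] by (rule source_cong) (auto simp: rg that)
    then show ?thesis by (simp add: source_mult[OF cg that(1)])
  qed
  have c: "c 2 = e * c 1" "c 0 = e * c 0"
    using source_rho[of "[]" 1] source_rho[of "[]" 0] by (simp_all add: c_def rho_def)
  \<comment> \<open>Ansatz 0, t, e * t at the corners. Midpoints 2 and 1 are the images of corners 1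
    and 2 under \<open>sgmap 0\<close>, so the scaling there is one linear equation for t. The bound
    5/4 is (5/2)/2 for e = 1 and 1/(4/5) for e = -1.\<close>
  obtain t where t: "mid (\<lambda>i. if i = 0 then 0 else if i = 1 then t else e * t) c 2 = s / 5 * t"
      "mid (\<lambda>i. if i = 0 then 0 else if i = 1 then t else e * t) c 1 = s / 5 * (e * t)"
      "\<bar>t\<bar> \<le> 5/4 * B"
    using se
  proof (elim disjE conjE)
    assume e: "e = 1" and s: "\<bar>s\<bar> \<le> 1"
    define t where "t = ((c 0 + c 1 + c 2) / 2 + c 1) / (s - 3)"
    have "s - 3 \<noteq> 0" using s by auto
    then have t: "(c 0 + c 1 + c 2) / 2 + c 1 = (s - 3) * t" by (simp add: t_def)
    have "2 * \<bar>t\<bar> \<le> \<bar>s - 3\<bar> * \<bar>t\<bar>"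
      using s by (intro mult_right_mono) auto
    also have "\<dots> = \<bar>(c 0 + c 1 + c 2) / 2 + c 1\<bar>"
      unfolding t by (simp add: abs_mult)
    also have "\<dots> \<le> 5/2 * B"
      using cB unfolding abs_le_iff by (simp add: field_simps)
    finally have "\<bar>t\<bar> \<le> 5/4 * B" by simp
    with that[of t] t c e show thesis
      by (simp add: mid_def field_simps)
  next
    assume e: "e = -1" and s: "\<bar>s\<bar> \<le> 1/5"
    define t where "t = c 2 / (s - 1)"
    have "s - 1 \<noteq> 0" using s by auto
    then have t: "c 2 = (s - 1) * t" by (simp add: t_def)
    have "4/5 * \<bar>t\<bar> \<le> \<bar>s - 1\<bar> * \<bar>t\<bar>"
      using s by (intro mult_right_mono) auto
    also have "\<dots> = \<bar>c 2\<bar>"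
      unfolding t by (simp add: abs_mult)
    finally have "\<bar>t\<bar> \<le> 5/4 * B" using cB(3) by simp
    with that[of t] t c e show thesis
      by (simp add: mid_def field_simps)
  qed
  define a :: "nat \<Rightarrow> real" where "a = (\<lambda>i. if i = 0 then 0 else if i = 1 then t else e * t)"
  define u where "u = Sol a (source g)"
  have u: "continuous_on SG u" "solves u (source g)" "\<And>i. i < 3 \<Longrightarrow> u (corner i) = a i"
    unfolding u_def using continuous_on_Sol[OF dec] solves_Sol[OF dec] Sol_corner[OF dec] by auto
  have "e * e = 1" using se by auto
  \<comment> \<open>Both sides have the same sources, since \<open>source g (0 # w)\<close> is s/5
    times \<open>source g w\<close>, and the same corner values by the choice of t.\<close>
  have scale: "(u \<circ> sgmap 0) x = s / 5 * u x" if x: "x \<in> SG" for x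
  proof (rule solves_unique[OF solves_shift[OF u(2)] _ _ _ _ x])
    show "solves (\<lambda>x. s / 5 * u x) (\<lambda>w. source g (0 # w))"
    proof (rule solves_cong)
      show "solves (\<lambda>x. s / 5 * u x + 0 * u x) (\<lambda>w k. s / 5 * source g w k + 0 * source g w k)"
        by (rule solves_linear[OF u(2) u(2)])
      fix w and k :: nat assume w: "valid w"
      have "source (g \<circ> sgmap 0) w k = source (\<lambda>x. s * g x) w k"
        by (rule source_cong) (auto simp: sg w)
      then show "s / 5 * source g w k + 0 * source g w k = source g (0 # w) k"
        by (simp add: source_Cons source_mult[OF cg w])
    qed simp
    fix i :: nat assume "i < 3"
    then show "(u \<circ> sgmap 0) (corner i) = s / 5 * u (corner i)"
      using solves_child[OF u(2), of 0 i] t(1,2) u(3)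
      by (auto simp: less_3_iff child_def mid_def a_def c_def)
  qed (intro u(1) continuous_on_comp_sgmap continuous_on_mult_left zero_less_numeral)+
  have symm: "(u \<circ> mirror) x = e * u x" if x: "x \<in> SG" for x
  proof (rule solves_unique[OF solves_mirror[OF u(2)] _ _ _ _ x])
    show "solves (\<lambda>x. e * u x) (\<lambda>w k. source g (map rho w) (rho k))"
    proof (rule solves_cong)
      show "solves (\<lambda>x. e * u x + 0 * u x) (\<lambda>w k. e * source g w k + 0 * source g w k)"
        by (rule solves_linear[OF u(2) u(2)])
    qed (auto simp: source_rho)
    fix i :: nat assume "i < 3"
    then show "(u \<circ> mirror) (corner i) = e * u (corner i)"
      using \<open>e * e = 1\<close> by (auto simp: mirror_corner u(3) a_def less_3_iff rho_def)
  qed (intro u(1) continuous_on_comp_mirror continuous_on_mult_left)+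
  have "B \<ge> 0" using cB(1) by simp
  \<comment> \<open>\<open>Sol_bound\<close> with corner values at most 5/4 B gives 6 * (5/4) + 5 =
    12.5.\<close>
  have "\<bar>u x\<bar> \<le> 13 * B" if "x \<in> SG" for x
  proof -
    have "\<bar>a i\<bar> \<le> 5/4 * B" if "i < 3" for i
      using t(3) \<open>B \<ge> 0\<close> se by (auto simp: a_def abs_mult)
    then have "\<bar>Sol a (source g) x\<bar> \<le> 6 * (5/4 * B) + 5 * B"
      using that by (rule Sol_bound[OF dec])
    with \<open>B \<ge> 0\<close> show ?thesis
      unfolding u_def by linarith
  qed
  with u scale symm cg show thesis
    by (intro that[of u]) (auto simp: pointwise_laplacian_def scaled_symmetric_def)
qed

text \<open>Scaling factor and symmetry type of \<open>P\<^bsub>0,k\<^esub>\<close>, and its corner values.\<close>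

definition ratio :: "nat \<Rightarrow> real" where
  "ratio k = (if k = 1 then 1 else if k = 2 then 3/5 else 1/5)"

definition parity :: "nat \<Rightarrow> real" where
  "parity k = (if k = 3 then -1 else 1)"

text \<open>Normalised so that the value, the normal derivative or the tangential derivative at q_0
  is 1; the defining sequences have this value already at m = 0.\<close>

definition corner_values :: "nat \<Rightarrow> nat \<Rightarrow> real" where
  "corner_values k i = (if k = 1 then 1 else if i = 0 then 0
     else if k = 2 then -1/2 else if i = 1 then 1/2 else -1/2)"

lemma base_monomial:
  assumes "k \<in> {1, 2, 3}"
  shows "scaled_symmetric (ratio k) (parity k) (harmonic_ext (corner_values k))"
  unfolding scaled_symmetric_def
proof (intro conjI ballI continuous_on_harm)
  fix x assume x: "x \<in> SG"
  show "harmonic_ext (corner_values k) (sgmap 0 x) = ratio k * harmonic_ext (corner_values k) x"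
    using assms unfolding harm_sgmap[OF zero_less_numeral x] harm_hbasis[OF x]
    by (auto simp: child_def mid_def corner_values_def ratio_def)
  show "harmonic_ext (corner_values k) (mirror x) = parity k * harmonic_ext (corner_values k) x"
    using assms unfolding harm_mirror[OF x] harm_hbasis[OF x]
    by (auto simp: corner_values_def parity_def rho_def)
qed

lemma pointwise_laplacian_harm: "pointwise_laplacian (harmonic_ext a) (\<lambda>x. 0)"
proof -
  have "source (\<lambda>x. 0) = (\<lambda>w k. 0)"
    by (simp add: fun_eq_iff source_def beta_def Int_SG_const)
  then show ?thesis
    by (simp add: pointwise_laplacian_def continuous_on_harm solves_harm)
qed

text \<open>Each function solves the Poisson equation with its predecessor as right-hand side; the
  harmonic function left open by that equation is selected by scaling and symmetry.\<close>

lemma monomial_sequence: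
  assumes k: "k \<in> {1, 2, 3}"
  obtains U where "U 0 = harmonic_ext (corner_values k)"
    "\<And>j. scaled_symmetric (ratio k / 5 ^ j) (parity k) (U j)"
    "\<And>j x. x \<in> SG \<Longrightarrow> \<bar>U j x\<bar> \<le> 13 ^ j"
    "\<And>j. has_laplacian (U (Suc j)) (U j)"
proof -
  let ?A = "\<lambda>j u. (j = 0 \<longrightarrow> u = harmonic_ext (corner_values k)) \<and>
    scaled_symmetric (ratio k / 5 ^ j) (parity k) u \<and> (\<forall>x\<in>SG. \<bar>u x\<bar> \<le> 13 ^ j)"
  have "\<exists>U. \<forall>j. ?A j (U j) \<and> has_laplacian (U (Suc j)) (U j)"
  proof (rule dependent_nat_choice)
    have "\<bar>corner_values k i - 0\<bar> \<le> 1" for i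
      by (simp add: corner_values_def)
    from harm_bound[OF _ this] show "\<exists>u. ?A 0 u"
      using base_monomial[OF k] by auto
  next
    fix u j assume u: "?A j u"
    have "\<bar>ratio k / 5 ^ j\<bar> \<le> \<bar>ratio k\<bar>"
      by (simp add: divide_le_eq mult_le_cancel_left1)
    moreover have "parity k = 1 \<and> \<bar>ratio k\<bar> \<le> 1 \<or> parity k = -1 \<and> \<bar>ratio k\<bar> \<le> 1/5"
      using k by (auto simp: parity_def ratio_def)
    ultimately have "parity k = 1 \<and> \<bar>ratio k / 5 ^ j\<bar> \<le> 1 \<or> parity k = -1 \<and> \<bar>ratio k / 5 ^ j\<bar> \<le> 1/5"
      by (meson order_trans)
    with u obtain v where "pointwise_laplacian v u" "scaled_symmetric (ratio k / 5 ^ j / 5) (parity k) v"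
        "\<And>x. x \<in> SG \<Longrightarrow> \<bar>v x\<bar> \<le> 13 * 13 ^ j"
      using poisson_scaled_symmetric[of "ratio k / 5 ^ j" "parity k" u "13 ^ j"] by blast
    then show "\<exists>v. ?A (Suc j) v \<and> has_laplacian v u"
      by (intro exI[of _ v]) (auto simp: has_laplacian_iff mult.commute)
  qed
  then show thesis using that by blast
qed

section \<open>Identification of the monomials by their jets\<close>

lemma scaled_symmetric_corners:
  assumes "scaled_symmetric s e u"
  shows "x \<in> SG \<Longrightarrow> u ((sgmap 0 ^^ m) x) = s ^ m * u x"
    and "u (corner 2) = e * u (corner 1)"
    and "s \<noteq> 1 \<Longrightarrow> u (corner 0) = 0"
proof -
  have s: "\<And>x. x \<in> SG \<Longrightarrow> u (sgmap 0 x) = s * u x" and r: "\<And>x. x \<in> SG \<Longrightarrow> u (mirror x) = e * u x"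
    using assms by (auto simp: scaled_symmetric_def)
  show "x \<in> SG \<Longrightarrow> u ((sgmap 0 ^^ m) x) = s ^ m * u x"
    by (induction m) (auto simp: s funpow_sgmap_mem)
  show "u (corner 2) = e * u (corner 1)"
    using r[OF corner_mem_SG[of 1]] by (simp add: mirror_corner rho_def)
  show "s \<noteq> 1 \<Longrightarrow> u (corner 0) = 0"
    using s[OF corner_mem_SG[of 0]] by simp
qed

text \<open>Along \<open>sgmap 0\<close> the sequences in the derivatives are governed by powers of
  \<open>5/3 * s\<close> and \<open>5 * s\<close>. For i > 0 they tend to 0 or vanish by symmetry;
  for i = 0 they are constant.\<close>

lemma monomial_jets:
  assumes k: "k \<in> {1, 2, 3}" and u: "scaled_symmetric (ratio k / 5 ^ i) (parity k) u"
    and base: "i = 0 \<Longrightarrow> u = harmonic_ext (corner_values k)"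
  shows "u (corner 0) = of_bool (i = 0 \<and> k = 1)"
    and "has_normal_deriv u 0 (of_bool (i = 0 \<and> k = 2))"
    and "has_tangential_deriv u 0 (of_bool (i = 0 \<and> k = 3))"
proof -
  let ?s = "ratio k / 5 ^ i"
  note scal = scaled_symmetric_corners(1)[OF u corner_mem_SG] and par = scaled_symmetric_corners(2)[OF u]
  have s_bound: "\<bar>?s\<bar> \<le> \<bar>ratio k\<bar> / 5" if "i > 0"
  proof -
    have "(5::real) ^ 1 \<le> 5 ^ i" using that by (intro power_increasing) auto
    then have "\<bar>ratio k\<bar> / 5 ^ i \<le> \<bar>ratio k\<bar> / 5"
      by (intro divide_left_mono) auto
    then show ?thesis by simp
  qed
  have ratio: "0 < ratio k" "ratio k \<le> 1" using k by (auto simp: ratio_def)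
  have s_nonneg: "0 \<le> ?s" using ratio by simp
  have zero: "u (corner 0) = 0" if "i > 0"
  proof (rule scaled_symmetric_corners(3)[OF u])
    show "?s \<noteq> 1" using s_bound[OF that] ratio by linarith
  qed
  have base_corner: "u (corner n) = corner_values k n" if "i = 0" "n < 3" for n
    using base that by (simp add: harm_corner)
  show "u (corner 0) = of_bool (i = 0 \<and> k = 1)"
    using zero base_corner[of 0] by (cases "i = 0") (auto simp: corner_values_def)
  have n: "(\<lambda>m. (5/3) ^ m * (2 * u (corner 0) - u ((sgmap 0 ^^ m) (corner 1)) - u ((sgmap 0 ^^ m) (corner 2)))) =
      (\<lambda>m. (5/3) ^ m * (2 * u (corner 0)) - (5/3 * ?s) ^ m * ((1 + parity k) * u (corner 1)))"
    unfolding scal par power_mult_distrib by (simp add: algebra_simps fun_eq_iff)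
  show "has_normal_deriv u 0 (of_bool (i = 0 \<and> k = 2))"
  proof (cases "i = 0")
    case True
    have "(\<lambda>m. (5/3) ^ m * (2 * u (corner 0)) - (5/3 * ?s) ^ m * ((1 + parity k) * u (corner 1))) =
        (\<lambda>m. of_bool (k = 2))"
      using k True by (auto simp: base_corner corner_values_def parity_def ratio_def)
    with n show ?thesis
      using True by (simp add: has_normal_deriv_def numeral_2_eq_2)
  next
    case False
    have "\<bar>5/3 * ?s\<bar> < 1"
      using s_bound False ratio s_nonneg by linarith
    then have "(\<lambda>m. (5/3 * ?s) ^ m * ((1 + parity k) * u (corner 1))) \<longlonglongrightarrow> 0 * ((1 + parity k) * u (corner 1))"
      by (intro tendsto_mult LIMSEQ_power_zero tendsto_const) simp
    then have "(\<lambda>m. (5/3) ^ m * (2 * u (corner 0)) - (5/3 * ?s) ^ m * ((1 + parity k) * u (corner 1))) \<longlonglongrightarrow> 0"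
      using zero False tendsto_minus by fastforce
    with n show ?thesis
      using False by (simp add: has_normal_deriv_def numeral_2_eq_2)
  qed
  have t: "(\<lambda>m. 5 ^ m * (u ((sgmap 0 ^^ m) (corner 1)) - u ((sgmap 0 ^^ m) (corner 2)))) =
      (\<lambda>m. (5 * ?s) ^ m * ((1 - parity k) * u (corner 1)))"
    unfolding scal par power_mult_distrib by (simp add: algebra_simps fun_eq_iff)
  show "has_tangential_deriv u 0 (of_bool (i = 0 \<and> k = 3))"
  proof (cases "k = 3")
    \<comment> \<open>Symmetry is decisive here: for k = 1 and i = 1 the base \<open>5 * ?s\<close>
      equals 1, so there is no decay.\<close>
    case False
    then show ?thesis
      using t by (simp add: has_tangential_deriv_def numeral_2_eq_2 parity_def)
  next
    case True
    show ?thesis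
    proof (cases "i = 0")
      case i: True
      then have u1: "u (corner 1) = 1/2"
        using True base_corner[of 1] by (simp add: corner_values_def)
      have "(\<lambda>m. (5 * ?s) ^ m * ((1 - parity k) * u (corner 1))) = (\<lambda>m. 1)"
        unfolding u1 using i True by (simp add: parity_def ratio_def)
      with t i True show ?thesis
        by (simp add: has_tangential_deriv_def numeral_2_eq_2)
    next
      case False
      have "\<bar>5 * ?s\<bar> < 1"
      proof -
        have "ratio k = 1/5" using True by (simp add: ratio_def)
        then show ?thesis using s_bound False s_nonneg by linarith
      qed
      then have "(\<lambda>m. (5 * ?s) ^ m * ((1 - parity k) * u (corner 1))) \<longlonglongrightarrow> 0 * ((1 - parity k) * u (corner 1))"
        by (intro tendsto_mult LIMSEQ_power_zero tendsto_const) simp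
      with t show ?thesis
        using False by (simp add: has_tangential_deriv_def numeral_2_eq_2)
    qed
  qed
qed

lemma P_properties:
  assumes k: "k \<in> {1, 2, 3}"
  shows P_scaled_symmetric: "scaled_symmetric (ratio k / 5 ^ j) (parity k) (P j k)"
    and P_bound: "x \<in> SG \<Longrightarrow> \<bar>P j k x\<bar> \<le> 13 ^ j"
    and P_0: "x \<in> SG \<Longrightarrow> P 0 k x = harmonic_ext (corner_values k) x"
    and P_laplacian: "has_laplacian (P (Suc j) k) (P j k)"
proof -
  obtain U where U: "U 0 = harmonic_ext (corner_values k)"
    "\<And>j. scaled_symmetric (ratio k / 5 ^ j) (parity k) (U j)"
    "\<And>j x. x \<in> SG \<Longrightarrow> \<bar>U j x\<bar> \<le> 13 ^ j"
    "\<And>j. has_laplacian (U (Suc j)) (U j)"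
    using monomial_sequence[OF k] by blast
  have pow: "has_laplacian_pow n (U (n + j)) (U j)" for n j
    using U(4) by (induction n) auto
  have pow0: "has_laplacian_pow (Suc j) (U j) (\<lambda>x. 0)" for j
  proof (induction j)
    case 0
    have "has_laplacian (U 0) (\<lambda>x. 0)"
      by (simp add: U(1) has_laplacian_iff pointwise_laplacian_harm)
    then show ?case by auto
  next
    case (Suc j)
    with U(4) show ?case by (metis has_laplacian_pow.simps(2))
  qed
  have "is_monomial j k (U j)" for j
    unfolding is_monomial_def
  proof (intro conjI allI impI pow0)
    \<comment> \<open>The n-th Laplacian of \<open>U j\<close> is \<open>U (j - n)\<close>, so a
      nonzero jet occurs only at n = j, from the normalised harmonic function
      \<open>U 0\<close>.\<close>
    fix n assume "n \<le> j"
    then have eq: "n = j \<longleftrightarrow> j - n = 0" by auto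
    have "has_laplacian_pow n (U j) (U (j - n))"
      using pow[of n "j - n"] \<open>n \<le> j\<close> by simp
    moreover have base: "U (j - n) = harmonic_ext (corner_values k)" if "j - n = 0"
      using that U(1) by simp
    ultimately show "\<exists>g. has_laplacian_pow n (U j) g \<and> g (corner 0) = of_bool (n = j \<and> k = 1) \<and>
        has_normal_deriv g 0 (of_bool (n = j \<and> k = 2)) \<and>
        has_tangential_deriv g 0 (of_bool (n = j \<and> k = 3))"
      unfolding eq by (intro exI[of _ "U (j - n)"] conjI monomial_jets[OF k U(2) base])
  qed
  then have PU: "P j k x = U j x" if "x \<in> SG" for j x
    using P_eqI that by blast
  show "scaled_symmetric (ratio k / 5 ^ j) (parity k) (P j k)"
    using U(2)[of j] PU continuous_on_cong[of SG SG "P j k" "U j"]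
    by (simp add: scaled_symmetric_def sgmap_mem mirror_mem)
  show "x \<in> SG \<Longrightarrow> \<bar>P j k x\<bar> \<le> 13 ^ j" "x \<in> SG \<Longrightarrow> P 0 k x = harmonic_ext (corner_values k) x"
    using PU U(1,3) by auto
  have "has_laplacian (P (Suc j) k) (U j)"
    using has_laplacian_cong[OF U(4)] PU by auto
  then show "has_laplacian (P (Suc j) k) (P j k)"
    by (rule has_laplacian_cong_right) (simp add: PU)
qed

text \<open>If \<open>P (Suc j) k\<close> vanished on \<open>SG\<close>, then so would its Laplacian
  \<open>P j k\<close>, by uniqueness.\<close>

lemma P_nonzero:
  assumes k: "k \<in> {1, 2, 3}"
  shows "\<exists>x\<in>SG. P j k x \<noteq> 0"
proof (induction j)
  case 0
  have "P 0 k (corner 1) \<noteq> 0"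
    using k by (auto simp: P_0 corner_mem_SG harm_corner corner_values_def)
  then show ?case using corner_mem_SG by blast
next
  case (Suc j)
  show ?case
  proof (rule ccontr)
    assume *: "\<not> (\<exists>x\<in>SG. P (Suc j) k x \<noteq> 0)"
    have "has_laplacian (harmonic_ext (\<lambda>i. 0)) (\<lambda>x. 0)"
      by (simp add: has_laplacian_iff pointwise_laplacian_harm)
    then have "has_laplacian (P (Suc j) k) (\<lambda>x. 0)"
      by (rule has_laplacian_cong) (use * harm_const in auto)
    then show False
      using has_laplacian_unique[OF P_laplacian[OF k]] Suc by blast
  qed
qed

section \<open>Power series near the corner\<close>

text \<open>M = 13 R joins the growth of the coefficients to that of the monomials; boundedness
  after division by \<open>R ^ j\<close> turns an eventual bound into one for all j.\<close>

lemma entire_coeffs_bound: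
  assumes "entire_coeffs c"
  obtains C M where "0 \<le> C" "0 < M"
    "\<And>j k x. k \<in> {1, 2, 3} \<Longrightarrow> x \<in> SG \<Longrightarrow> \<bar>c j k * P j k x\<bar> \<le> C * M ^ j"
proof -
  obtain R where R: "0 < R" "\<And>k. k \<in> {1, 2, 3} \<Longrightarrow> (\<lambda>j. c j k) \<in> O(\<lambda>j. R ^ j)"
    using assms unfolding entire_coeffs_def by blast
  have "\<exists>C. \<forall>j. \<bar>c j k\<bar> \<le> C * R ^ j" if k: "k \<in> {1, 2, 3}" for k :: nat
  proof -
    obtain B where "eventually (\<lambda>j. norm (c j k) \<le> B * norm (R ^ j)) sequentially"
      by (rule landau_o.bigE[OF R(2)[OF k]])
    then have "eventually (\<lambda>j. norm (c j k / R ^ j) \<le> B) sequentially"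
      using R(1) by (simp add: divide_le_eq)
    then have "Bseq (\<lambda>j. c j k / R ^ j)"
      by (rule BfunI)
    then obtain C where "\<And>j. norm (c j k / R ^ j) \<le> C"
      unfolding Bseq_def by blast
    then show ?thesis
      using R(1) by (auto simp: divide_le_eq intro!: exI[of _ C])
  qed
  then obtain C :: "nat \<Rightarrow> real" where C: "\<And>k j. k \<in> {1, 2, 3} \<Longrightarrow> \<bar>c j k\<bar> \<le> C k * R ^ j"
    by metis
  define D where "D = \<bar>C 1\<bar> + \<bar>C 2\<bar> + \<bar>C 3\<bar>"
  have D: "\<bar>c j k\<bar> \<le> D * R ^ j" if "k \<in> {1, 2, 3}" for j k :: nat
  proof -
    have "C k \<le> D" using that by (auto simp: D_def)
    then have "C k * R ^ j \<le> D * R ^ j" using R(1) by (intro mult_right_mono) auto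
    with C[OF that, of j] show ?thesis by linarith
  qed
  show thesis
  proof (rule that[of D "13 * R"])
    show "0 \<le> D" by (simp add: D_def)
    show "0 < 13 * R" using R(1) by simp
    fix j k :: nat and x assume k: "k \<in> {1, 2, 3}" and x: "x \<in> SG"
    have "\<bar>c j k\<bar> * \<bar>P j k x\<bar> \<le> (D * R ^ j) * 13 ^ j"
      using D[OF k] P_bound[OF k x] by (intro mult_mono) (auto intro: order_trans[OF abs_ge_zero])
    then show "\<bar>c j k * P j k x\<bar> \<le> D * (13 * R) ^ j"
      by (simp add: abs_mult power_mult_distrib mult_ac)
  qed
qed

text \<open>A ratio of at most 1/2 keeps the geometric tail within twice its first term.\<close>

lemma suminf_leading_term:
  fixes a :: "nat \<Rightarrow> real"
  assumes a: "\<And>j. \<bar>a j\<bar> \<le> C * q ^ j" and q: "0 \<le> q" "q \<le> 1/2" and zero: "\<And>j. j < t \<Longrightarrow> a j = 0"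
  shows "\<bar>suminf a - a t\<bar> \<le> 2 * C * q ^ Suc t"
proof -
  have C: "0 \<le> C" using a[of 0] by simp
  have geo: "summable (\<lambda>j. C * q ^ j)"
    using q by (intro summable_mult summable_geometric) auto
  have "summable a"
    by (rule summable_comparison_test[OF _ geo]) (use a in auto)
  then have "suminf a = (\<Sum>j. a (j + Suc t)) + (\<Sum>j<Suc t. a j)"
    by (rule suminf_split_initial_segment)
  also have "(\<Sum>j<Suc t. a j) = a t"
    using zero by simp
  finally have "\<bar>suminf a - a t\<bar> = \<bar>\<Sum>j. a (j + Suc t)\<bar>" by simp
  also have "\<dots> \<le> (\<Sum>j. C * q ^ Suc t * q ^ j)"
  proof -
    have "norm (a (j + Suc t)) \<le> C * q ^ Suc t * q ^ j" for j
      using a[of "j + Suc t"] by (simp add: power_add mult_ac)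
    moreover have "summable (\<lambda>j. C * q ^ Suc t * q ^ j)"
      using q by (intro summable_mult summable_geometric) auto
    ultimately show ?thesis
      using norm_suminf_le[of "\<lambda>j. a (j + Suc t)"] by simp
  qed
  also have "\<dots> = C * q ^ Suc t * (1 / (1 - q))"
    using q by (subst suminf_mult) (auto simp: suminf_geometric summable_geometric)
  also have "\<dots> \<le> C * q ^ Suc t * 2"
    using q C by (intro mult_left_mono) (auto simp: divide_le_eq)
  finally show ?thesis by (simp add: mult_ac)
qed

text \<open>Grouped so that on \<open>F_0^m(SG)\<close> each component becomes a power series in
  \<open>1 / 5 ^ m\<close>, with \<open>ratio k ^ m\<close> in front.\<close>

lemma P_funpow:
  assumes "k \<in> {1, 2, 3}" "x \<in> SG"
  shows "P j k ((sgmap 0 ^^ m) x) = ratio k ^ m * ((1 / 5 ^ m) ^ j * P j k x)"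
  using scaled_symmetric_corners(1)[OF P_scaled_symmetric[OF assms(1)] assms(2), of j m]
  by (simp add: power_divide mult.commute flip: power_mult)

definition component :: "(nat \<Rightarrow> nat \<Rightarrow> real) \<Rightarrow> nat \<Rightarrow> point \<Rightarrow> real" where
  "component c k x = (\<Sum>j. c j k * P j k x)"

lemma ratio_bounds: "0 < ratio k" "ratio k \<le> 1"
  by (auto simp: ratio_def)

context
  fixes c :: "nat \<Rightarrow> nat \<Rightarrow> real" and C M :: real
  assumes M: "0 < M"
    and bound: "\<And>j k x. k \<in> {1, 2, 3} \<Longrightarrow> x \<in> SG \<Longrightarrow> \<bar>c j k * P j k x\<bar> \<le> C * M ^ j"
begin

lemma scaled_term_bound:
  assumes "k \<in> {1, 2, 3}" "x \<in> SG"
  shows "\<bar>(1 / 5 ^ m) ^ j * (c j k * P j k x)\<bar> \<le> C * (M / 5 ^ m) ^ j"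
proof -
  have "\<bar>(1 / 5 ^ m) ^ j * (c j k * P j k x)\<bar> = (1 / 5 ^ m) ^ j * \<bar>c j k * P j k x\<bar>"
    by (simp add: abs_mult)
  also have "\<dots> \<le> (1 / 5 ^ m) ^ j * (C * M ^ j)"
    by (intro mult_left_mono bound assms) auto
  finally show ?thesis by (simp add: power_divide)
qed

lemma component_funpow:
  assumes k: "k \<in> {1, 2, 3}" and x: "x \<in> SG" and m: "M / 5 ^ m \<le> 1/2"
  shows "component c k ((sgmap 0 ^^ m) x) = ratio k ^ m * (\<Sum>j. (1 / 5 ^ m) ^ j * (c j k * P j k x))"
proof -
  have "summable (\<lambda>j. C * (M / 5 ^ m) ^ j)"
    using m M by (intro summable_mult summable_geometric) auto
  then have "summable (\<lambda>j. (1 / 5 ^ m) ^ j * (c j k * P j k x))"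
    by (rule summable_comparison_test[rotated]) (use scaled_term_bound[OF k x] in auto)
  from suminf_mult[OF this, of "ratio k ^ m"] show ?thesis
    by (simp add: component_def P_funpow[OF k x] mult_ac)
qed

text \<open>The tail starts with the power t + 1 of \<open>1 / 5 ^ m\<close>, which yields the
  factor \<open>(1/5) ^ m\<close> beside the leading scale, uniformly in x.\<close>

lemma component_asymptotics:
  assumes k: "k \<in> {1, 2, 3}" and x: "x \<in> SG" and m: "M / 5 ^ m \<le> 1/2" and t: "\<And>j. j < t \<Longrightarrow> c j k = 0"
  shows "\<bar>component c k ((sgmap 0 ^^ m) x) - (ratio k / 5 ^ t) ^ m * (c t k * P t k x)\<bar>
    \<le> (ratio k / 5 ^ t) ^ m * (2 * C * M ^ Suc t * (1/5) ^ m)"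
proof -
  let ?a = "\<lambda>j. (1 / 5 ^ m) ^ j * (c j k * P j k x)"
  have "\<bar>suminf ?a - ?a t\<bar> \<le> 2 * C * (M / 5 ^ m) ^ Suc t"
    by (rule suminf_leading_term[OF scaled_term_bound[OF k x] _ m]) (use t M in auto)
  then have "ratio k ^ m * \<bar>suminf ?a - ?a t\<bar> \<le> ratio k ^ m * (2 * C * (M / 5 ^ m) ^ Suc t)"
    using ratio_bounds[of k] by (intro mult_left_mono) auto
  moreover have "ratio k ^ m * \<bar>suminf ?a - ?a t\<bar> =
      \<bar>component c k ((sgmap 0 ^^ m) x) - ratio k ^ m * ?a t\<bar>"
    unfolding component_funpow[OF k x m] right_diff_distrib[symmetric] abs_mult
    using ratio_bounds[of k] by simp
  moreover have "(ratio k / 5 ^ t) ^ m = ratio k ^ m * (1 / 5 ^ m) ^ t"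
    by (simp add: power_divide mult.commute flip: power_mult)
  moreover have "(M / 5 ^ m) ^ Suc t = (1 / 5 ^ m) ^ t * M ^ Suc t * (1/5) ^ m"
    by (simp add: power_divide)
  ultimately show ?thesis by (simp only: mult_ac)
qed

text \<open>Weierstrass test on a small cell, where scaling makes the majorant a convergent
  geometric series.\<close>

lemma continuous_on_component:
  assumes k: "k \<in> {1, 2, 3}" and m: "M / 5 ^ m \<le> 1/2"
  shows "continuous_on SG (\<lambda>x. component c k ((sgmap 0 ^^ m) x))"
proof -
  let ?a = "\<lambda>j x. (1 / 5 ^ m) ^ j * (c j k * P j k x)"
  have "summable (\<lambda>j. C * (M / 5 ^ m) ^ j)"
    using m M by (intro summable_mult summable_geometric) auto
  then have "uniform_limit SG (\<lambda>n x. \<Sum>j<n. ?a j x) (\<lambda>x. \<Sum>j. ?a j x) sequentially"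
    using scaled_term_bound[OF k] by (intro Weierstrass_m_test[of SG ?a "\<lambda>j. C * (M / 5 ^ m) ^ j"]) auto
  moreover have "continuous_on SG (\<lambda>x. \<Sum>j<n. ?a j x)" for n
    using P_scaled_symmetric[OF k] by (intro continuous_intros) (auto simp: scaled_symmetric_def)
  ultimately have "continuous_on SG (\<lambda>x. \<Sum>j. ?a j x)"
    by (intro uniform_limit_theorem[of _ "\<lambda>n x. \<Sum>j<n. ?a j x"]) auto
  then have "continuous_on SG (\<lambda>x. ratio k ^ m * (\<Sum>j. ?a j x))"
    by (rule continuous_on_mult_left)
  then show ?thesis
    by (rule continuous_on_eq) (simp add: component_funpow[OF k _ m])
qed

end

text \<open>Divided by the scale of the leading monomial, \<open>f\<close> on the m-th cell at q_0
  converges uniformly to a multiple of that monomial. The margin 3/5 between scales is the rate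
  contributed by the other components.\<close>

lemma dominant_term:
  assumes f: "entire_analytic c f"
    and t: "\<And>j k. k \<in> {1, 2, 3} \<Longrightarrow> j < t k \<Longrightarrow> c j k = 0"
    and d: "d \<in> {1, 2, 3}"
    and dom: "\<And>k. k \<in> {1, 2, 3} \<Longrightarrow> k \<noteq> d \<Longrightarrow> ratio k / 5 ^ t k \<le> 3/5 * (ratio d / 5 ^ t d)"
  obtains E N where
    "\<And>m. m \<ge> N \<Longrightarrow> continuous_on SG (\<lambda>x. f ((sgmap 0 ^^ m) x))"
    "\<And>m x. m \<ge> N \<Longrightarrow> x \<in> SG \<Longrightarrow> \<bar>f ((sgmap 0 ^^ m) x) / (ratio d / 5 ^ t d) ^ m - c (t d) d * P (t d) d x\<bar> \<le> E * (3/5) ^ m"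
proof -
  obtain C M where CM: "0 \<le> C" "0 < M"
    "\<And>j k x. k \<in> {1, 2, 3} \<Longrightarrow> x \<in> SG \<Longrightarrow> \<bar>c j k * P j k x\<bar> \<le> C * M ^ j"
    using entire_coeffs_bound f unfolding entire_analytic_def by blast
  have f_eq: "f x = component c 1 x + component c 2 x + component c 3 x" if "x \<in> SG" for x
    using f that by (simp add: entire_analytic_def component_def)
  obtain N where N: "(1/5::real) ^ N < 1 / (2 * M)"
    using real_arch_pow_inv[of "1 / (2 * M)" "1/5"] CM(2) by auto
  have small: "M / 5 ^ m \<le> 1/2" if "m \<ge> N" for m
  proof -
    have "(1/5::real) ^ m \<le> (1/5) ^ N" using that by (intro power_decreasing) auto
    with N have "(1/5) ^ m \<le> 1 / (2 * M)" by linarith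
    then have "(1/5) ^ m * M \<le> 1 / (2 * M) * M" using CM(2) by (intro mult_right_mono) auto
    then show ?thesis using CM(2) by (simp add: power_divide)
  qed
  let ?s = "\<lambda>k. ratio k / 5 ^ t k"
  have s_pos: "0 < ?s k" for k using ratio_bounds[of k] by simp
  define A where "A = (\<lambda>k. 2 * C * M ^ Suc (t k))"
  define B where "B = (\<lambda>k. C * M ^ t k + A k)"
  have A: "0 \<le> A k" and B: "0 \<le> B k" for k
    using CM by (auto simp: A_def B_def)
  define E where "E = A d + (\<Sum>k\<in>{1, 2, 3}. B k)"
  show thesis
  proof (rule that[of N E])
    fix m assume m: "m \<ge> N"
    have "continuous_on SG (\<lambda>x. component c 1 ((sgmap 0 ^^ m) x) + component c 2 ((sgmap 0 ^^ m) x)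
        + component c 3 ((sgmap 0 ^^ m) x))"
      by (intro continuous_intros continuous_on_component[OF CM(2,3) _ small[OF m]]) auto
    then show "continuous_on SG (\<lambda>x. f ((sgmap 0 ^^ m) x))"
      by (rule continuous_on_eq) (simp add: f_eq funpow_sgmap_mem)
    fix x assume x: "x \<in> SG"
    let ?x = "(sgmap 0 ^^ m) x"
    have asym: "\<bar>component c k ?x - ?s k ^ m * (c (t k) k * P (t k) k x)\<bar> \<le> ?s k ^ m * (A k * (1/5) ^ m)"
      if "k \<in> {1, 2, 3}" for k
      unfolding A_def by (rule component_asymptotics[OF CM(2,3) that x small[OF m] t[OF that]])
    \<comment> \<open>The better rate 1/5 is weakened to 3/5 to match the other components.\<close>
    have lead: "\<bar>component c d ?x - ?s d ^ m * (c (t d) d * P (t d) d x)\<bar> \<le> ?s d ^ m * (A d * (3/5) ^ m)"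
    proof (rule order_trans[OF asym[OF d]], intro mult_left_mono A)
      show "(1/5::real) ^ m \<le> (3/5) ^ m" by (intro power_mono) auto
    qed (use s_pos[of d] in auto)
    have other: "\<bar>component c k ?x\<bar> \<le> ?s d ^ m * (B k * (3/5) ^ m)" if k: "k \<in> {1, 2, 3}" "k \<noteq> d" for k
    proof -
      have "\<bar>?s k ^ m * (c (t k) k * P (t k) k x)\<bar> \<le> ?s k ^ m * (C * M ^ t k)"
        unfolding abs_mult[of "?s k ^ m"] using s_pos[of k] CM(3)[OF k(1) x, of "t k"]
        by (intro mult_mono) auto
      moreover have "?s k ^ m * (A k * (1/5) ^ m) \<le> ?s k ^ m * (A k * 1)"
        using s_pos[of k] A[of k] by (intro mult_left_mono power_le_one) auto
      ultimately have "\<bar>component c k ?x\<bar> \<le> ?s k ^ m * (C * M ^ t k) + ?s k ^ m * (A k * 1)"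
        using asym[OF k(1)] by linarith
      also have "\<dots> = ?s k ^ m * B k"
        by (simp add: B_def distrib_left)
      also have "\<dots> \<le> (3/5 * ?s d) ^ m * B k"
        using dom[OF k] s_pos[of k] B[of k] by (intro mult_right_mono power_mono) auto
      also have "\<dots> = ?s d ^ m * (B k * (3/5) ^ m)"
        unfolding power_mult_distrib by (simp only: mult_ac)
      finally show ?thesis .
    qed
    have "\<bar>f ?x - ?s d ^ m * (c (t d) d * P (t d) d x)\<bar> \<le> ?s d ^ m * (E * (3/5) ^ m)"
    proof -
      let ?L = "?s d ^ m * (c (t d) d * P (t d) d x)" and ?K = "{1, 2, 3} :: nat set"
      have "f ?x = (\<Sum>k\<in>?K. component c k ?x)"
        using f_eq[OF funpow_sgmap_mem[OF x]] by simp
      also have "\<dots> = component c d ?x + (\<Sum>k\<in>?K - {d}. component c k ?x)"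
        by (rule sum.remove[OF _ d]) simp
      finally have "\<bar>f ?x - ?L\<bar> \<le> \<bar>component c d ?x - ?L\<bar> + \<bar>\<Sum>k\<in>?K - {d}. component c k ?x\<bar>"
        by linarith
      also have "\<bar>\<Sum>k\<in>?K - {d}. component c k ?x\<bar> \<le> (\<Sum>k\<in>?K - {d}. ?s d ^ m * (B k * (3/5) ^ m))"
        by (intro order_trans[OF sum_abs] sum_mono other) auto
      also have "\<dots> \<le> (\<Sum>k\<in>?K. ?s d ^ m * (B k * (3/5) ^ m))"
        using s_pos[of d] B by (intro sum_mono2) auto
      also have "\<dots> = ?s d ^ m * ((\<Sum>k\<in>?K. B k) * (3/5) ^ m)"
        unfolding sum_distrib_left sum_distrib_right ..
      finally have "\<bar>f ?x - ?L\<bar> \<le> ?s d ^ m * (A d * (3/5) ^ m) + ?s d ^ m * ((\<Sum>k\<in>?K. B k) * (3/5) ^ m)"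
        using lead by linarith
      then show ?thesis unfolding E_def distrib_right distrib_left .
    qed
    then have "\<bar>f ?x - ?s d ^ m * (c (t d) d * P (t d) d x)\<bar> / ?s d ^ m \<le> E * (3/5) ^ m"
      using s_pos[of d] by (simp add: pos_divide_le_eq mult.commute)
    moreover have "\<bar>f ?x - ?s d ^ m * (c (t d) d * P (t d) d x)\<bar> / ?s d ^ m =
        \<bar>(f ?x - ?s d ^ m * (c (t d) d * P (t d) d x)) / ?s d ^ m\<bar>"
      using s_pos[of d] by simp
    moreover have "(f ?x - ?s d ^ m * (c (t d) d * P (t d) d x)) / ?s d ^ m =
        f ?x / ?s d ^ m - c (t d) d * P (t d) d x"
    proof -
      have nz: "?s d ^ m \<noteq> 0" using zero_less_power[OF s_pos[of d], of m] by linarith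
      show ?thesis
        unfolding diff_divide_distrib nonzero_mult_div_cancel_left[OF nz] ..
    qed
    ultimately show "\<bar>f ?x / ?s d ^ m - c (t d) d * P (t d) d x\<bar> \<le> E * (3/5) ^ m"
      by metis
  qed
qed

section \<open>The cells away from the corner\<close>

text \<open>The images under iterates of \<open>sgmap 0\<close> fill \<open>SG\<close> except q_0,
  so uniform control on this compact set gives control on a punctured neighbourhood of q_0.\<close>

definition far :: "point set" where
  "far = sgmap 1 ` SG \<union> sgmap 2 ` SG"

lemma far_subset_SG: "far \<subseteq> SG"
  by (auto simp: far_def sgmap_mem)

lemma compact_far: "compact far"
  unfolding far_def by (intro compact_Un compact_continuous_image continuous_on_sgmap SG_properties)

lemma bary_far: "x \<in> far \<Longrightarrow> bary 0 x \<le> 1/2"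
  by (auto simp: far_def bary_sgmap bary_le_1)

lemma mirror_far: "x \<in> far \<Longrightarrow> mirror x \<in> far"
  unfolding far_def by (auto simp: mirror_sgmap rho_def mirror_mem)

lemma bary_funpow: "1 - bary 0 ((sgmap 0 ^^ n) x) = (1/2) ^ n * (1 - bary 0 x)"
  by (induction n) (auto simp: bary_sgmap field_simps)

text \<open>\<open>1 - bary 0\<close> doubles whenever one \<open>sgmap 0\<close> is stripped off,
  so this can happen only finitely often before the point leaves cell 0.\<close>

lemma far_cover:
  assumes "x \<in> SG" "x \<noteq> corner 0"
  obtains n y where "y \<in> far" "x = (sgmap 0 ^^ n) y"
proof -
  have "bary 0 x < 1"
    using bary_le_1[OF assms(1), of 0] bary_eq_1[OF assms(1), of 0] assms(2) by fastforce
  then obtain N where "(1/2) ^ N < 1 - bary 0 x"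
    using real_arch_pow_inv[of "1 - bary 0 x" "1/2"] by auto
  with assms(1) have "\<exists>n. \<exists>y\<in>far. x = (sgmap 0 ^^ n) y"
  proof (induction N arbitrary: x)
    case 0
    then show ?case using bary_nonneg[of x 0] by simp
  next
    case (Suc N)
    obtain i y where iy: "i < 3" "y \<in> SG" "x = sgmap i y"
      using SG_cases[OF Suc.prems(1)] .
    show ?case
    proof (cases "i = 0")
      case True
      then have "(1/2) ^ N < 1 - bary 0 y"
        using Suc.prems(2) iy by (simp add: bary_sgmap field_simps)
      from Suc.IH[OF iy(2) this] obtain n z where "z \<in> far" "y = (sgmap 0 ^^ n) z" by blast
      with True iy(3) have "x = (sgmap 0 ^^ Suc n) z" by simp
      with \<open>z \<in> far\<close> show ?thesis by blast
    next
      case False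
      then have "x \<in> far" using iy by (auto simp: far_def less_3_iff)
      then show ?thesis by (intro exI[of _ 0] bexI[of _ x]) auto
    qed
  qed
  with that show thesis by blast
qed

text \<open>An intermediate value theorem on \<open>SG\<close>: the minimum of the absolute value
  exceeds the oscillation on small cells, so the sign is constant on each, and neighbouring cells
  share a point.\<close>

lemma sign_constant:
  fixes u :: "point \<Rightarrow> real"
  assumes u: "continuous_on SG u" "\<And>x. x \<in> SG \<Longrightarrow> u x \<noteq> 0" and xy: "x \<in> SG" "y \<in> SG"
  shows "u x > 0 \<longleftrightarrow> u y > 0"
proof -
  obtain z where z: "z \<in> SG" "\<And>y. y \<in> SG \<Longrightarrow> \<bar>u z\<bar> \<le> \<bar>u y\<bar>"
    using continuous_attains_inf[OF SG_properties(2,1), of "\<lambda>x. \<bar>u x\<bar>"] continuous_on_rabs[OF u(1)] by blast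
  then have "\<bar>u z\<bar> > 0" using u(2) by simp
  then obtain N where N: "\<And>m w x y. m \<ge> N \<Longrightarrow> w \<in> words m \<Longrightarrow> x \<in> SG \<Longrightarrow> y \<in> SG \<Longrightarrow>
      \<bar>u (wordmap w x) - u (wordmap w y)\<bar> < \<bar>u z\<bar>"
    using cells_small_oscillation[OF u(1)] by blast
  show ?thesis
  proof (rule locally_constant_on_cells[where q = "\<lambda>x. u x > 0" and n = N, OF _ xy])
    fix w x y assume w: "w \<in> words N" and xy: "x \<in> SG" "y \<in> SG"
    have "\<bar>u z\<bar> \<le> \<bar>u (wordmap w x)\<bar>" "\<bar>u z\<bar> \<le> \<bar>u (wordmap w y)\<bar>"
      using words_valid[OF w] xy by (auto intro!: z(2) wordmap_mem)
    with N[OF order.refl w xy] show "u (wordmap w x) > 0 \<longleftrightarrow> u (wordmap w y) > 0"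
      by linarith
  qed
qed

text \<open>Without a zero the sign would be constant on either cell, and the two signs agree at the
  common point \<open>sgmap 1 (corner 2)\<close>.\<close>

lemma far_zero:
  fixes u :: "point \<Rightarrow> real"
  assumes u: "continuous_on SG u" and xy: "x \<in> far" "y \<in> far" "u x > 0" "u y < 0"
  obtains z where "z \<in> far" "u z = 0"
proof (rule ccontr)
  assume "\<not> thesis"
  with that have nonzero: "u z \<noteq> 0" if "z \<in> far" for z using that by blast
  have const: "u (sgmap i a) > 0 \<longleftrightarrow> u (sgmap i b) > 0" if "i = 1 \<or> i = 2" "a \<in> SG" "b \<in> SG" for i a b
  proof -
    have "(u \<circ> sgmap i) z \<noteq> 0" if "z \<in> SG" for z
      using \<open>i = 1 \<or> i = 2\<close> that nonzero[of "sgmap i z"] by (auto simp: far_def)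
    moreover have "i < 3" using that(1) by auto
    ultimately have "(u \<circ> sgmap i) a > 0 \<longleftrightarrow> (u \<circ> sgmap i) b > 0"
      by (intro sign_constant continuous_on_comp_sgmap u that)
    then show ?thesis by simp
  qed
  have "u z > 0 \<longleftrightarrow> u (sgmap 1 (corner 2)) > 0" if "z \<in> far" for z
  proof -
    obtain a where a: "a \<in> SG" "z = sgmap 1 a \<or> z = sgmap 2 a"
      using \<open>z \<in> far\<close> unfolding far_def by blast
    have "sgmap 2 (corner 1) = sgmap 1 (corner 2)" by (rule sgmap_corner_commute)
    with const[OF _ a(1) corner_mem_SG[of 2], of 1] const[OF _ a(1) corner_mem_SG[of 1], of 2]
    have "u (sgmap 1 a) > 0 \<longleftrightarrow> u (sgmap 1 (corner 2)) > 0" "u (sgmap 2 a) > 0 \<longleftrightarrow> u (sgmap 1 (corner 2)) > 0"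
      by simp_all
    with a(2) show ?thesis by fast
  qed
  from this[OF xy(1)] this[OF xy(2)] xy(3,4) show False by simp
qed

lemma dist_funpow_corner: "dist ((sgmap 0 ^^ m) z) (corner 0) = (1/2) ^ m * dist z (corner 0)"
proof (induction m)
  case (Suc m)
  then show ?case
    using dist_sgmap[of 0 "(sgmap 0 ^^ m) z" "corner 0"] by simp
qed simp

lemma power_small:
  fixes E e :: real
  assumes "e > 0"
  obtains N where "\<And>m. m \<ge> N \<Longrightarrow> E * (3/5) ^ m < e"
proof -
  have "(\<lambda>m. E * (3/5) ^ m) \<longlonglongrightarrow> E * 0"
    by (intro tendsto_intros LIMSEQ_power_zero) simp
  from order_tendstoD(2)[OF this, of e] assms obtain N where "\<forall>m\<ge>N. E * (3/5) ^ m < e"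
    by (auto simp: eventually_sequentially)
  with that show thesis by blast
qed

text \<open>An antisymmetric dominant term changes sign under reflection, and the two cells away from the
  corner form a connected reflection-invariant set.\<close>

lemma zeros_accumulate:
  assumes f: "entire_analytic c f"
    and t: "\<And>j k. k \<in> {1, 2, 3} \<Longrightarrow> j < t k \<Longrightarrow> c j k = 0" "c (t 3) 3 \<noteq> 0"
    and dom: "\<And>k. k \<in> {1, 2, 3} \<Longrightarrow> k \<noteq> 3 \<Longrightarrow> ratio k / 5 ^ t k \<le> 3/5 * (ratio 3 / 5 ^ t 3)"
  shows "corner 0 islimpt {x\<in>SG. f x = 0}"
proof -
  let ?p = "P (t 3) 3" and ?s = "ratio 3 / 5 ^ t 3" and ?c = "c (t 3) 3"
  obtain E N where E: "\<And>m. m \<ge> N \<Longrightarrow> continuous_on SG (\<lambda>x. f ((sgmap 0 ^^ m) x))"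
    "\<And>m x. m \<ge> N \<Longrightarrow> x \<in> SG \<Longrightarrow> \<bar>f ((sgmap 0 ^^ m) x) / ?s ^ m - ?c * ?p x\<bar> \<le> E * (3/5) ^ m"
    by (rule dominant_term[OF f t(1) _ dom]) auto
  have sym: "scaled_symmetric ?s (-1) ?p"
    using P_scaled_symmetric[of 3 "t 3"] by (simp add: parity_def)
  \<comment> \<open>A positive scale permits division; a scale different from 1 forces
    \<open>?p\<close> to vanish at q_0, so a nonzero value can be pulled back to
    \<open>far\<close>.\<close>
  have s: "0 < ?s" "?s \<noteq> 1"
  proof -
    have "(1::real) \<le> 5 ^ t 3" by simp
    moreover have "ratio 3 < 1" by (simp add: ratio_def)
    ultimately have "ratio 3 < 5 ^ t 3" by linarith
    then show "?s \<noteq> 1" by simp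
  qed (simp add: ratio_bounds)
  have "\<exists>x\<in>SG. ?p x \<noteq> 0"
    by (rule P_nonzero) simp
  then obtain x where x: "x \<in> SG" "?p x \<noteq> 0"
    by blast
  have "x \<noteq> corner 0"
    using x scaled_symmetric_corners(3)[OF sym s(2)] by auto
  then obtain n y where y: "y \<in> far" "x = (sgmap 0 ^^ n) y"
    using far_cover[OF x(1)] by blast
  have ySG: "y \<in> SG" using y far_subset_SG by auto
  have py: "?p y \<noteq> 0"
    using x(2) scaled_symmetric_corners(1)[OF sym ySG, of n] y(2) by auto
  have pm: "?p (mirror y) = - ?p y"
    using sym ySG by (simp add: scaled_symmetric_def)
  have zero: "\<exists>N'. \<forall>m\<ge>N'. \<exists>z\<in>far. f ((sgmap 0 ^^ m) z) = 0"
  proof -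
    obtain N' where N': "\<And>m. m \<ge> N' \<Longrightarrow> E * (3/5) ^ m < \<bar>?c * ?p y\<bar>"
      using power_small[of "\<bar>?c * ?p y\<bar>" E] py t(2) by auto
    have "\<exists>z\<in>far. f ((sgmap 0 ^^ m) z) = 0" if m: "m \<ge> max N N'" for m
    proof -
      let ?g = "\<lambda>x. f ((sgmap 0 ^^ m) x) / ?s ^ m"
      have cont: "continuous_on SG ?g"
        using E(1)[of m] m s(1) by (intro continuous_on_divide continuous_on_const) auto
      \<comment> \<open>The rescaled f is closer to \<open>?c * ?p y\<close> at y, and to its
        negative at the mirror point, than the size of this number; hence opposite signs.\<close>
      have g: "\<bar>?g y - ?c * ?p y\<bar> < \<bar>?c * ?p y\<bar>" "\<bar>?g (mirror y) + ?c * ?p y\<bar> < \<bar>?c * ?p y\<bar>"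
        using E(2)[of m y] E(2)[of m "mirror y"] N'[of m] m ySG mirror_mem[OF ySG] pm by auto
      have "\<exists>z\<in>far. ?g z = 0"
      proof (cases "?c * ?p y > 0")
        case True
        with g have "?g y > 0" "?g (mirror y) < 0" by linarith+
        from far_zero[OF cont y(1) mirror_far[OF y(1)] this] show ?thesis by blast
      next
        case False
        with g have "?g (mirror y) > 0" "?g y < 0" by linarith+
        from far_zero[OF cont mirror_far[OF y(1)] y(1) this] show ?thesis by blast
      qed
      then show ?thesis using s(1) by auto
    qed
    then show ?thesis by blast
  qed
  then obtain N' where N': "\<And>m. m \<ge> N' \<Longrightarrow> \<exists>z\<in>far. f ((sgmap 0 ^^ m) z) = 0" by blast
  obtain D where D: "\<And>z. z \<in> SG \<Longrightarrow> dist (corner 0) z \<le> D"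
    using compact_imp_bounded[OF SG_properties(2)] unfolding bounded_any_center[of SG "corner 0"] by blast
  show ?thesis
    unfolding islimpt_approachable
  proof (intro allI impI)
    fix e :: real assume "e > 0"
    then obtain N'' where N'': "(1/2::real) ^ N'' < e / max D 1"
      using real_arch_pow_inv[of "e / max D 1" "1/2"] by auto
    define m where "m = max N' N''"
    obtain z where z: "z \<in> far" "f ((sgmap 0 ^^ m) z) = 0"
      using N'[of m] by (auto simp: m_def)
    have zSG: "z \<in> SG" using z far_subset_SG by blast
    \<comment> \<open>A limit point needs zeros other than q_0 itself.\<close>
    have "1 - bary 0 ((sgmap 0 ^^ m) z) > 0"
      using bary_far[OF z(1)] unfolding bary_funpow by simp
    then have "(sgmap 0 ^^ m) z \<noteq> corner 0"
      using bary_corner[of 0 0] by auto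
    moreover have "dist ((sgmap 0 ^^ m) z) (corner 0) < e"
    proof -
      have "dist ((sgmap 0 ^^ m) z) (corner 0) \<le> (1/2) ^ m * max D 1"
        unfolding dist_funpow_corner using D[OF zSG]
        by (intro mult_left_mono) (auto simp: dist_commute)
      also have "\<dots> \<le> (1/2) ^ N'' * max D 1"
        by (intro mult_right_mono power_decreasing) (auto simp: m_def)
      also have "\<dots> < e" using N'' by (simp add: pos_less_divide_eq)
      finally show ?thesis .
    qed
    ultimately show "\<exists>x'\<in>{x \<in> SG. f x = 0}. x' \<noteq> corner 0 \<and> dist x' (corner 0) < e"
      using z(2) funpow_sgmap_mem[OF zSG, of m] by blast
  qed
qed

text \<open>On the compact set \<open>far\<close> the leading monomial has a positive minimum, which
  beats the error for large m.\<close>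

lemma zero_isolated:
  assumes f: "entire_analytic c f"
    and t: "\<And>j k. k \<in> {1, 2, 3} \<Longrightarrow> j < t k \<Longrightarrow> c j k = 0" "c (t 1) 1 \<noteq> 0"
    and dom: "\<And>k. k \<in> {1, 2, 3} \<Longrightarrow> k \<noteq> 1 \<Longrightarrow> ratio k / 5 ^ t k \<le> 3/5 * (ratio 1 / 5 ^ t 1)"
    and pos: "\<And>x. x \<in> far \<Longrightarrow> P (t 1) 1 x > 0"
  shows "\<exists>U. openin (top_of_set SG) U \<and> corner 0 \<in> U \<and> {x\<in>SG. f x = 0} \<inter> U \<subseteq> {corner 0}"
proof -
  let ?p = "P (t 1) 1" and ?s = "ratio 1 / 5 ^ t 1" and ?c = "c (t 1) 1"
  obtain E N where "\<And>m. m \<ge> N \<Longrightarrow> continuous_on SG (\<lambda>x. f ((sgmap 0 ^^ m) x))"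
    and E: "\<And>m x. m \<ge> N \<Longrightarrow> x \<in> SG \<Longrightarrow> \<bar>f ((sgmap 0 ^^ m) x) / ?s ^ m - ?c * ?p x\<bar> \<le> E * (3/5) ^ m"
    by (rule dominant_term[OF f t(1) _ dom]) auto
  have "continuous_on far ?p"
    using P_scaled_symmetric[of 1 "t 1"] continuous_on_subset[OF _ far_subset_SG]
    by (auto simp: scaled_symmetric_def)
  moreover have "far \<noteq> {}" using corner_mem_SG by (auto simp: far_def)
  ultimately obtain y where y: "y \<in> far" "\<And>x. x \<in> far \<Longrightarrow> ?p y \<le> ?p x"
    using continuous_attains_inf[OF compact_far] by blast
  obtain N' where N': "\<And>m. m \<ge> N' \<Longrightarrow> E * (3/5) ^ m < \<bar>?c\<bar> * ?p y"
    using power_small[of "\<bar>?c\<bar> * ?p y" E] pos[OF y(1)] t(2) by auto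
  have nonzero: "f ((sgmap 0 ^^ m) x) \<noteq> 0" if "m \<ge> max N N'" "x \<in> far" for m x
  proof
    assume "f ((sgmap 0 ^^ m) x) = 0"
    with E[of m x] that far_subset_SG have "\<bar>?c * ?p x\<bar> \<le> E * (3/5) ^ m" by auto
    also have "\<dots> < \<bar>?c\<bar> * ?p y" using N' that by simp
    also have "\<dots> \<le> \<bar>?c\<bar> * ?p x" using y(2)[OF that(2)] by (intro mult_left_mono) auto
    finally show False using pos[OF that(2)] by (simp add: abs_mult)
  qed
  \<comment> \<open>The threshold forces at least \<open>max N N'\<close> iterates of
    \<open>sgmap 0\<close> from \<open>far\<close>; the bound 1/2 on coordinate 0 there accounts for
    the one in \<open>Suc n\<close> below.\<close>
  let ?U = "SG \<inter> {x. 1 - (1/2) ^ max N N' < bary 0 x}"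
  have "openin (top_of_set SG) ?U"
    by (intro openin_open_Int open_Collect_less continuous_on_bary continuous_on_const)
  moreover have "corner 0 \<in> ?U"
    using bary_corner[of 0 0] by (simp add: corner_mem_SG)
  moreover have "x = corner 0" if x: "x \<in> SG" "f x = 0" "1 - (1/2) ^ max N N' < bary 0 x" for x
  proof (rule ccontr)
    assume "x \<noteq> corner 0"
    then obtain n z where z: "z \<in> far" "x = (sgmap 0 ^^ n) z"
      using far_cover[OF x(1)] by blast
    have "(1/2) ^ Suc n = (1/2::real) ^ n * (1/2)" by simp
    also have "\<dots> \<le> (1/2) ^ n * (1 - bary 0 z)"
      using bary_far[OF z(1)] by (intro mult_left_mono) auto
    also have "\<dots> < (1/2) ^ max N N'"
      using x(3) bary_funpow[of n z] z(2) by simp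
    finally have "max N N' < Suc n"
      by (subst (asm) power_strict_decreasing_iff) auto
    with nonzero[of n z] z x(2) show False by simp
  qed
  ultimately show ?thesis by (intro exI[of _ ?U]) auto
qed

section \<open>Comparison of the scaling factors in both cases\<close>

theorem theorem2p1:
  fixes f :: "point \<Rightarrow> real" and c :: "nat \<Rightarrow> nat \<Rightarrow> real"
    and t\<^sub>1 t\<^sub>2 t\<^sub>3 :: nat and Z :: "point set"
  assumes f: "entire_analytic c f"
    and start1: "\<forall>j<t\<^sub>1. c j 1 = 0" "c t\<^sub>1 1 \<noteq> 0"
    and start2: "\<forall>j<t\<^sub>2. c j 2 = 0" "c t\<^sub>2 2 \<noteq> 0"
    and start3: "\<forall>j<t\<^sub>3. c j 3 = 0" "c t\<^sub>3 3 \<noteq> 0"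
    and Z: "Z = {x\<in>SG. f x = 0}"
  shows "(int t\<^sub>3 < int t\<^sub>1 - 1 \<and> t\<^sub>3 < t\<^sub>2 \<longrightarrow> infinite Z \<and> corner 0 islimpt Z) \<and>
    ((\<forall>j>0. \<forall>x\<in>SG - {corner 0}. P j 1 x > 0) \<and> t\<^sub>1 \<le> t\<^sub>2 \<and> t\<^sub>1 \<le> t\<^sub>3 \<longrightarrow>
      (\<exists>U. openin (top_of_set SG) U \<and> corner 0 \<in> U \<and> Z \<inter> U \<subseteq> {corner 0}))"
proof (intro conjI impI)
  define t where "t = (\<lambda>k::nat. if k = 1 then t\<^sub>1 else if k = 2 then t\<^sub>2 else t\<^sub>3)"
  have zero: "c j k = 0" if "k \<in> {1, 2, 3}" "j < t k" for j k
    using that start1(1) start2(1) start3(1) by (auto simp: t_def split: if_splits)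
  have power_le: "(5::real) ^ a * 5 ^ n \<le> 5 ^ b" if "a + n \<le> b" for a b n :: nat
    using power_increasing[OF that, of "5::real"] by (simp add: power_add)
  have power_le_3: "(5::real) ^ a * 5 ^ n \<le> 3 * 5 ^ b" if "a + n \<le> b" for a b n :: nat
    using power_le[OF that] zero_le_power[of "5::real" b] by linarith
  {
    assume *: "int t\<^sub>3 < int t\<^sub>1 - 1 \<and> t\<^sub>3 < t\<^sub>2"
    \<comment> \<open>The quotients of scales are 5^(t_3 + 1 - t_1) <= 1/5 for k = 1 and 3 * 5^(t_3
      - t_2) <= 3/5 for k = 2.\<close>
    have dom: "ratio k / 5 ^ t k \<le> 3/5 * (ratio 3 / 5 ^ t 3)" if "k \<in> {1, 2, 3}" "k \<noteq> 3" for k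
      using that * power_le[of t\<^sub>3 2 t\<^sub>1] power_le[of t\<^sub>3 1 t\<^sub>2]
          power_le_3[of t\<^sub>3 2 t\<^sub>1]
      by (auto simp: ratio_def t_def field_simps)
    have "c (t 3) 3 \<noteq> 0" using start3(2) by (simp add: t_def)
    from zeros_accumulate[OF f zero this dom] show "corner 0 islimpt Z"
      unfolding Z .
    then show "infinite Z"
      using islimpt_finite by blast
  }
  assume *: "(\<forall>j>0. \<forall>x\<in>SG - {corner 0}. P j 1 x > 0) \<and> t\<^sub>1 \<le> t\<^sub>2 \<and> t\<^sub>1 \<le> t\<^sub>3"
  have pos: "P (t 1) 1 x > 0" if "x \<in> far" for x
  proof (cases "t\<^sub>1 = 0")
    case True
    \<comment> \<open>Positivity is assumed for j > 0 only; \<open>P 0 1\<close> is the constant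
      1.\<close>
    have "P 0 1 x = harmonic_ext (\<lambda>i. 1) x"
      using P_0[of 1 x] far_subset_SG that by (auto simp: corner_values_def[abs_def])
    then show ?thesis
      using True harm_const[of x 1] far_subset_SG that by (auto simp: t_def)
  next
    case False
    have "x \<noteq> corner 0" using bary_far[OF that] bary_corner[of 0 0] by auto
    with * False that far_subset_SG show ?thesis by (auto simp: t_def)
  qed
  \<comment> \<open>The quotients are (3/5) * 5^(t_1 - t_2) for k = 2 and (1/5) * 5^(t_1 - t_3) for
    k = 3; the margin 3/5 is attained when t_1 = t_2.\<close>
  have dom: "ratio k / 5 ^ t k \<le> 3/5 * (ratio 1 / 5 ^ t 1)" if "k \<in> {1, 2, 3}" "k \<noteq> 1" for k
    using that * power_le[of t\<^sub>1 0 t\<^sub>2] power_le[of t\<^sub>1 0 t\<^sub>3]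
      power_le_3[of t\<^sub>1 0 t\<^sub>3]
    by (auto simp: ratio_def t_def field_simps)
  have "c (t 1) 1 \<noteq> 0" using start1(2) by (simp add: t_def)
  from zero_isolated[OF f zero this dom pos]
  show "\<exists>U. openin (top_of_set SG) U \<and> corner 0 \<in> U \<and> Z \<inter> U \<subseteq> {corner 0}"
    unfolding Z .
qed

end
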